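(* An oriented bond matroid $\vec{M}$ is non-even if and only if none of its $\mathsf{GB}$-minors is isomorphic to $M^\ast(\vec{K}_{m,n})$ for any $m,n\ge 2$ such that $m+n$ is odd.
   Context: An oriented matroid is given by a ground set and a family of signed circuits $(C^+,C^-)$; its signed cocircuits are the signed sets whose supports are the cocircuits of the underlying matroid and which satisfy the usual orthogonality with all signed circuits. A (signed) circuit is directed if one of its parts is empty. For a digraph $D$, $M^\ast(D)$ is the oriented bond matroid on $E(D)$: for each bond (minimal nonempty edge cut) $S=D[X,Y]$, with $S^+$ the edges from $X$ to $Y$ and $S^-$ those from $Y$ to $X$, both $(S^+,S^-)$ and $(S^-,S^+)$ are signed circuits. An oriented bond matroid is one isomorphic to some $M^\ast(D)$. $\vec{K}_{m,n}$ is the complete bipartite graph $K_{m,n}$ with all edges oriented from the side of size $m$ to the side of size $n$. An oriented matroid is non-even if its underlying matroid is regular and there is a set $J$ of elements such that every directed circuit meets $J$ in an odd number of elements. An element $e$ of an orientation $\vec{M}$ of a regular matroid $M$ is butterfly-contractible if there is a cocircuit $S$ of $M$ with $(S\setminus\{e\},\{e\})$ a signed cocircuit of $\vec{M}$. A $\mathsf{GB}$-minor of $\vec{M}$ is any oriented matroid obtained by a finite sequence of element deletions and contractions of butterfly-contractible elements. *)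

theory Defs
  imports "Graph_Theory.Digraph" "Jordan_Normal_Form.Determinant"
begin

section \<open>Matroids\<close>

record 'a matroid =
  ground :: "'a set"
  circuits :: "'a set set"

definition indep :: "'a matroid \<Rightarrow> 'a set \<Rightarrow> bool" where
  "indep M X \<longleftrightarrow> X \<subseteq> ground M \<and> (\<forall>C\<in>circuits M. \<not> C \<subseteq> X)"

definition basis :: "'a matroid \<Rightarrow> 'a set \<Rightarrow> bool" where
  "basis M B \<longleftrightarrow> indep M B \<and> (\<forall>X. indep M X \<and> B \<subseteq> X \<longrightarrow> X = B)"

text \<open>The bases of the dual matroid are the complements of the bases.\<close>

definition coindep :: "'a matroid \<Rightarrow> 'a set \<Rightarrow> bool" where
  "coindep M X \<longleftrightarrow> (\<exists>B. basis M B \<and> X \<subseteq> ground M - B)"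

definition cocircuit :: "'a matroid \<Rightarrow> 'a set \<Rightarrow> bool" where
  "cocircuit M S \<longleftrightarrow> S \<subseteq> ground M \<and> \<not> coindep M S \<and> (\<forall>T. T \<subset> S \<longrightarrow> coindep M T)"

text \<open>
  Real matrices with rows \<open>0, \<dots>, r - 1\<close> and columns indexed by a set \<open>E\<close>. Repeated row or
  column indices only contribute submatrices of determinant \<open>0\<close>, so the selections
  \<open>f\<close> and \<open>g\<close> need not be injective.
\<close>

definition totally_unimodular :: "nat \<Rightarrow> 'a set \<Rightarrow> (nat \<Rightarrow> 'a \<Rightarrow> real) \<Rightarrow> bool" where
  "totally_unimodular r E A \<longleftrightarrow>
     (\<forall>k. \<forall>f \<in> {..<k} \<rightarrow> {..<r}. \<forall>g \<in> {..<k} \<rightarrow> E.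
        det (mat k k (\<lambda>(i, j). A (f i) (g j))) \<in> {-1, 0, 1})"

text \<open>Independence is that of the family of columns: equal columns are dependent.\<close>

definition independent_columns :: "nat \<Rightarrow> (nat \<Rightarrow> 'a \<Rightarrow> real) \<Rightarrow> 'a set \<Rightarrow> bool" where
  "independent_columns r A X \<longleftrightarrow>
     (\<forall>c :: 'a \<Rightarrow> real. (\<forall>i<r. (\<Sum>e\<in>X. c e * A i e) = 0) \<longrightarrow> (\<forall>e\<in>X. c e = 0))"

definition regular_matroid :: "'a matroid \<Rightarrow> bool" where
  "regular_matroid M \<longleftrightarrow>
     (\<exists>r A. totally_unimodular r (ground M) A \<and>
            (\<forall>X \<subseteq> ground M. indep M X \<longleftrightarrow> independent_columns r A X))"

section \<open>Oriented matroids\<close>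

text \<open>A signed set is a pair consisting of its positive and its negative part.\<close>

type_synonym 'a signed_set = "'a set \<times> 'a set"

definition supp :: "'a signed_set \<Rightarrow> 'a set" where
  "supp C = fst C \<union> snd C"

definition opposite :: "'a signed_set \<Rightarrow> 'a signed_set" where
  "opposite C = (snd C, fst C)"

definition orthogonal :: "'a signed_set \<Rightarrow> 'a signed_set \<Rightarrow> bool" where
  "orthogonal C S \<longleftrightarrow>
     ((fst C \<inter> fst S) \<union> (snd C \<inter> snd S) = {} \<longleftrightarrow> (fst C \<inter> snd S) \<union> (snd C \<inter> fst S) = {})"

record 'a oriented_matroid =
  elements :: "'a set"
  signed_circuits :: "'a signed_set set"

locale oriented_matroid =
  fixes M :: "'a oriented_matroid"
  assumes finite_elements: "finite (elements M)"
    and signed_circuit_subset: "C \<in> signed_circuits M \<Longrightarrow> supp C \<subseteq> elements M"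
    and signed_circuit_disjoint: "C \<in> signed_circuits M \<Longrightarrow> fst C \<inter> snd C = {}"
    and signed_circuit_nonempty: "C \<in> signed_circuits M \<Longrightarrow> supp C \<noteq> {}"
    and signed_circuit_opposite: "C \<in> signed_circuits M \<Longrightarrow> opposite C \<in> signed_circuits M"
    and signed_circuit_incomparable:
      "\<lbrakk>C \<in> signed_circuits M; C' \<in> signed_circuits M; supp C \<subseteq> supp C'\<rbrakk>
        \<Longrightarrow> C = C' \<or> C = opposite C'"
    and signed_circuit_elimination:
      "\<lbrakk>C \<in> signed_circuits M; C' \<in> signed_circuits M; C \<noteq> opposite C'; e \<in> fst C \<inter> snd C'\<rbrakk>
        \<Longrightarrow> \<exists>Z \<in> signed_circuits M. fst Z \<subseteq> (fst C \<union> fst C') - {e} \<and>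
                                    snd Z \<subseteq> (snd C \<union> snd C') - {e}"

definition underlying_matroid :: "'a oriented_matroid \<Rightarrow> 'a matroid" where
  "underlying_matroid M = \<lparr>ground = elements M, circuits = supp ` signed_circuits M\<rparr>"

definition signed_cocircuit :: "'a oriented_matroid \<Rightarrow> 'a signed_set \<Rightarrow> bool" where
  "signed_cocircuit M S \<longleftrightarrow>
     fst S \<inter> snd S = {} \<and> cocircuit (underlying_matroid M) (supp S) \<and>
     (\<forall>C\<in>signed_circuits M. orthogonal C S)"

definition directed_circuit :: "'a oriented_matroid \<Rightarrow> 'a signed_set \<Rightarrow> bool" where
  "directed_circuit M C \<longleftrightarrow> C \<in> signed_circuits M \<and> (fst C = {} \<or> snd C = {})"

definition non_even :: "'a oriented_matroid \<Rightarrow> bool" where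
  "non_even M \<longleftrightarrow>
     regular_matroid (underlying_matroid M) \<and>
     (\<exists>J \<subseteq> elements M. \<forall>C. directed_circuit M C \<longrightarrow> odd (card (supp C \<inter> J)))"

definition om_iso :: "'a oriented_matroid \<Rightarrow> 'b oriented_matroid \<Rightarrow> bool" where
  "om_iso M N \<longleftrightarrow>
     (\<exists>f. bij_betw f (elements M) (elements N) \<and>
          signed_circuits N = (\<lambda>C. (f ` fst C, f ` snd C)) ` signed_circuits M)"

section \<open>Generalised butterfly minors\<close>

definition om_delete :: "'a oriented_matroid \<Rightarrow> 'a \<Rightarrow> 'a oriented_matroid" where
  "om_delete M e =
     \<lparr>elements = elements M - {e},
      signed_circuits = {C \<in> signed_circuits M. e \<notin> supp C}\<rparr>"

definition om_contract :: "'a oriented_matroid \<Rightarrow> 'a \<Rightarrow> 'a oriented_matroid" where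
  "om_contract M e =
     (let \<C> = {(fst C - {e}, snd C - {e}) | C. C \<in> signed_circuits M \<and> supp C \<noteq> {e}}
      in \<lparr>elements = elements M - {e},
          signed_circuits = {C \<in> \<C>. \<forall>C'\<in>\<C>. \<not> supp C' \<subset> supp C}\<rparr>)"

definition butterfly_contractible :: "'a oriented_matroid \<Rightarrow> 'a \<Rightarrow> bool" where
  "butterfly_contractible M e \<longleftrightarrow>
     e \<in> elements M \<and>
     (\<exists>S. cocircuit (underlying_matroid M) S \<and> signed_cocircuit M (S - {e}, {e}))"

inductive gb_minor :: "'a oriented_matroid \<Rightarrow> 'a oriented_matroid \<Rightarrow> bool"
  for M :: "'a oriented_matroid" where
  gb_minor_refl: "gb_minor M M"
| gb_minor_delete: "\<lbrakk>gb_minor M N; e \<in> elements N\<rbrakk> \<Longrightarrow> gb_minor M (om_delete N e)"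
| gb_minor_contract: "\<lbrakk>gb_minor M N; butterfly_contractible N e\<rbrakk> \<Longrightarrow> gb_minor M (om_contract N e)"

section \<open>Oriented bond matroids\<close>

definition arcs_between :: "('v, 'e) pre_digraph \<Rightarrow> 'v set \<Rightarrow> 'v set \<Rightarrow> 'e set" where
  "arcs_between D X Y = {e \<in> arcs D. tail D e \<in> X \<and> head D e \<in> Y}"

definition edge_cut :: "('v, 'e) pre_digraph \<Rightarrow> 'v set \<Rightarrow> 'e set" where
  "edge_cut D X = arcs_between D X (verts D - X) \<union> arcs_between D (verts D - X) X"

definition bond :: "('v, 'e) pre_digraph \<Rightarrow> 'e set \<Rightarrow> bool" where
  "bond D S \<longleftrightarrow>
     S \<noteq> {} \<and> (\<exists>X \<subseteq> verts D. S = edge_cut D X) \<and>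
     (\<forall>X \<subseteq> verts D. edge_cut D X \<subseteq> S \<and> edge_cut D X \<noteq> {} \<longrightarrow> edge_cut D X = S)"

text \<open>Exchanging \<open>X\<close> and its complement yields the opposite signed circuit.\<close>

definition bond_matroid :: "('v, 'e) pre_digraph \<Rightarrow> 'e oriented_matroid" where
  "bond_matroid D =
     \<lparr>elements = arcs D,
      signed_circuits =
        {(arcs_between D X (verts D - X), arcs_between D (verts D - X) X) | X.
           X \<subseteq> verts D \<and> bond D (edge_cut D X)}\<rparr>"

text \<open>
  Digraphs are finite and may have loops and parallel arcs. Vertices and arcs are taken to be
  natural numbers only because a definition cannot quantify over types; by
  \<open>oriented_bond_matroidI\<close> below this is no restriction.
\<close>

definition oriented_bond_matroid :: "'a oriented_matroid \<Rightarrow> bool" where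
  "oriented_bond_matroid M \<longleftrightarrow>
     oriented_matroid M \<and>
     (\<exists>D :: (nat, nat) pre_digraph. fin_digraph D \<and> om_iso M (bond_matroid D))"

definition complete_bipartite_dir :: "nat \<Rightarrow> nat \<Rightarrow> (nat + nat, nat \<times> nat) pre_digraph" where
  "complete_bipartite_dir m n =
     \<lparr>verts = Inl ` {..<m} \<union> Inr ` {..<n},
      arcs = {..<m} \<times> {..<n},
      tail = (\<lambda>e. Inl (fst e)),
      head = (\<lambda>e. Inr (snd e))\<rparr>"

lemma om_iso_trans:
  assumes "om_iso L M" "om_iso M N"
  shows "om_iso L N"
proof -
  obtain f g where f: "bij_betw f (elements L) (elements M)"
      "signed_circuits M = (\<lambda>C. (f ` fst C, f ` snd C)) ` signed_circuits L"
    and g: "bij_betw g (elements M) (elements N)"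
      "signed_circuits N = (\<lambda>C. (g ` fst C, g ` snd C)) ` signed_circuits M"
    using assms unfolding om_iso_def by blast
  have "bij_betw (g \<circ> f) (elements L) (elements N)"
    using f(1) g(1) by (rule bij_betw_trans)
  moreover have "signed_circuits N =
      (\<lambda>C. ((g \<circ> f) ` fst C, (g \<circ> f) ` snd C)) ` signed_circuits L"
    unfolding f(2) g(2) by (simp add: image_image image_comp)
  ultimately show ?thesis unfolding om_iso_def by blast
qed

lemma bond_matroid_relabel:
  fixes D :: "('v, 'e) pre_digraph" and p :: "'v \<Rightarrow> 'w" and q :: "'e \<Rightarrow> 'f"
  assumes "wf_digraph D" and p: "inj_on p (verts D)" and q: "inj_on q (arcs D)"
  defines "D' \<equiv> \<lparr>verts = p ` verts D, arcs = q ` arcs D,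
    tail = (\<lambda>a. p (tail D (the_inv_into (arcs D) q a))),
    head = (\<lambda>a. p (head D (the_inv_into (arcs D) q a)))\<rparr>"
  shows "wf_digraph D'" and "om_iso (bond_matroid D) (bond_matroid D')"
proof -
  interpret wf_digraph D by fact
  have inv: "the_inv_into (arcs D) q (q a) = a" if "a \<in> arcs D" for a
    using q that by (rule the_inv_into_f_f)
  show "wf_digraph D'"
    by unfold_locales (auto simp: D'_def inv)
  have mem: "p v \<in> p ` X \<longleftrightarrow> v \<in> X" if "v \<in> verts D" "X \<subseteq> verts D" for v X
    using p that by (rule inj_on_image_mem_iff)
  have btw: "arcs_between D' (p ` X) (p ` Y) = q ` arcs_between D X Y"
    if "X \<subseteq> verts D" "Y \<subseteq> verts D" for X Y
  proof -
    have "arcs_between D' (p ` X) (p ` Y) =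
        q ` {e \<in> arcs D. p (tail D e) \<in> p ` X \<and> p (head D e) \<in> p ` Y}"
      unfolding arcs_between_def D'_def by (auto simp: inv simp del: image_iff)
    also have "\<dots> = q ` arcs_between D X Y"
      using that by (simp add: arcs_between_def mem cong: conj_cong)
    finally show ?thesis .
  qed
  have V: "verts D' - p ` X = p ` (verts D - X)" if "X \<subseteq> verts D" for X
    using p that by (simp add: D'_def inj_on_image_set_diff)
  have cut: "edge_cut D' (p ` X) = q ` edge_cut D X" if "X \<subseteq> verts D" for X
    using that by (simp add: edge_cut_def V btw image_Un)
  have sub: "edge_cut D X \<subseteq> arcs D" for X
    by (auto simp: edge_cut_def arcs_between_def)
  have ex: "(\<exists>X \<subseteq> verts D'. P X) \<longleftrightarrow> (\<exists>X \<subseteq> verts D. P (p ` X))" for P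
    by (auto simp: D'_def subset_image_iff)
  have all: "(\<forall>X \<subseteq> verts D'. P X) \<longleftrightarrow> (\<forall>X \<subseteq> verts D. P (p ` X))" for P
    using ex[of "\<lambda>X. \<not> P X"] by blast
  have le: "q ` A \<subseteq> q ` B \<longleftrightarrow> A \<subseteq> B" if "A \<subseteq> arcs D" "B \<subseteq> arcs D" for A B
  proof
    assume *: "q ` A \<subseteq> q ` B"
    show "A \<subseteq> B"
    proof
      fix a assume "a \<in> A"
      then show "a \<in> B"
        using * that inj_on_image_mem_iff[OF q, of a B] by blast
    qed
  qed blast
  have eq: "q ` A = q ` B \<longleftrightarrow> A = B" if "A \<subseteq> arcs D" "B \<subseteq> arcs D" for A B
    using that q by (simp add: inj_on_image_eq_iff)
  have bond: "bond D' (edge_cut D' (p ` X)) \<longleftrightarrow> bond D (edge_cut D X)" if "X \<subseteq> verts D" for X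
  proof -
    have 1: "(\<exists>Y \<subseteq> verts D. edge_cut D' (p ` X) = edge_cut D' (p ` Y)) \<longleftrightarrow>
        (\<exists>Y \<subseteq> verts D. edge_cut D X = edge_cut D Y)"
      using that by blast
    have 2: "(edge_cut D' (p ` Y) \<subseteq> edge_cut D' (p ` X) \<and> edge_cut D' (p ` Y) \<noteq> {} \<longrightarrow>
          edge_cut D' (p ` Y) = edge_cut D' (p ` X)) \<longleftrightarrow>
        (edge_cut D Y \<subseteq> edge_cut D X \<and> edge_cut D Y \<noteq> {} \<longrightarrow> edge_cut D Y = edge_cut D X)"
      if "Y \<subseteq> verts D" for Y
      unfolding cut[OF \<open>X \<subseteq> verts D\<close>] cut[OF that] le[OF sub sub] eq[OF sub sub] by simp
    have 3: "edge_cut D' (p ` X) = {} \<longleftrightarrow> edge_cut D X = {}"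
      using cut[OF that] by simp
    show ?thesis
      unfolding bond_def ex all 1 3 by (intro arg_cong2[where f = conj] all_cong1 imp_cong[OF refl] refl 2)
  qed
  have "bij_betw q (elements (bond_matroid D)) (elements (bond_matroid D'))"
    using q by (simp add: bond_matroid_def D'_def inj_on_imp_bij_betw)
  moreover have "signed_circuits (bond_matroid D') =
      (\<lambda>C. (q ` fst C, q ` snd C)) ` signed_circuits (bond_matroid D)" (is "?L = ?R")
  proof -
    have "?L = {C. \<exists>X \<subseteq> verts D'. bond D' (edge_cut D' X) \<and>
        C = (arcs_between D' X (verts D' - X), arcs_between D' (verts D' - X) X)}"
      unfolding bond_matroid_def by auto
    also have "\<dots> = {C. \<exists>X \<subseteq> verts D. bond D (edge_cut D X) \<and>
        C = (q ` arcs_between D X (verts D - X), q ` arcs_between D (verts D - X) X)}"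
    proof -
      have "(arcs_between D' (p ` X) (verts D' - p ` X), arcs_between D' (verts D' - p ` X) (p ` X)) =
          (q ` arcs_between D X (verts D - X), q ` arcs_between D (verts D - X) X)"
        if "X \<subseteq> verts D" for X
        using that by (simp add: V btw)
      then show ?thesis
        unfolding ex by (intro Collect_cong ex_cong1 conj_cong refl) (simp_all only: bond)
    qed
    also have "\<dots> = ?R"
    proof -
      have "signed_circuits (bond_matroid D) =
          (\<lambda>X. (arcs_between D X (verts D - X), arcs_between D (verts D - X) X)) `
            {X. X \<subseteq> verts D \<and> bond D (edge_cut D X)}"
        unfolding bond_matroid_def by auto
      then show ?thesis
        by (simp only: image_image fst_conv snd_conv) blast
    qed
    finally show ?thesis .
  qed
  ultimately show "om_iso (bond_matroid D) (bond_matroid D')"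
    unfolding om_iso_def by blast
qed

lemma oriented_bond_matroidI:
  fixes D :: "('v, 'e) pre_digraph"
  assumes "oriented_matroid M" "fin_digraph D" "om_iso M (bond_matroid D)"
  shows "oriented_bond_matroid M"
proof -
  interpret fin_digraph D by fact
  obtain p :: "'v \<Rightarrow> nat" where p: "inj_on p (verts D)"
    using finite_imp_inj_to_nat_seg[OF finite_verts] by blast
  obtain q :: "'e \<Rightarrow> nat" where q: "inj_on q (arcs D)"
    using finite_imp_inj_to_nat_seg[OF finite_arcs] by blast
  note D' = bond_matroid_relabel[OF wf_digraph p q]
  show ?thesis
    unfolding oriented_bond_matroid_def
    using assms(1) om_iso_trans[OF assms(3) D'(2)] wf_digraph.fin_digraphI[OF D'(1)] by auto
qed

end

theory Submission
  imports Defs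
begin

text \<open>
  Deleting an element of \<open>M\<^sup>*(D)\<close> contracts an arc of \<open>D\<close>, and the butterfly-contractible elements are
  the arcs parallel to a directed path, which may be deleted from \<open>D\<close>. Non-evenness says that some
  arc set \<open>J\<close> meets every dibond in an odd number of arcs. It passes to minors since \<open>J\<close> may be
  changed by the cycle formed by such an arc and path, and it fails for \<open>K\<^sub>m\<^sub>,\<^sub>n\<close> with \<open>m + n\<close> odd
  because the \<open>m + n\<close> vertex stars are dibonds that cover every arc twice.

  Conversely let \<open>D\<close> be minimal without such a \<open>J\<close>. If all dibonds are vertex stars, then every
  vertex star is a dibond and the number of vertices is odd, as otherwise \<open>J\<close> would be obtained from
  paths; all vertices are then sources or sinks, and completeness follows from a dicut around the
  neighbourhood of a source. Otherwise let \<open>Y\<close> be a dibond with arcs on both of its sides. The sets \<open>J\<close>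
  of the contractions of the two sides can be made to agree on \<open>Y\<close> and be glued together; a dibond
  \<open>I\<close> on which the result fails crosses \<open>Y\<close>. Uncrossing \<open>I\<close> and \<open>Y\<close> gives a contradiction in the
  contraction of any arc lying in neither dibond, so every arc lies in one of them. The
  four parts cut out by \<open>I\<close> and \<open>Y\<close> are therefore independent sets, and the same argument for
  further dibonds forces the parts \<open>I - Y\<close> and \<open>Y - I\<close> to be single vertices, adjacent to all the
  others. Up to a twist at these two vertices this is \<open>K\<^sub>2\<^sub>,\<^sub>n\<close> with \<open>n\<close> odd.
\<close>

section \<open>Cuts and bonds of arc systems\<close>

text \<open>All parity arguments are linear algebra over GF(2): adding to \<open>J\<close> an arc
  set that meets every cut evenly changes nothing, so paths and cycles enter only through
  \<open>joins\<close>. The obstacle to uncrossing is that the cuts around the intersection and the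
  union of two dibonds are directed but need not be bonds. They split into dibonds, however, and the
  parity of their number depends on the digraph alone. A relation found with one faulty
  \<open>J\<close> can therefore be tested against the correct set of a contraction. The bond
  matroid does not determine the digraph, so one of the two final isomorphisms has to be read off
  from the signed circuits. Since non-evenness includes regularity, a totally unimodular
  representation is constructed as well.\<close>

lemma odd_card_sym_diff:
  assumes "finite A" "finite B"
  shows "odd (card (C \<inter> (A - B \<union> (B - A)))) \<longleftrightarrow> odd (card (C \<inter> A)) \<noteq> odd (card (C \<inter> B))"
proof -
  have 1: "card (C \<inter> A) = card (C \<inter> (A - B)) + card (C \<inter> A \<inter> B)"
    by (subst card_Un_disjoint[symmetric]) (use assms in \<open>auto intro!: arg_cong[where f = card]\<close>)
  have 2: "card (C \<inter> B) = card (C \<inter> (B - A)) + card (C \<inter> A \<inter> B)"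
    by (subst card_Un_disjoint[symmetric]) (use assms in \<open>auto intro!: arg_cong[where f = card]\<close>)
  have 3: "card (C \<inter> (A - B \<union> (B - A))) = card (C \<inter> (A - B)) + card (C \<inter> (B - A))"
    by (subst card_Un_disjoint[symmetric]) (use assms in \<open>auto intro!: arg_cong[where f = card]\<close>)
  show ?thesis unfolding 1 2 3 by auto
qed

text \<open>
  A digraph without isolated vertices, given by its arcs alone; \<open>bmat\<close> is its oriented bond matroid.
\<close>

locale arc_system =
  fixes E :: "'a set" and t h :: "'a \<Rightarrow> 'v"
begin

definition leave :: "'v set \<Rightarrow> 'a set" where
  "leave X = {e \<in> E. t e \<in> X \<and> h e \<notin> X}"

definition cut :: "'v set \<Rightarrow> 'a set" where
  "cut X = {e \<in> E. (t e \<in> X) \<noteq> (h e \<in> X)}"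

definition is_bond :: "'v set \<Rightarrow> bool" where
  "is_bond X \<longleftrightarrow> cut X \<noteq> {} \<and> (\<forall>Z. cut Z \<subseteq> cut X \<and> cut Z \<noteq> {} \<longrightarrow> cut Z = cut X)"

definition upset :: "'v set \<Rightarrow> bool" where
  "upset X \<longleftrightarrow> (\<forall>e\<in>E. t e \<in> X \<longrightarrow> h e \<in> X)"

definition dibond :: "'v set \<Rightarrow> bool" where
  "dibond X \<longleftrightarrow> upset X \<and> is_bond X"

definition ends :: "'v set" where
  "ends = t ` E \<union> h ` E"

text \<open>Connectivity of the subgraph induced on \<open>X\<close>, phrased through its cuts.\<close>

definition conn :: "'v set \<Rightarrow> bool" where
  "conn X \<longleftrightarrow>
     (\<forall>Z. (\<forall>e\<in>E. t e \<in> X \<and> h e \<in> X \<longrightarrow> (t e \<in> Z \<longleftrightarrow> h e \<in> Z)) \<longrightarrow>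
          X \<inter> ends \<subseteq> Z \<or> X \<inter> ends \<inter> Z = {})"

text \<open>This is the parity condition of \<open>non_even\<close> for \<open>bmat\<close> (see
  \<open>has_odd_join_iff\<close>); \<open>regular_bmat\<close> supplies the other
  condition.\<close>

definition has_odd_join :: bool where
  "has_odd_join \<longleftrightarrow> (\<exists>J\<subseteq>E. \<forall>X. dibond X \<longrightarrow> odd (card (cut X \<inter> J)))"

definition bmat :: "'a oriented_matroid" where
  "bmat = \<lparr>elements = E, signed_circuits = {(leave X, leave (- X)) | X. is_bond X}\<rparr>"

text \<open>
  In the bond matroid this is butterfly-contractibility; it says that some directed path avoiding
  \<open>e\<close> leads from the tail of \<open>e\<close> to its head.
\<close>

definition transitive_arc :: "'a \<Rightarrow> bool" where
  "transitive_arc e \<longleftrightarrow> e \<in> E \<and> (\<forall>X. e \<in> leave X \<longrightarrow> (\<exists>f\<in>leave X. f \<noteq> e))"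

text \<open>Modulo 2, \<open>P\<close> is a path from \<open>u\<close> to \<open>v\<close>.\<close>

definition joins :: "'a set \<Rightarrow> 'v \<Rightarrow> 'v \<Rightarrow> bool" where
  "joins P u v \<longleftrightarrow> (\<forall>Z. odd (card (cut Z \<inter> P)) \<longleftrightarrow> (u \<in> Z) \<noteq> (v \<in> Z))"

lemma conn_cases:
  assumes "conn X"
    and "\<And>e. e \<in> E \<Longrightarrow> t e \<in> X \<Longrightarrow> h e \<in> X \<Longrightarrow> t e \<in> Z \<longleftrightarrow> h e \<in> Z"
  shows "X \<inter> ends \<subseteq> Z \<or> X \<inter> ends \<inter> Z = {}"
  using assms(1)[unfolded conn_def, rule_format, of Z] assms(2) by blast

lemma cut_eq_leave: "cut X = leave X \<union> leave (- X)"
  by (auto simp: cut_def leave_def)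

lemma cut_Compl [simp]: "cut (- X) = cut X"
  by (auto simp: cut_def)

lemma is_bond_Compl [simp]: "is_bond (- X) \<longleftrightarrow> is_bond X"
  by (simp add: is_bond_def)

lemma leave_disjoint: "leave X \<inter> leave (- X) = {}"
  by (auto simp: leave_def)

lemma leave_subset: "leave X \<subseteq> E"
  by (auto simp: leave_def)

lemma cut_subset: "cut X \<subseteq> E"
  by (auto simp: cut_def)

lemma upset_iff_leave: "upset X \<longleftrightarrow> leave X = {}"
  by (auto simp: upset_def leave_def)

lemma cut_upset: "upset X \<Longrightarrow> cut X = leave (- X)"
  by (auto simp: upset_def leave_def cut_def)

lemma cut_sym_diff: "cut (X - Y \<union> (Y - X)) = cut X - cut Y \<union> (cut Y - cut X)"
  by (auto simp: cut_def)

lemma elements_bmat [simp]: "elements bmat = E"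
  by (simp add: bmat_def)

lemma signed_circuits_bmat: "signed_circuits bmat = {(leave X, leave (- X)) | X. is_bond X}"
  by (simp add: bmat_def)

lemma supp_leave: "supp (leave X, leave (- X)) = cut X"
  by (simp add: supp_def cut_eq_leave)

lemma finer_leave_imp_cut:
  "leave Y \<subseteq> leave X \<Longrightarrow> leave (- Y) \<subseteq> leave (- X) \<Longrightarrow> cut Y \<subseteq> cut X"
  by (auto simp: cut_eq_leave)

text \<open>The definition speaks of \<open>leave X\<close> only; applied to \<open>X\<close> or to
  its complement it excludes cuts consisting of a transitive arc alone.\<close>

lemma transitive_arc_enter:
  assumes "transitive_arc e" "e \<in> cut X"
  shows "\<exists>f\<in>cut X. f \<noteq> e"
proof -
  have "e \<in> leave X \<or> e \<in> leave (- X)" using assms(2) by (auto simp: cut_eq_leave)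
  then show ?thesis using assms(1) unfolding transitive_arc_def cut_eq_leave by blast
qed

end

locale fin_arc_system = arc_system +
  assumes finite_E: "finite E"
begin

lemma finite_cut [simp]: "finite (cut X)"
  using finite_E cut_subset by (rule rev_finite_subset)

lemma finite_ends: "finite ends"
  using finite_E by (simp add: ends_def)

text \<open>
  A cut that is minimal among those refining \<open>X\<close> with signs is a bond: if \<open>cut Z \<subset> cut Y\<close>, then one
  of the four regions into which \<open>Y\<close> and \<open>Z\<close> divide the vertices would give a smaller one.
\<close>

lemma bond_refines_cut:
  assumes "e \<in> leave X"
  obtains Y where "is_bond Y" "e \<in> leave Y" "leave Y \<subseteq> leave X" "leave (- Y) \<subseteq> leave (- X)"
proof -
  define good where
    "good Y \<longleftrightarrow> e \<in> leave Y \<and> leave Y \<subseteq> leave X \<and> leave (- Y) \<subseteq> leave (- X)" for Y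
  have "good X" using assms by (auto simp: good_def)
  then obtain Y where Y: "good Y" and min: "\<And>Z. good Z \<Longrightarrow> card (cut Y) \<le> card (cut Z)"
    using ex_has_least_nat[of good X "\<lambda>Y. card (cut Y)"] by blast
  have same: "cut Z = cut Y" if "good Z" "cut Z \<subseteq> cut Y" for Z
    using card_seteq[OF finite_cut that(2) min[OF that(1)]] .
  have "is_bond Y"
    unfolding is_bond_def
  proof (intro conjI allI impI)
    show "cut Y \<noteq> {}" using Y by (auto simp: good_def cut_eq_leave)
    fix Z assume Z: "cut Z \<subseteq> cut Y \<and> cut Z \<noteq> {}"
    show "cut Z = cut Y"
    proof (rule ccontr)
      assume ne: "cut Z \<noteq> cut Y"
      have Zarc: "(t f \<in> Z) = (h f \<in> Z) \<or> (t f \<in> Y) \<noteq> (h f \<in> Y)" if "f \<in> E" for f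
        using Z that by (auto simp: cut_def)
      have sub: "leave W \<subseteq> leave Y \<and> leave (- W) \<subseteq> leave (- Y)"
        if "W \<in> {Y \<inter> Z, Y - Z, - (Z - Y), - (- Y - Z)}" for W
        using that Zarc by (auto simp: leave_def)
      have eq: "cut W = cut Y" if "W \<in> {Y \<inter> Z, Y - Z, - (Z - Y), - (- Y - Z)}" "e \<in> leave W" for W
      proof (rule same)
        show "good W" using Y sub[OF that(1)] that(2) unfolding good_def by blast
        show "cut W \<subseteq> cut Y" using sub[OF that(1)] by (simp add: finer_leave_imp_cut)
      qed
      have e: "e \<in> E" "t e \<in> Y" "h e \<notin> Y" using Y by (auto simp: good_def leave_def)
      obtain f where f: "f \<in> cut Z" "f \<in> cut Y" using Z by blast
      obtain g where g: "g \<notin> cut Z" "g \<in> cut Y" using Z ne by blast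
      \<comment> \<open>\<open>W1\<close> is the region of \<open>Y\<close> holding
        \<open>t e\<close>, and \<open>W2\<close> the complement of the region of \<open>- Y\<close>
        holding \<open>h e\<close>. Minimality makes every arc of \<open>cut Y\<close> join these
        two regions, so \<open>f\<close> and \<open>g\<close> cannot differ on whether they cross
        \<open>Z\<close>.\<close>
      define W1 W2 where "W1 = (if t e \<in> Z then Y \<inter> Z else Y - Z)"
        and "W2 = (if h e \<in> Z then - (Z - Y) else - (- Y - Z))"
      have "cut W1 = cut Y" "cut W2 = cut Y"
        using e by (auto intro!: eq simp: W1_def W2_def leave_def)
      then have "f \<in> cut W1" "f \<in> cut W2" "g \<in> cut W1" "g \<in> cut W2" using f g by auto
      then show False using f g e Zarc[of f] Zarc[of g]
        by (auto simp: W1_def W2_def cut_def split: if_splits)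
    qed
  qed
  with that Y show thesis unfolding good_def by blast
qed

section \<open>Paths modulo 2 and connected vertex sets\<close>

lemma joins_extend:
  assumes "finite P" "f \<in> E" "joins P u v" "{t f, h f} = {v, w}"
  shows "joins (P - {f} \<union> ({f} - P)) u w"
  unfolding joins_def
proof
  fix Z
  have "odd (card (cut Z \<inter> {f})) \<longleftrightarrow> (v \<in> Z) \<noteq> (w \<in> Z)"
    using assms(2,4) by (cases "f \<in> cut Z") (auto simp: cut_def doubleton_eq_iff)
  then show "odd (card (cut Z \<inter> (P - {f} \<union> ({f} - P)))) \<longleftrightarrow> (u \<in> Z) \<noteq> (w \<in> Z)"
    using assms(3)[unfolded joins_def, rule_format, of Z]
      odd_card_sym_diff[OF assms(1), of "{f}" "cut Z"] by auto
qed

lemma joins_empty: "joins {} u u"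
  by (simp add: joins_def)

text \<open>The vertices reachable from \<open>u\<close> through arcs inside \<open>X\<close> are
  closed under these arcs, so the cut form of connectivity puts \<open>v\<close> among them.\<close>

lemma conn_joins:
  assumes "conn X" "u \<in> X \<inter> ends" "v \<in> X \<inter> ends"
  obtains P where "P \<subseteq> {e \<in> E. t e \<in> X \<and> h e \<in> X}" "joins P u v"
proof -
  define F where "F = {e \<in> E. t e \<in> X \<and> h e \<in> X}"
  define R where "R = {w. \<exists>P \<subseteq> F. joins P u w}"
  have "u \<in> R" unfolding R_def using joins_empty by blast
  have step: "w' \<in> R" if w: "w \<in> R" and f: "f \<in> F" and ww: "{t f, h f} = {w, w'}" for f w w'
  proof -
    obtain P where P: "P \<subseteq> F" "joins P u w" using w unfolding R_def by blast
    have "finite P" using P(1) finite_E by (auto simp: F_def intro: finite_subset)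
    from joins_extend[OF this _ P(2) ww] have "joins (P - {f} \<union> ({f} - P)) u w'"
      using f by (simp add: F_def)
    moreover have "P - {f} \<union> ({f} - P) \<subseteq> F" using P(1) f by blast
    ultimately show ?thesis unfolding R_def by blast
  qed
  have "t f \<in> R \<longleftrightarrow> h f \<in> R" if "f \<in> E" "t f \<in> X" "h f \<in> X" for f
    using step[of "t f" f "h f"] step[of "h f" f "t f"] that by (auto simp: F_def)
  then have "X \<inter> ends \<subseteq> R \<or> X \<inter> ends \<inter> R = {}"
    by (intro conn_cases[OF assms(1)])
  then have "X \<inter> ends \<subseteq> R" using assms(2) \<open>u \<in> R\<close> by blast
  then obtain P where "P \<subseteq> F" "joins P u v" using assms(3) unfolding R_def by blast
  then show thesis using that unfolding F_def by blast
qed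

text \<open>The set \<open>R\<close> of vertices joined to \<open>t e\<close> without
  \<open>e\<close> is left by no arc other than \<open>e\<close>; if it missed \<open>h e\<close>,
  then \<open>e\<close> would be the only arc leaving it.\<close>

lemma transitive_joins:
  assumes "transitive_arc e"
  obtains P where "P \<subseteq> E - {e}" "joins P (t e) (h e)"
proof -
  define R where "R = {w. \<exists>P \<subseteq> E - {e}. joins P (t e) w}"
  have "t e \<in> R" unfolding R_def using joins_empty by blast
  have step: "h f \<in> R" if w: "t f \<in> R" and f: "f \<in> E - {e}" for f
  proof -
    obtain P where P: "P \<subseteq> E - {e}" "joins P (t e) (t f)" using w unfolding R_def by blast
    have "finite P" using P(1) finite_E by (auto intro: finite_subset)
    from joins_extend[OF this _ P(2) refl] have "joins (P - {f} \<union> ({f} - P)) (t e) (h f)"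
      using f by simp
    moreover have "P - {f} \<union> ({f} - P) \<subseteq> E - {e}" using P(1) f by blast
    ultimately show ?thesis unfolding R_def by blast
  qed
  have "h e \<in> R"
  proof (rule ccontr)
    assume "h e \<notin> R"
    then have "e \<in> leave R" using \<open>t e \<in> R\<close> assms by (auto simp: leave_def transitive_arc_def)
    then obtain f where "f \<in> leave R" "f \<noteq> e" using assms by (auto simp: transitive_arc_def)
    then show False using step by (auto simp: leave_def)
  qed
  then show thesis using that unfolding R_def by blast
qed

text \<open>A cut contained in \<open>cut X\<close> separates no two vertices of one shore, so only
  the empty cut and \<open>cut X\<close> itself remain.\<close>

lemma is_bondI_conn:
  assumes "conn X" "conn (- X)" "cut X \<noteq> {}"
  shows "is_bond X"
  unfolding is_bond_def
proof (intro conjI allI impI)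
  fix Z assume Z: "cut Z \<subseteq> cut X \<and> cut Z \<noteq> {}"
  have "X \<inter> ends \<subseteq> Z \<or> X \<inter> ends \<inter> Z = {}"
    by (rule conn_cases[OF assms(1)]) (use Z in \<open>auto simp: cut_def\<close>)
  moreover have "- X \<inter> ends \<subseteq> Z \<or> - X \<inter> ends \<inter> Z = {}"
    by (rule conn_cases[OF assms(2)]) (use Z in \<open>auto simp: cut_def\<close>)
  moreover have "t f \<in> ends" "h f \<in> ends" if "f \<in> E" for f using that by (auto simp: ends_def)
  ultimately show "cut Z = cut X" using Z unfolding cut_def by blast
qed fact

lemma cut_nonempty:
  assumes "conn UNIV" "u \<in> ends" "u \<in> X" "v \<in> ends" "v \<notin> X"
  shows "cut X \<noteq> {}"
proof
  assume "cut X = {}"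
  then have "UNIV \<inter> ends \<subseteq> X \<or> UNIV \<inter> ends \<inter> X = {}"
    by (intro conn_cases[OF assms(1)]) (auto simp: cut_def)
  then show False using assms by blast
qed

text \<open>If \<open>Z\<close> split \<open>X\<close> along no arc, then
  \<open>X \<inter> Z\<close> and \<open>X - Z\<close> would have disjoint nonempty cuts inside
  \<open>cut X\<close>, and minimality would make both equal to \<open>cut X\<close>. Nonemptiness
  is where connectivity of the whole digraph enters.\<close>

lemma bond_conn:
  assumes "conn UNIV" "is_bond X"
  shows "conn X"
  unfolding conn_def
proof (intro allI impI)
  fix Z assume Z: "\<forall>e\<in>E. t e \<in> X \<and> h e \<in> X \<longrightarrow> (t e \<in> Z) = (h e \<in> Z)"
  show "X \<inter> ends \<subseteq> Z \<or> X \<inter> ends \<inter> Z = {}"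
  proof (rule ccontr)
    assume "\<not> ?thesis"
    then obtain u v where u: "u \<in> X" "u \<in> ends" "u \<in> Z" and v: "v \<in> X" "v \<in> ends" "v \<notin> Z" by blast
    have sub: "cut (X \<inter> Z) \<subseteq> cut X" "cut (X - Z) \<subseteq> cut X" using Z by (auto simp: cut_def)
    have "cut (X \<inter> Z) \<noteq> {}" "cut (X - Z) \<noteq> {}"
      using cut_nonempty[OF assms(1) u(2) _ v(2), of "X \<inter> Z"]
        cut_nonempty[OF assms(1) v(2) _ u(2), of "X - Z"] u v by auto
    then have "cut (X \<inter> Z) = cut X" "cut (X - Z) = cut X" "cut X \<noteq> {}"
      using assms(2) sub unfolding is_bond_def by blast+
    then show False using Z by (auto simp: cut_def)
  qed
qed

text \<open>The usual way below to verify connectivity: a connected core to which every further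
  vertex is adjacent.\<close>

lemma conn_attach:
  assumes "conn Y" "Y \<subseteq> X"
    and "\<And>v. v \<in> X \<inter> ends - Y \<Longrightarrow>
      \<exists>e\<in>E. (t e = v \<and> h e \<in> Y) \<or> (h e = v \<and> t e \<in> Y)"
  shows "conn X"
  unfolding conn_def
proof (intro allI impI)
  fix Z assume Z: "\<forall>e\<in>E. t e \<in> X \<and> h e \<in> X \<longrightarrow> (t e \<in> Z) = (h e \<in> Z)"
  have Y: "Y \<inter> ends \<subseteq> Z \<or> Y \<inter> ends \<inter> Z = {}"
    by (rule conn_cases[OF assms(1)]) (use assms(2) Z in auto)
  have in_ends: "t f \<in> ends" "h f \<in> ends" if "f \<in> E" for f using that by (auto simp: ends_def)
  have att: "\<exists>w \<in> Y \<inter> ends. w \<in> Z \<longleftrightarrow> v \<in> Z" if "v \<in> X \<inter> ends" for v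
  proof (cases "v \<in> Y")
    case False
    with that assms(3) obtain e where
      "e \<in> E" "(t e = v \<and> h e \<in> Y) \<or> (h e = v \<and> t e \<in> Y)" by blast
    then show ?thesis using Z assms(2) in_ends[of e] that by auto
  qed (use that in auto)
  show "X \<inter> ends \<subseteq> Z \<or> X \<inter> ends \<inter> Z = {}" using Y att by blast
qed

lemma conn_singleton: "conn {v}"
  by (auto simp: conn_def)

lemma conn_no_arcs:
  assumes "conn X" "\<And>e. e \<in> E \<Longrightarrow> t e \<in> X \<Longrightarrow> h e \<notin> X" "v \<in> X \<inter> ends"
  shows "X \<inter> ends = {v}"
  using conn_cases[OF assms(1), of "{v}"] assms(2,3) by blast

end

section \<open>Generalised butterfly minors of bond matroids\<close>

context arc_system
begin

text \<open>Contraction keeps the vertex type by moving the head onto the tail. The preimages under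
  \<open>merge e\<close> are exactly the vertex sets that do not separate the ends of
  \<open>e\<close>.\<close>

definition merge :: "'a \<Rightarrow> 'v \<Rightarrow> 'v" where
  "merge e v = (if v = h e then t e else v)"

lemma cut_merge:
  "arc_system.cut (E - {e}) (merge e \<circ> t) (merge e \<circ> h) X = cut (merge e -` X)"
  "e \<notin> cut (merge e -` X)"
  by (auto simp: arc_system.cut_def merge_def)

lemma leave_merge:
  "arc_system.leave (E - {e}) (merge e \<circ> t) (merge e \<circ> h) X = leave (merge e -` X)"
  by (auto simp: arc_system.leave_def merge_def)

lemma merge_vimage_eq:
  assumes "e \<in> E" "e \<notin> cut X"
  shows "merge e -` X = X"
  using assms by (auto simp: merge_def cut_def split: if_splits)

lemma is_bond_merge:
  assumes "e \<in> E"
  shows "arc_system.is_bond (E - {e}) (merge e \<circ> t) (merge e \<circ> h) X \<longleftrightarrow> is_bond (merge e -` X)"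
proof -
  have "(\<forall>Z. cut (merge e -` Z) \<subseteq> cut (merge e -` X) \<and> cut (merge e -` Z) \<noteq> {} \<longrightarrow>
          cut (merge e -` Z) = cut (merge e -` X)) \<longleftrightarrow>
        (\<forall>Z. cut Z \<subseteq> cut (merge e -` X) \<and> cut Z \<noteq> {} \<longrightarrow> cut Z = cut (merge e -` X))"
    (is "?L \<longleftrightarrow> ?R")
  proof
    assume L: ?L
    show ?R
    proof (intro allI impI)
      fix Z assume Z: "cut Z \<subseteq> cut (merge e -` X) \<and> cut Z \<noteq> {}"
      then have "e \<notin> cut Z" using cut_merge(2)[of e X] by blast
      then have eq: "merge e -` Z = Z" by (rule merge_vimage_eq[OF assms])
      show "cut Z = cut (merge e -` X)" using L[rule_format, of Z] Z unfolding eq by blast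
    qed
  qed blast
  then show ?thesis by (simp add: arc_system.is_bond_def[of "E - {e}"] is_bond_def cut_merge)
qed

lemma upset_merge:
  "arc_system.upset (E - {e}) (merge e \<circ> t) (merge e \<circ> h) X \<longleftrightarrow> upset (merge e -` X)"
  by (simp add: arc_system.upset_iff_leave leave_merge)

lemma om_delete_bmat:
  assumes "e \<in> E"
  shows "om_delete bmat e = arc_system.bmat (E - {e}) (merge e \<circ> t) (merge e \<circ> h)"
proof -
  have "{C \<in> signed_circuits bmat. e \<notin> supp C} =
      {(leave X, leave (- X)) | X. is_bond X \<and> e \<notin> cut X}"
    unfolding signed_circuits_bmat by (auto simp: supp_leave)
  also have "\<dots> = {(leave (merge e -` X), leave (- (merge e -` X))) | X. is_bond (merge e -` X)}"
    (is "?L = ?R")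
  proof
    show "?L \<subseteq> ?R"
    proof
      fix C assume "C \<in> ?L"
      then obtain X where X: "C = (leave X, leave (- X))" "is_bond X" "e \<notin> cut X" by blast
      with merge_vimage_eq[OF assms] show "C \<in> ?R" by (metis (mono_tags, lifting) mem_Collect_eq)
    qed
    show "?R \<subseteq> ?L" using cut_merge(2) by blast
  qed
  finally show ?thesis
    unfolding om_delete_def
    by (simp add: arc_system.bmat_def[of "E - {e}"] leave_merge is_bond_merge[OF assms] vimage_Compl)
qed

text \<open>Stating the condition with the dibonds of the uncontracted digraph allows the sets
  \<open>J\<close> of several contractions to be compared on the same cuts.\<close>

lemma has_odd_join_merge_iff:
  assumes "e \<in> E"
  shows "arc_system.has_odd_join (E - {e}) (merge e \<circ> t) (merge e \<circ> h) \<longleftrightarrow>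
    (\<exists>J\<subseteq>E. \<forall>X. dibond X \<and> e \<notin> cut X \<longrightarrow> odd (card (cut X \<inter> J)))"
proof -
  have all: "(\<forall>X. dibond X \<and> e \<notin> cut X \<longrightarrow> odd (card (cut X \<inter> J))) \<longleftrightarrow>
      (\<forall>X. dibond (merge e -` X) \<longrightarrow> odd (card (cut (merge e -` X) \<inter> J)))" for J
    using merge_vimage_eq[OF assms] cut_merge(2) by metis
  have J: "(\<exists>J\<subseteq>E. \<forall>X. dibond (merge e -` X) \<longrightarrow> odd (card (cut (merge e -` X) \<inter> J))) \<longleftrightarrow>
      (\<exists>J\<subseteq>E - {e}. \<forall>X. dibond (merge e -` X) \<longrightarrow> odd (card (cut (merge e -` X) \<inter> J)))"
  proof
    assume "\<exists>J\<subseteq>E. \<forall>X. dibond (merge e -` X) \<longrightarrow> odd (card (cut (merge e -` X) \<inter> J))"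
    then obtain J where J: "J \<subseteq> E" "\<forall>X. dibond (merge e -` X) \<longrightarrow> odd (card (cut (merge e -` X) \<inter> J))"
      by blast
    have "cut (merge e -` X) \<inter> J = cut (merge e -` X) \<inter> (J - {e})" for X using cut_merge(2) by blast
    with J show "\<exists>J\<subseteq>E - {e}. \<forall>X. dibond (merge e -` X) \<longrightarrow> odd (card (cut (merge e -` X) \<inter> J))"
      by (intro exI[of _ "J - {e}"]) auto
  qed blast
  show ?thesis
    unfolding all J arc_system.has_odd_join_def[of "E - {e}"] arc_system.dibond_def[of "E - {e}"]
      upset_merge is_bond_merge[OF assms] cut_merge(1) dibond_def[symmetric] by blast
qed

section \<open>Removal of a transitive arc\<close>

lemma cut_remove: "arc_system.cut (E - {e}) t h X = cut X - {e}"
  by (auto simp: arc_system.cut_def)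

lemma leave_remove: "arc_system.leave (E - {e}) t h X = leave X - {e}"
  by (auto simp: arc_system.leave_def)

text \<open>Removing an arbitrary arc may turn a vertex set into an up-set and so create dibonds. A
  transitive arc is never the only arc leaving a set, nor the only arc of a cut, which preserves
  both up-sets and minimality.\<close>

lemma dibond_transitive_remove:
  assumes e: "transitive_arc e"
  shows "arc_system.dibond (E - {e}) t h X \<longleftrightarrow> dibond X"
proof
  assume "arc_system.dibond (E - {e}) t h X"
  then have X: "leave X \<subseteq> {e}" "cut X - {e} \<noteq> {}"
    and min: "\<And>Z. cut Z - {e} \<subseteq> cut X - {e} \<Longrightarrow> cut Z - {e} \<noteq> {} \<Longrightarrow> cut Z - {e} = cut X - {e}"
    by (auto simp: arc_system.dibond_def[of "E - {e}"] arc_system.upset_iff_leave[of "E - {e}"]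
        leave_remove cut_remove arc_system.is_bond_def[of "E - {e}"])
  have "upset X" using X(1) e unfolding upset_iff_leave transitive_arc_def by blast
  moreover have "is_bond X"
    unfolding is_bond_def
  proof (intro conjI allI impI)
    show "cut X \<noteq> {}" using X by blast
    fix Z assume Z: "cut Z \<subseteq> cut X \<and> cut Z \<noteq> {}"
    then have "cut Z - {e} \<noteq> {}" using transitive_arc_enter[OF e, of Z] by blast
    then have eq: "cut Z - {e} = cut X - {e}" using min Z by blast
    \<comment> \<open>Otherwise the symmetric difference of \<open>X\<close> and \<open>Z\<close>
      has the cut \<open>{e}\<close>.\<close>
    have "e \<in> cut X \<Longrightarrow> e \<in> cut Z"
      using transitive_arc_enter[OF e, of "X - Z \<union> (Z - X)"] eq Z unfolding cut_sym_diff by blast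
    then show "cut Z = cut X" using Z eq by blast
  qed
  ultimately show "dibond X" by (simp add: dibond_def)
next
  assume "dibond X"
  then have up: "upset X" and ne: "cut X \<noteq> {}"
    and min: "\<And>Z. cut Z \<subseteq> cut X \<Longrightarrow> cut Z \<noteq> {} \<Longrightarrow> cut Z = cut X"
    by (auto simp: dibond_def is_bond_def)
  have eE: "e \<in> E" using e by (simp add: transitive_arc_def)
  have key: False if Z: "cut Z - {e} \<subseteq> cut X" and eZ: "e \<in> leave Z" "e \<notin> cut X" for Z
  proof -
    have all: "f = e" if "f \<in> E" "(t f \<in> Z) \<noteq> (h f \<in> Z)" "(t f \<in> X) = (h f \<in> X)" for f
      using Z that by (auto simp: cut_def)
    \<comment> \<open>On whichever side of \<open>X\<close> it lies, \<open>e\<close> still leaves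
      \<open>W\<close>, so a second arc leaves \<open>W\<close>. Since no arc leaves the up-set
      \<open>X\<close>, this second arc crosses \<open>Z\<close> but not \<open>X\<close>.\<close>
    define W where "W = (if t e \<in> X then Z \<inter> X else Z \<union> X)"
    have "e \<in> leave W" using eZ by (auto simp: W_def leave_def cut_def)
    then obtain f where f: "f \<in> leave W" "f \<noteq> e" using e by (auto simp: transitive_arc_def)
    then have "f \<in> E" "(t f \<in> Z) \<noteq> (h f \<in> Z)" "(t f \<in> X) = (h f \<in> X)"
      using up by (auto simp: W_def leave_def upset_def split: if_splits)
    then show False using all f(2) by blast
  qed
  have bond: "cut Z - {e} = cut X - {e}" if Z: "cut Z - {e} \<subseteq> cut X - {e}" "cut Z - {e} \<noteq> {}" for Z
  proof -
    have "cut Z \<subseteq> cut X"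
    proof (rule ccontr)
      assume "\<not> ?thesis"
      then have "e \<in> cut Z" "e \<notin> cut X" using Z by blast+
      then have "e \<in> leave Z \<or> e \<in> leave (- Z)" by (simp add: cut_eq_leave)
      then show False using key[of Z] key[of "- Z"] Z \<open>e \<notin> cut X\<close> by auto
    qed
    then show ?thesis using min[of Z] Z by blast
  qed
  have "leave X - {e} = {}" using up unfolding upset_iff_leave by blast
  moreover have "cut X - {e} \<noteq> {}" using ne transitive_arc_enter[OF e, of X] by blast
  ultimately show "arc_system.dibond (E - {e}) t h X"
    using bond unfolding arc_system.dibond_def[of "E - {e}"] arc_system.upset_iff_leave[of "E - {e}"]
      leave_remove cut_remove arc_system.is_bond_def[of "E - {e}"] by blast
qed

lemma circuits_bmat:
  "circuits (underlying_matroid bmat) = cut ` {X. is_bond X}"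
proof -
  have "signed_circuits bmat = (\<lambda>X. (leave X, leave (- X))) ` {X. is_bond X}"
    unfolding signed_circuits_bmat by blast
  then show ?thesis by (simp add: underlying_matroid_def image_image supp_leave)
qed

end

context fin_arc_system
begin

lemma bond_refines_cut':
  assumes "g \<in> cut X"
  obtains Y where "is_bond Y" "g \<in> cut Y" "leave Y \<subseteq> leave X" "leave (- Y) \<subseteq> leave (- X)"
proof (cases "g \<in> leave X")
  case True
  then show ?thesis using bond_refines_cut[OF True] that by (metis Un_iff cut_eq_leave)
next
  case False
  then have "g \<in> leave (- X)" using assms by (simp add: cut_eq_leave)
  then obtain Y where "is_bond Y" "g \<in> leave Y" "leave Y \<subseteq> leave (- X)" "leave (- Y) \<subseteq> leave X"
    using bond_refines_cut by (metis double_complement)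
  then show ?thesis using that[of "- Y"] by (simp add: cut_eq_leave)
qed

lemma om_contract_bmat: "om_contract bmat e = arc_system.bmat (E - {e}) t h"
proof -
  define \<C> where "\<C> = {(fst C - {e}, snd C - {e}) | C. C \<in> signed_circuits bmat \<and> supp C \<noteq> {e}}"
  have mem\<C>: "C \<in> \<C> \<longleftrightarrow> (\<exists>X. is_bond X \<and> cut X \<noteq> {e} \<and> C = (leave X - {e}, leave (- X) - {e}))" for C
  proof
    assume "C \<in> \<C>"
    then show "\<exists>X. is_bond X \<and> cut X \<noteq> {e} \<and> C = (leave X - {e}, leave (- X) - {e})"
      unfolding \<C>_def signed_circuits_bmat by (force simp: supp_leave)
  next
    assume "\<exists>X. is_bond X \<and> cut X \<noteq> {e} \<and> C = (leave X - {e}, leave (- X) - {e})"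
    then obtain X where X: "is_bond X" "cut X \<noteq> {e}" "C = (leave X - {e}, leave (- X) - {e})"
      by blast
    then show "C \<in> \<C>"
      unfolding \<C>_def signed_circuits_bmat
      by (intro CollectI exI[of _ "(leave X, leave (- X))"]) (auto simp: supp_leave)
  qed
  have supp: "supp (leave X - {e}, leave (- X) - {e}) = cut X - {e}" for X
    by (auto simp: supp_def cut_eq_leave)
  have bond: "arc_system.is_bond (E - {e}) t h X \<longleftrightarrow> cut X - {e} \<noteq> {} \<and>
      (\<forall>Z. cut Z - {e} \<subseteq> cut X - {e} \<and> cut Z - {e} \<noteq> {} \<longrightarrow> cut Z - {e} = cut X - {e})" for X
    by (simp add: arc_system.is_bond_def[of "E - {e}"] cut_remove)
  have "{C \<in> \<C>. \<forall>C'\<in>\<C>. \<not> supp C' \<subset> supp C} =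
      {(leave X - {e}, leave (- X) - {e}) | X. arc_system.is_bond (E - {e}) t h X}" (is "?L = ?R")
  proof (intro equalityI subsetI)
    fix C assume C: "C \<in> ?L"
    then obtain X where X: "is_bond X" "cut X \<noteq> {e}" "C = (leave X - {e}, leave (- X) - {e})"
      unfolding mem\<C> by blast
    have "cut X - {e} \<noteq> {}" using X(1,2) by (auto simp: is_bond_def)
    moreover have "cut Z - {e} = cut X - {e}" if Z: "cut Z - {e} \<subseteq> cut X - {e}" "cut Z - {e} \<noteq> {}" for Z
    proof -
      obtain g where g: "g \<in> cut Z" "g \<noteq> e" using Z(2) by blast
      obtain Y where Y: "is_bond Y" "g \<in> cut Y" "leave Y \<subseteq> leave Z" "leave (- Y) \<subseteq> leave (- Z)"
        using bond_refines_cut'[OF g(1)] .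
      have "(leave Y - {e}, leave (- Y) - {e}) \<in> \<C>" unfolding mem\<C> using Y g by blast
      then have "\<not> supp (leave Y - {e}, leave (- Y) - {e}) \<subset> supp C" using C by blast
      then have "\<not> cut Y - {e} \<subset> cut X - {e}" unfolding X(3) supp .
      moreover have "cut Y \<subseteq> cut Z" using Y(3,4) by (rule finer_leave_imp_cut)
      ultimately show ?thesis using Z(1) by blast
    qed
    ultimately show "C \<in> ?R" using X(3) unfolding bond by blast
  next
    fix C assume "C \<in> ?R"
    then obtain X where C: "C = (leave X - {e}, leave (- X) - {e})"
      and X: "arc_system.is_bond (E - {e}) t h X" by blast
    have ne: "cut X - {e} \<noteq> {}" using X[unfolded bond] by (rule conjunct1)
    have min: "cut Z - {e} = cut X - {e}" if "cut Z - {e} \<subseteq> cut X - {e}" "cut Z - {e} \<noteq> {}" for Z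
      using X[unfolded bond, THEN conjunct2] that by blast
    obtain g where g: "g \<in> cut X" "g \<noteq> e" using ne by blast
    obtain Y where Y: "is_bond Y" "g \<in> cut Y" "leave Y \<subseteq> leave X" "leave (- Y) \<subseteq> leave (- X)"
      using bond_refines_cut'[OF g(1)] .
    have "cut Y \<subseteq> cut X" using Y(3,4) by (rule finer_leave_imp_cut)
    then have eq: "cut Y - {e} = cut X - {e}" using min[of Y] Y(2) g by blast
    \<comment> \<open>The refinement keeps the signs, so equal supports up to \<open>e\<close>
      already give equal signed sets up to \<open>e\<close>.\<close>
    have "leave Y - {e} = leave X - {e}" "leave (- Y) - {e} = leave (- X) - {e}"
      using eq Y(3,4) leave_disjoint[of X] unfolding cut_eq_leave by blast+
    then have "C \<in> \<C>" unfolding mem\<C> C using Y(1,2) g by (intro exI[of _ Y]) auto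
    moreover have "\<not> supp C' \<subset> supp C" if C': "C' \<in> \<C>" for C'
    proof -
      obtain W where W: "is_bond W" "cut W \<noteq> {e}" "C' = (leave W - {e}, leave (- W) - {e})"
        using C' unfolding mem\<C> by blast
      have "cut W - {e} \<noteq> {}" using W(1,2) by (auto simp: is_bond_def)
      then show ?thesis using min[of W] unfolding C W(3) supp by blast
    qed
    ultimately show "C \<in> ?L" by blast
  qed
  then show ?thesis
    unfolding om_contract_def \<C>_def[symmetric] Let_def
    by (simp add: arc_system.bmat_def[of "E - {e}"] leave_remove)
qed

section \<open>Cocircuits and butterfly-contractible elements\<close>

lemma indep_bmat: "indep (underlying_matroid bmat) X \<longleftrightarrow> X \<subseteq> E \<and> (\<forall>Z. cut Z \<noteq> {} \<longrightarrow> \<not> cut Z \<subseteq> X)"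
proof -
  have "\<exists>Y. is_bond Y \<and> cut Y \<subseteq> cut Z" if nonempty: "cut Z \<noteq> {}" for Z
  proof -
    obtain g where "g \<in> cut Z" using nonempty by blast
    then obtain Y where "is_bond Y" "leave Y \<subseteq> leave Z" "leave (- Y) \<subseteq> leave (- Z)"
      using bond_refines_cut' by metis
    then show ?thesis using finer_leave_imp_cut by blast
  qed
  moreover have "cut Y \<noteq> {}" if "is_bond Y" for Y using that by (simp add: is_bond_def)
  moreover have "ground (underlying_matroid bmat) = E" by (simp add: underlying_matroid_def)
  ultimately show ?thesis
    unfolding indep_def circuits_bmat by (simp add: Ball_def image_iff) (metis subset_trans)
qed

lemma coindep_bmat:
  assumes T: "T \<subseteq> E" and single: "\<And>x. x \<in> T \<Longrightarrow> \<exists>Z. cut Z \<inter> T = {x}"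
  shows "coindep (underlying_matroid bmat) T"
proof -
  let ?I = "indep (underlying_matroid bmat)"
  have "finite {B. B \<subseteq> E - T \<and> ?I B}" using finite_E by auto
  moreover have "{} \<in> {B. B \<subseteq> E - T \<and> ?I B}" by (auto simp: indep_bmat)
  ultimately have "\<exists>B\<in>{B. B \<subseteq> E - T \<and> ?I B}. \<forall>B'\<in>{B. B \<subseteq> E - T \<and> ?I B}. B \<subseteq> B' \<longrightarrow> B = B'"
    by (intro finite_has_maximal) auto
  then obtain B where B: "B \<subseteq> E - T" "?I B"
    and max': "\<forall>B'\<in>{B. B \<subseteq> E - T \<and> ?I B}. B \<subseteq> B' \<longrightarrow> B = B'"
    by blast
  have max: "B' = B" if "B' \<subseteq> E - T" "?I B'" "B \<subseteq> B'" for B'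
    using max' that by blast
  have "X = B" if X: "?I X" "B \<subseteq> X" for X
  proof (rule ccontr)
    assume "X \<noteq> B"
    then obtain x where x: "x \<in> X" "x \<notin> B" using X(2) by blast
    have ix: "?I (insert x B)" using X x unfolding indep_bmat by blast
    then have "x \<in> T" using max[of "insert x B"] B x unfolding indep_bmat by blast
    then obtain Z0 where "cut Z0 \<inter> T = {x}" using single by blast
    then obtain Z where Z: "cut Z \<inter> T = {x}"
      and minZ: "\<And>Z'. cut Z' \<inter> T = {x} \<Longrightarrow> card (cut Z - B) \<le> card (cut Z' - B)"
      using ex_has_least_nat[of "\<lambda>Z. cut Z \<inter> T = {x}" Z0 "\<lambda>Z. card (cut Z - B)"] by blast
    have "cut Z \<subseteq> insert x B"
    proof
      fix f assume f: "f \<in> cut Z"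
      show "f \<in> insert x B"
      proof (rule ccontr)
        assume nf: "f \<notin> insert x B"
        then have fT: "f \<notin> T" "f \<in> E" using f Z cut_subset by blast+
        have "\<not> ?I (insert f B)" using max[of "insert f B"] nf fT B(1) by blast
        then obtain W where W: "cut W \<noteq> {}" "cut W \<subseteq> insert f B"
          using B fT unfolding indep_bmat by blast
        have fW: "f \<in> cut W" using W B(2) unfolding indep_bmat by blast
        have "cut (Z - W \<union> (W - Z)) \<inter> T = {x}"
          using Z W(2) B(1) fT unfolding cut_sym_diff by blast
        then have "card (cut Z - B) \<le> card (cut (Z - W \<union> (W - Z)) - B)" by (rule minZ)
        moreover have "cut (Z - W \<union> (W - Z)) - B \<subset> cut Z - B"
          using W(2) f fW nf unfolding cut_sym_diff by blast
        then have "card (cut (Z - W \<union> (W - Z)) - B) < card (cut Z - B)"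
          by (rule psubset_card_mono[rotated]) simp
        ultimately show False by linarith
      qed
    qed
    moreover have "cut Z \<noteq> {}" using Z by blast
    ultimately show False using ix unfolding indep_bmat by blast
  qed
  then have "basis (underlying_matroid bmat) B" unfolding basis_def using B(2) by blast
  then show ?thesis
    unfolding coindep_def using B(1) T by (intro exI[of _ B]) (auto simp: underlying_matroid_def)
qed

text \<open>Were \<open>e\<close> the only arc leaving \<open>X\<close>, a bond refining
  \<open>X\<close> would have positive part \<open>{e}\<close>. Against
  \<open>(S - {e}, {e})\<close> this circuit has a sign disagreement at \<open>e\<close> and no
  agreement, contrary to orthogonality.\<close>

lemma butterfly_contractible_imp_transitive:
  assumes "butterfly_contractible bmat e"
  shows "transitive_arc e"
  unfolding transitive_arc_def
proof (intro conjI allI impI)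
  show "e \<in> E" using assms by (simp add: butterfly_contractible_def)
  obtain S where S: "\<And>C. C \<in> signed_circuits bmat \<Longrightarrow> orthogonal C (S - {e}, {e})"
    using assms unfolding butterfly_contractible_def signed_cocircuit_def by blast
  fix X assume e: "e \<in> leave X"
  show "\<exists>f\<in>leave X. f \<noteq> e"
  proof (rule ccontr)
    assume only: "\<not> ?thesis"
    obtain Y where Y: "is_bond Y" "e \<in> leave Y" "leave Y \<subseteq> leave X" using bond_refines_cut[OF e] .
    then have "leave Y = {e}" using only by blast
    moreover have "orthogonal (leave Y, leave (- Y)) (S - {e}, {e})"
      using S Y(1) unfolding signed_circuits_bmat by blast
    ultimately show False using leave_disjoint[of Y] by (auto simp: orthogonal_def)
  qed
qed

text \<open>
  A minimal set \<open>P\<close> of arcs other than \<open>e\<close> that meets every \<open>leave X\<close> containing \<open>e\<close> is a directed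
  path from the tail to the head of \<open>e\<close>, and \<open>P \<union> {e}\<close> is the required cocircuit.
\<close>

lemma transitive_imp_butterfly_contractible:
  assumes e: "transitive_arc e"
  shows "butterfly_contractible bmat e"
proof -
  have eE: "e \<in> E" using e by (simp add: transitive_arc_def)
  define covers where "covers P \<longleftrightarrow> P \<subseteq> E - {e} \<and> (\<forall>X. e \<in> leave X \<longrightarrow> leave X \<inter> P \<noteq> {})" for P
  have "covers (E - {e})"
    using e leave_subset unfolding covers_def transitive_arc_def by blast
  then obtain P where P: "covers P" and minP: "\<And>P'. covers P' \<Longrightarrow> card P \<le> card P'"
    using ex_has_least_nat[of covers "E - {e}" card] by blast
  have PE: "P \<subseteq> E" "e \<notin> P" and cov: "\<And>X. e \<in> leave X \<Longrightarrow> leave X \<inter> P \<noteq> {}"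
    using P unfolding covers_def by blast+
  have finP: "finite P" using PE finite_E finite_subset by blast
  have ex1: "\<exists>X. e \<in> leave X \<and> leave X \<inter> P = {p}" if "p \<in> P" for p
  proof -
    have "\<not> covers (P - {p})" using minP[of "P - {p}"] card_Diff1_less[OF finP that] by linarith
    then obtain X where "e \<in> leave X" "leave X \<inter> (P - {p}) = {}" using PE unfolding covers_def by blast
    then show ?thesis using cov[of X] that by blast
  qed
  have noenter: "leave (- X) \<inter> P = {}" if X: "e \<in> leave X" "leave X \<inter> P = {p}" for X p
  proof (rule ccontr)
    assume "\<not> ?thesis"
    then obtain q where q: "q \<in> P" "t q \<notin> X" "h q \<in> X" by (auto simp: leave_def)
    obtain X' where X': "e \<in> leave X'" "leave X' \<inter> P = {q}" using ex1[OF q(1)] by blast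
    have p: "p \<in> P" "t p \<in> X" "h p \<notin> X" using X(2) by (auto simp: leave_def)
    have uX: "r = p" if "r \<in> P" "t r \<in> X" "h r \<notin> X" for r using X(2) that PE by (auto simp: leave_def)
    have uX': "r = q" if "r \<in> P" "t r \<in> X'" "h r \<notin> X'" for r using X'(2) that PE by (auto simp: leave_def)
    \<comment> \<open>Intersection and union are left by \<open>e\<close>, hence also by arcs of
      \<open>P\<close>. Such an arc leaves \<open>X\<close> or \<open>X'\<close>, so it is
      \<open>p\<close> or \<open>q\<close>; since \<open>q\<close> enters \<open>X\<close>, it is
      \<open>p\<close> both times, and then \<open>p\<close> leaves \<open>X'\<close> as
      well.\<close>
    have "e \<in> leave (X \<inter> X')" "e \<in> leave (X \<union> X')" using X(1) X'(1) by (auto simp: leave_def)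
    then obtain r r' where "r \<in> leave (X \<inter> X') \<inter> P" "r' \<in> leave (X \<union> X') \<inter> P" using cov by blast
    then have "t p \<in> X'" "h p \<notin> X'" using uX uX' q by (auto simp: leave_def)
    then show False using uX'[OF p(1)] p q by blast
  qed
  have balance: "leave (- X) \<inter> P \<noteq> {}" if eX: "e \<notin> cut X" and PX: "leave X \<inter> P \<noteq> {}" for X
  proof
    assume none: "leave (- X) \<inter> P = {}"
    then have none': "h r \<in> - X" if "r \<in> P" "t r \<in> - X" for r using that PE by (auto simp: leave_def)
    obtain p where p: "p \<in> P" "t p \<in> X" "h p \<notin> X" using PX by (auto simp: leave_def)
    obtain Y where Y: "e \<in> leave Y" "leave Y \<inter> P = {p}" using ex1[OF p(1)] by blast
    have uY: "r = p" if "r \<in> P" "t r \<in> Y" "h r \<notin> Y" for r using Y(2) that PE by (auto simp: leave_def)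
    \<comment> \<open>As no arc of \<open>P\<close> enters \<open>X\<close>, an arc of
      \<open>P\<close> leaving \<open>W\<close> also leaves \<open>Y\<close>, so it is
      \<open>p\<close>; but \<open>p\<close> leaves \<open>X\<close> and therefore does not leave
      \<open>W\<close>.\<close>
    define W where "W = (if t e \<in> X then Y \<union> - X else Y \<inter> - X)"
    have "e \<in> leave W" using Y(1) eX eE by (auto simp: W_def leave_def cut_def)
    then obtain r where "r \<in> leave W \<inter> P" using cov by blast
    then show False using uY none' p by (auto simp: W_def leave_def split: if_splits)
  qed
  have orth: "orthogonal C (P, {e})" if C: "C \<in> signed_circuits bmat" for C
  proof -
    obtain X where X: "C = (leave X, leave (- X))" using C unfolding signed_circuits_bmat by blast
    show ?thesis
    proof (cases "e \<in> cut X")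
      case True
      then have "e \<in> leave X \<or> e \<in> leave (- X)" by (simp add: cut_eq_leave)
      then show ?thesis using cov[of X] cov[of "- X"] unfolding X orthogonal_def by auto
    next
      case False
      then have "e \<notin> leave X" "e \<notin> leave (- X)" by (simp_all add: cut_eq_leave)
      then show ?thesis using balance[of X] balance[of "- X"] False unfolding X orthogonal_def by auto
    qed
  qed
  let ?S = "insert e P"
  let ?U = "underlying_matroid bmat"
  have ground: "ground ?U = E" by (simp add: underlying_matroid_def)
  \<comment> \<open>The cut of \<open>X p\<close> meets \<open>insert e P\<close> in exactly
    \<open>p\<close> and \<open>e\<close>. Once an element \<open>g\<close> is removed, such a cut
    or the symmetric difference of two of them isolates each remaining element, as
    \<open>coindep_bmat\<close> requires.\<close>
  obtain X where X: "\<And>p. p \<in> P \<Longrightarrow> e \<in> leave (X p) \<and> leave (X p) \<inter> P = {p}" using ex1 by metis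
  have cutX: "cut (X p) \<inter> ?S = {p, e}" if "p \<in> P" for p
    using X[OF that] noenter[of "X p" p] unfolding cut_eq_leave by blast
  have co: "coindep ?U (?S - {g})" if g: "g \<in> ?S" for g
  proof (rule coindep_bmat)
    show "?S - {g} \<subseteq> E" using PE eE by blast
    fix x assume x: "x \<in> ?S - {g}"
    show "\<exists>Z. cut Z \<inter> (?S - {g}) = {x}"
    proof -
      consider "g = e" "x \<in> P" | "x = e" "g \<in> P" | "x \<in> P" "g \<in> P" "x \<noteq> g" using x g by blast
      then show ?thesis
      proof cases
        case 1
        have "cut (X x) \<inter> (?S - {g}) = (cut (X x) \<inter> ?S) - {g}" by blast
        also have "\<dots> = {x}" unfolding cutX[OF 1(2)] using 1 PE by blast
        finally show ?thesis by blast
      next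
        case 2
        have "cut (X g) \<inter> (?S - {g}) = (cut (X g) \<inter> ?S) - {g}" by blast
        also have "\<dots> = {x}" unfolding cutX[OF 2(2)] using 2 PE by blast
        finally show ?thesis by blast
      next
        case 3
        have "cut (X x - X g \<union> (X g - X x)) \<inter> (?S - {g}) =
            (cut (X x) \<inter> ?S - cut (X g) \<inter> ?S) \<union> (cut (X g) \<inter> ?S - cut (X x) \<inter> ?S) - {g}"
          unfolding cut_sym_diff by blast
        also have "\<dots> = {x}" unfolding cutX[OF 3(1)] cutX[OF 3(2)] using 3 PE by blast
        finally show ?thesis by blast
      qed
    qed
  qed
  have "cocircuit ?U ?S"
    unfolding cocircuit_def
  proof (intro conjI allI impI)
    show "?S \<subseteq> ground ?U" using PE eE ground by blast
    show "\<not> coindep ?U ?S"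
    proof
      assume "coindep ?U ?S"
      then obtain B where B: "basis ?U B" "?S \<subseteq> E - B" unfolding coindep_def ground by blast
      then have "\<not> indep ?U (insert e B)" unfolding basis_def by blast
      then obtain Z where Z: "cut Z \<noteq> {}" "cut Z \<subseteq> insert e B"
        using B eE unfolding indep_bmat basis_def by blast
      have "e \<in> cut Z" using Z B unfolding indep_bmat basis_def by blast
      then have "e \<in> leave Z \<or> e \<in> leave (- Z)" by (simp add: cut_eq_leave)
      then have "cut Z \<inter> P \<noteq> {}" using cov[of Z] cov[of "- Z"] unfolding cut_eq_leave by blast
      then show False using Z(2) B(2) PE by blast
    qed
    fix T assume "T \<subset> ?S"
    then obtain g where "g \<in> ?S" "T \<subseteq> ?S - {g}" by blast
    then show "coindep ?U T" using co unfolding coindep_def by (meson subset_trans)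
  qed
  moreover have "?S - {e} = P" using PE by blast
  moreover have "supp (P, {e}) = ?S" by (auto simp: supp_def)
  ultimately show ?thesis
    unfolding butterfly_contractible_def signed_cocircuit_def
    using orth PE eE by (intro conjI exI[of _ ?S]) auto
qed

lemma butterfly_contractible_bmat: "butterfly_contractible bmat e \<longleftrightarrow> transitive_arc e"
  using butterfly_contractible_imp_transitive transitive_imp_butterfly_contractible by blast

section \<open>The parity condition under minors\<close>

lemma has_odd_join_remove:
  assumes e: "transitive_arc e"
  shows "arc_system.has_odd_join (E - {e}) t h \<longleftrightarrow> has_odd_join"
proof
  assume "arc_system.has_odd_join (E - {e}) t h"
  then obtain J where J: "J \<subseteq> E - {e}" "\<And>X. dibond X \<Longrightarrow> odd (card ((cut X - {e}) \<inter> J))"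
    unfolding arc_system.has_odd_join_def[of "E - {e}"] dibond_transitive_remove[OF e] cut_remove by blast
  moreover have "(cut X - {e}) \<inter> J = cut X \<inter> J" for X using J(1) by blast
  ultimately show has_odd_join unfolding has_odd_join_def by auto
next
  assume has_odd_join
  then obtain J where J: "J \<subseteq> E" "\<And>X. dibond X \<Longrightarrow> odd (card (cut X \<inter> J))"
    unfolding has_odd_join_def by blast
  have eE: "e \<in> E" using e by (simp add: transitive_arc_def)
  obtain P where P: "P \<subseteq> E - {e}" "joins P (t e) (h e)" using transitive_joins[OF e] .
  have finP: "finite P" and finJ: "finite J" using P(1) J(1) finite_E by (auto intro: finite_subset)
  define Q where "Q = P - {e} \<union> ({e} - P)"
  have Q: "Q = insert e P" using P(1) by (auto simp: Q_def)
  have "joins Q (t e) (t e)" unfolding Q_def by (rule joins_extend[OF finP eE P(2)]) auto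
  then have evenQ: "even (card (cut X \<inter> Q))" for X by (simp add: joins_def)
  define J' where "J' = (if e \<in> J then J - Q \<union> (Q - J) else J)"
  have "finite Q" using finP Q by simp
  then have "odd (card (cut X \<inter> J'))" if "dibond X" for X
    using J(2)[OF that] evenQ[of X] odd_card_sym_diff[OF finJ, of Q "cut X"] by (auto simp: J'_def)
  moreover have J': "J' \<subseteq> E - {e}" using J(1) P(1) Q eE by (auto simp: J'_def)
  moreover have "(cut X - {e}) \<inter> J' = cut X \<inter> J'" for X using J' by blast
  ultimately show "arc_system.has_odd_join (E - {e}) t h"
    unfolding arc_system.has_odd_join_def[of "E - {e}"] dibond_transitive_remove[OF e] cut_remove
    by (intro exI[of _ J']) simp
qed

lemma directed_circuit_bmat:
  "directed_circuit bmat C \<longleftrightarrow> (\<exists>X. dibond X \<and> (C = (leave (- X), {}) \<or> C = ({}, leave (- X))))"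
proof
  assume "directed_circuit bmat C"
  then obtain X where X: "is_bond X" "C = (leave X, leave (- X))" "leave X = {} \<or> leave (- X) = {}"
    unfolding directed_circuit_def signed_circuits_bmat by auto
  show "\<exists>X. dibond X \<and> (C = (leave (- X), {}) \<or> C = ({}, leave (- X)))"
  proof (cases "leave X = {}")
    case True
    then show ?thesis using X by (auto simp: dibond_def upset_iff_leave)
  next
    case False
    then show ?thesis using X by (intro exI[of _ "- X"]) (auto simp: dibond_def upset_iff_leave)
  qed
next
  assume "\<exists>X. dibond X \<and> (C = (leave (- X), {}) \<or> C = ({}, leave (- X)))"
  then obtain X where X: "is_bond X" "leave X = {}" "C = (leave (- X), {}) \<or> C = ({}, leave (- X))"
    unfolding dibond_def upset_iff_leave by blast
  have "(leave Z, leave (- Z)) \<in> signed_circuits bmat" if "is_bond Z" for Z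
    using that unfolding signed_circuits_bmat by blast
  from this[of X] this[of "- X"]
  have "(leave X, leave (- X)) \<in> signed_circuits bmat" "(leave (- X), leave X) \<in> signed_circuits bmat"
    using X(1) by simp_all
  then show "directed_circuit bmat C" using X unfolding directed_circuit_def by auto
qed

lemma has_odd_join_iff:
  "has_odd_join \<longleftrightarrow> (\<exists>J\<subseteq>elements bmat. \<forall>C. directed_circuit bmat C \<longrightarrow> odd (card (supp C \<inter> J)))"
proof -
  have cutX: "cut X = leave (- X)" if "dibond X" for X
    using that cut_upset by (simp add: dibond_def)
  have "(\<forall>C. directed_circuit bmat C \<longrightarrow> odd (card (supp C \<inter> J))) \<longleftrightarrow>
      (\<forall>X. dibond X \<longrightarrow> odd (card (cut X \<inter> J)))" (is "?L \<longleftrightarrow> ?R") for J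
  proof
    assume L: ?L
    show ?R
    proof (intro allI impI)
      fix X assume X: "dibond X"
      then have "directed_circuit bmat (leave (- X), {})" unfolding directed_circuit_bmat by blast
      then show "odd (card (cut X \<inter> J))"
        using L[rule_format, of "(leave (- X), {})"] cutX[OF X] by (simp add: supp_def)
    qed
  next
    assume ?R
    then show ?L unfolding directed_circuit_bmat by (auto simp: supp_def cutX)
  qed
  then show ?thesis unfolding has_odd_join_def by simp
qed

end

text \<open>The vertex type stays fixed along a sequence of minors, because merging and removing
  arcs use only old vertices.\<close>

lemma gb_minor_bmat:
  fixes t h :: "'a \<Rightarrow> 'v"
  assumes "gb_minor M N" "M = arc_system.bmat E t h" "finite E" "arc_system.has_odd_join E t h"
  shows "\<exists>E' (t' :: 'a \<Rightarrow> 'v) h'.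
    N = arc_system.bmat E' t' h' \<and> finite E' \<and> arc_system.has_odd_join E' t' h'"
  using assms(1)
proof induction
  case gb_minor_refl
  then show ?case using assms by blast
next
  case (gb_minor_delete N e)
  then obtain E' and t' h' :: "'a \<Rightarrow> 'v"
    where N: "N = arc_system.bmat E' t' h'" "finite E'" "arc_system.has_odd_join E' t' h'" by blast
  interpret fin_arc_system E' t' h' by unfold_locales fact
  have e: "e \<in> E'" using gb_minor_delete N by simp
  have "arc_system.has_odd_join (E' - {e}) (merge e \<circ> t') (merge e \<circ> h')"
    using N(3) unfolding has_odd_join_merge_iff[OF e] has_odd_join_def by blast
  then show ?case using N om_delete_bmat[OF e] finite_Diff[OF N(2)] by metis
next
  case (gb_minor_contract N e)
  then obtain E' and t' h' :: "'a \<Rightarrow> 'v"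
    where N: "N = arc_system.bmat E' t' h'" "finite E'" "arc_system.has_odd_join E' t' h'" by blast
  interpret fin_arc_system E' t' h' by unfold_locales fact
  have e: "transitive_arc e" using gb_minor_contract N butterfly_contractible_bmat by simp
  then show ?case using N om_contract_bmat[of e] has_odd_join_remove[OF e] finite_Diff[OF N(2)] by metis
qed

lemma gb_minor_trans: "gb_minor L M \<Longrightarrow> gb_minor M N \<Longrightarrow> gb_minor L N"
  by (rotate_tac, induction rule: gb_minor.induct) (auto intro: gb_minor.intros)

section \<open>Directed bonds of a minimal even bond matroid\<close>

context arc_system
begin

text \<open>Reversing all arcs complements up-sets and keeps cuts. Statements on sinks and
  intersections thereby yield those on sources and unions.\<close>

lemma rev_simps:
  "arc_system.cut E h t X = cut X"
  "arc_system.leave E h t X = leave (- X)"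
  "arc_system.is_bond E h t X = is_bond X"
  "arc_system.upset E h t X = upset (- X)"
  "arc_system.dibond E h t X = dibond (- X)"
  "arc_system.ends E h t = ends"
  "arc_system.conn E h t X = conn X"
  "arc_system.transitive_arc E h t e = transitive_arc e"
proof -
  show cut: "arc_system.cut E h t X = cut X" for X by (auto simp: arc_system.cut_def)
  show leave: "arc_system.leave E h t X = leave (- X)" for X by (auto simp: arc_system.leave_def)
  show bond: "arc_system.is_bond E h t X = is_bond X" for X
    by (simp add: arc_system.is_bond_def[of E h t] is_bond_def cut)
  show upset: "arc_system.upset E h t X = upset (- X)" for X
    by (auto simp: arc_system.upset_def)
  show "arc_system.dibond E h t X = dibond (- X)"
    by (simp add: arc_system.dibond_def[of E h t] dibond_def upset bond)
  show ends: "arc_system.ends E h t = ends" by (auto simp: arc_system.ends_def)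
  show "arc_system.conn E h t X = conn X"
    unfolding arc_system.conn_def[of E h t] conn_def ends by (simp add: eq_commute conj_commute)
  have "(\<forall>X. e \<in> leave (- X) \<longrightarrow> (\<exists>f\<in>leave (- X). f \<noteq> e)) \<longleftrightarrow>
      (\<forall>X. e \<in> leave X \<longrightarrow> (\<exists>f\<in>leave X. f \<noteq> e))"
    by (metis double_complement)
  then show "arc_system.transitive_arc E h t e = transitive_arc e"
    by (simp add: arc_system.transitive_arc_def[of E h t] transitive_arc_def leave)
qed

definition inside :: "'v set \<Rightarrow> 'a set" where
  "inside X = {e \<in> E. t e \<in> X \<and> h e \<in> X}"

lemma arc_ends: "e \<in> E \<Longrightarrow> t e \<in> ends" "e \<in> E \<Longrightarrow> h e \<in> ends"
  by (auto simp: ends_def)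

lemma conn_Un:
  assumes "conn X" "conn Y" "v \<in> X" "v \<in> Y" "v \<in> ends"
  shows "conn (X \<union> Y)"
  unfolding conn_def
proof (intro allI impI)
  fix Z assume Z: "\<forall>e\<in>E. t e \<in> X \<union> Y \<and> h e \<in> X \<union> Y \<longrightarrow> (t e \<in> Z) = (h e \<in> Z)"
  have "X \<inter> ends \<subseteq> Z \<or> X \<inter> ends \<inter> Z = {}" by (rule conn_cases[OF assms(1)]) (use Z in auto)
  moreover have "Y \<inter> ends \<subseteq> Z \<or> Y \<inter> ends \<inter> Z = {}"
    by (rule conn_cases[OF assms(2)]) (use Z in auto)
  ultimately show "(X \<union> Y) \<inter> ends \<subseteq> Z \<or> (X \<union> Y) \<inter> ends \<inter> Z = {}" using assms(3-5) by blast
qed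

lemma conn_Un_arc:
  assumes "conn X" "conn Y" "e \<in> E" "t e \<in> X" "h e \<in> Y"
  shows "conn (X \<union> Y)"
  unfolding conn_def
proof (intro allI impI)
  fix Z assume Z: "\<forall>e\<in>E. t e \<in> X \<union> Y \<and> h e \<in> X \<union> Y \<longrightarrow> (t e \<in> Z) = (h e \<in> Z)"
  have "X \<inter> ends \<subseteq> Z \<or> X \<inter> ends \<inter> Z = {}" by (rule conn_cases[OF assms(1)]) (use Z in auto)
  moreover have "Y \<inter> ends \<subseteq> Z \<or> Y \<inter> ends \<inter> Z = {}"
    by (rule conn_cases[OF assms(2)]) (use Z in auto)
  moreover have "t e \<in> Z \<longleftrightarrow> h e \<in> Z" using Z assms by blast
  ultimately show "(X \<union> Y) \<inter> ends \<subseteq> Z \<or> (X \<union> Y) \<inter> ends \<inter> Z = {}"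
    using assms(3-5) arc_ends by blast
qed

end

section \<open>Uncrossing and decomposition of directed cuts\<close>

context fin_arc_system
begin

lemma joins_trans:
  assumes "finite P" "finite Q" "joins P u v" "joins Q v w"
  shows "joins (P - Q \<union> (Q - P)) u w"
  unfolding joins_def
proof
  fix Z
  show "odd (card (cut Z \<inter> (P - Q \<union> (Q - P)))) \<longleftrightarrow> (u \<in> Z) \<noteq> (w \<in> Z)"
    using odd_card_sym_diff[OF assms(1,2), of "cut Z"]
      assms(3,4)[unfolded joins_def, rule_format, of Z] by auto
qed

lemma dibondI:
  assumes "upset X" "conn X" "conn (- X)" "e \<in> E" "t e \<notin> X" "h e \<in> X"
  shows "dibond X"
proof -
  have "e \<in> cut X" using assms by (simp add: cut_def)
  then show ?thesis using is_bondI_conn assms unfolding dibond_def by blast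
qed

text \<open>Cuts are submodular, and the defect counts the arcs between \<open>I - Y\<close> and
  \<open>Y - I\<close>; such an arc would leave one of the two up-sets.\<close>

lemma uncross_card:
  assumes "upset I" "upset Y"
  shows "card (cut I \<inter> J) + card (cut Y \<inter> J) = card (cut (I \<inter> Y) \<inter> J) + card (cut (I \<union> Y) \<inter> J)"
proof -
  have cap: "(cut I \<inter> J) \<inter> (cut Y \<inter> J) = (cut (I \<inter> Y) \<inter> J) \<inter> (cut (I \<union> Y) \<inter> J)"
    using assms by (auto simp: cut_def upset_def)
  have cup: "(cut I \<inter> J) \<union> (cut Y \<inter> J) = (cut (I \<inter> Y) \<inter> J) \<union> (cut (I \<union> Y) \<inter> J)"
    using assms by (auto simp: cut_def upset_def)
  have fin: "finite (cut X \<inter> J)" for X by simp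
  show ?thesis
    unfolding card_Un_Int[OF fin fin, of I Y] card_Un_Int[OF fin fin, of "I \<inter> Y" "I \<union> Y"] cap cup ..
qed

lemma uncross_parity:
  assumes "upset I" "upset Y"
  shows "odd (card (cut I \<inter> J)) \<noteq> odd (card (cut Y \<inter> J)) \<longleftrightarrow>
    odd (card (cut (I \<inter> Y) \<inter> J)) \<noteq> odd (card (cut (I \<union> Y) \<inter> J))"
  using arg_cong[OF uncross_card[OF assms, of J], of even] unfolding even_add by blast

text \<open>
  The number \<open>n\<close> is the number of dibonds into which the directed cut decomposes (equivalently, of
  connected components of \<open>A\<close>).
\<close>

lemma dicut_parity:
  assumes "conn UNIV" "upset A" "conn (- A)"
  shows "\<exists>n. \<forall>J. (\<forall>Y. dibond Y \<and> cut Y \<subseteq> cut A \<longrightarrow> odd (card (cut Y \<inter> J))) \<longrightarrow>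
    (odd (card (cut A \<inter> J)) \<longleftrightarrow> odd (n :: nat))"
  using assms(2,3)
proof (induction "card (cut A)" arbitrary: A rule: less_induct)
  case less
  show ?case
  proof (cases "cut A = {}")
    case True
    then show ?thesis by (intro exI[of _ 0]) auto
  next
    case False
    then obtain g where g: "g \<in> cut A" by blast
    obtain Y where Y: "is_bond Y" "g \<in> cut Y" "leave Y \<subseteq> leave A" "leave (- Y) \<subseteq> leave (- A)"
      using bond_refines_cut'[OF g] .
    have sub: "cut Y \<subseteq> cut A" using Y(3,4) by (rule finer_leave_imp_cut)
    have upY: "upset Y" using Y(3) less.prems(1) unfolding upset_iff_leave by blast
    then have dY: "dibond Y" using Y(1) by (simp add: dibond_def)
    have gE: "g \<in> E" "t g \<notin> Y" "h g \<in> Y" "t g \<notin> A"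
      using Y(2) upY g less.prems(1) by (auto simp: cut_def upset_def)
    \<comment> \<open>The connected shore \<open>- A\<close> is not split by \<open>Y\<close>, as
      \<open>cut Y\<close> lies in \<open>cut A\<close>. It contains \<open>t g\<close>, which is
      outside \<open>Y\<close>, so it misses \<open>Y\<close> altogether, and \<open>Y\<close> can
      be split off from \<open>A\<close>.\<close>
    have YA: "Y \<inter> ends \<subseteq> A"
    proof -
      have "- A \<inter> ends \<subseteq> Y \<or> - A \<inter> ends \<inter> Y = {}"
        by (rule conn_cases[OF less.prems(2)]) (use sub in \<open>auto simp: cut_def\<close>)
      then show ?thesis using gE arc_ends[of g] by blast
    qed
    have cutA': "cut (A - Y) = cut A - cut Y"
    proof -
      have "cut (A - Y) = cut (A - Y \<union> (Y - A))"
        unfolding cut_def using YA arc_ends by blast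
      then show ?thesis using sub unfolding cut_sym_diff by blast
    qed
    have "upset (A - Y)" using less.prems(1) sub by (auto simp: upset_def cut_def)
    moreover have "conn (- (A - Y))"
    proof -
      have "conn (- A \<union> Y)"
        by (rule conn_Un_arc[OF less.prems(2) bond_conn[OF assms(1) Y(1)] gE(1)]) (use gE in auto)
      then show ?thesis by (simp add: Compl_Diff_eq)
    qed
    moreover have "card (cut (A - Y)) < card (cut A)"
      unfolding cutA' by (rule psubset_card_mono) (use g Y(2) in auto)
    ultimately obtain n where n: "\<And>J. (\<forall>Z. dibond Z \<and> cut Z \<subseteq> cut (A - Y) \<longrightarrow> odd (card (cut Z \<inter> J)))
        \<Longrightarrow> (odd (card (cut (A - Y) \<inter> J)) \<longleftrightarrow> odd (n :: nat))"
      using less.hyps[of "A - Y"] by blast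
    have "odd (card (cut A \<inter> J)) \<longleftrightarrow> odd (Suc n)"
      if J: "\<forall>Z. dibond Z \<and> cut Z \<subseteq> cut A \<longrightarrow> odd (card (cut Z \<inter> J))" for J
    proof -
      have eq: "cut A \<inter> J = (cut (A - Y) \<inter> J) \<union> (cut Y \<inter> J)" using sub cutA' by blast
      have "card (cut A \<inter> J) = card (cut (A - Y) \<inter> J) + card (cut Y \<inter> J)"
        unfolding eq by (rule card_Un_disjoint) (use cutA' in auto)
      moreover have "odd (card (cut Y \<inter> J))" using J dY sub by blast
      moreover have "\<forall>Z. dibond Z \<and> cut Z \<subseteq> cut (A - Y) \<longrightarrow> odd (card (cut Z \<inter> J))"
        using J cutA' by blast
      ultimately show ?thesis using n[of J] by simp
    qed
    then show ?thesis by blast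
  qed
qed

end

text \<open>
  An oriented bond matroid that is not non-even although all its proper \<open>GB\<close>-minors are. The last
  assumption is non-evenness of the matroid with \<open>e\<close> deleted, transferred to the dibonds of the
  original digraph.
\<close>

locale minimal_even = fin_arc_system +
  assumes no_odd_join: "\<not> has_odd_join"
    and connected: "conn UNIV"
    and no_transitive_arc: "\<not> transitive_arc e"
    and odd_join_avoiding: "e \<in> E \<Longrightarrow> \<exists>J\<subseteq>E. \<forall>X. dibond X \<and> e \<notin> cut X \<longrightarrow> odd (card (cut X \<inter> J))"
begin

lemma reverse: "minimal_even E h t"
proof -
  have all: "(\<forall>X. P (- X)) \<longleftrightarrow> (\<forall>X. P X)" for P :: "'v set \<Rightarrow> bool" by (metis double_complement)
  have "arc_system.has_odd_join E h t = has_odd_join"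
    unfolding arc_system.has_odd_join_def[of E h t] has_odd_join_def rev_simps
    by (subst all[symmetric]) simp
  moreover have "\<exists>J\<subseteq>E. \<forall>X. dibond (- X) \<and> e \<notin> cut X \<longrightarrow> odd (card (cut X \<inter> J))" if "e \<in> E" for e
    using odd_join_avoiding[OF that] by (subst (asm) all[symmetric]) simp
  ultimately show ?thesis
    by unfold_locales (use finite_E no_odd_join connected no_transitive_arc in \<open>simp_all add: rev_simps\<close>)
qed

section \<open>Gluing the sets of two contractions along a dibond\<close>

lemma dibond_conn:
  assumes "dibond Y"
  shows "conn Y" "conn (- Y)"
  using bond_conn[OF connected] assms is_bond_Compl by (auto simp: dibond_def)

text \<open>For each arc of \<open>W\<close>, a path from \<open>x0\<close> to \<open>y0\<close>
  that crosses \<open>Y\<close> in this arc only is added modulo 2. For even \<open>card W\<close>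
  the sum meets every cut evenly, so an even discrepancy on \<open>cut Y\<close> can be
  repaired.\<close>

lemma even_through_dibond:
  assumes Y: "dibond Y" and x0: "x0 \<in> - Y \<inter> ends" and y0: "y0 \<in> Y \<inter> ends"
    and W: "W \<subseteq> cut Y"
  shows "\<exists>Z\<subseteq>E. Z \<inter> cut Y = W \<and>
    (\<forall>U. odd (card (cut U \<inter> Z)) \<longleftrightarrow> odd (card W) \<and> (x0 \<in> U) \<noteq> (y0 \<in> U))"
proof -
  have "finite W" using W finite_cut finite_subset by blast
  then show ?thesis using W
  proof (induction W)
    case empty
    then show ?case by (intro exI[of _ "{}"]) auto
  next
    case (insert s W)
    then obtain Z where Z: "Z \<subseteq> E" "Z \<inter> cut Y = W"
      and parZ: "\<And>U. odd (card (cut U \<inter> Z)) \<longleftrightarrow> odd (card W) \<and> (x0 \<in> U) \<noteq> (y0 \<in> U)"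
      by auto
    have s: "s \<in> E" "t s \<notin> Y" "h s \<in> Y"
      using insert.prems Y by (auto simp: cut_def dibond_def upset_def)
    obtain P where P: "P \<subseteq> {e \<in> E. t e \<in> - Y \<and> h e \<in> - Y}" "joins P x0 (t s)"
      using conn_joins[OF dibond_conn(2)[OF Y] x0, of "t s"] s arc_ends by blast
    obtain Q where Q: "Q \<subseteq> {e \<in> E. t e \<in> Y \<and> h e \<in> Y}" "joins Q (h s) y0"
      using conn_joins[OF dibond_conn(1)[OF Y] _ y0, of "h s"] s arc_ends by blast
    have fin: "finite P" "finite Q" "finite Z" using P(1) Q(1) Z(1) finite_E by (auto intro: finite_subset)
    define R where "R = (P - {s} \<union> ({s} - P)) - Q \<union> (Q - (P - {s} \<union> ({s} - P)))"
    have Ps: "joins (P - {s} \<union> ({s} - P)) x0 (h s)" by (rule joins_extend[OF fin(1) s(1) P(2) refl])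
    have finPs: "finite (P - {s} \<union> ({s} - P))" using fin by simp
    have R: "joins R x0 y0" unfolding R_def by (rule joins_trans[OF finPs fin(2) Ps Q(2)])
    have Req: "R = insert s (P \<union> Q)" using P(1) Q(1) s by (auto simp: R_def)
    have PQ: "P \<inter> cut Y = {}" "Q \<inter> cut Y = {}" using P(1) Q(1) by (auto simp: cut_def)
    have "s \<notin> Z" using Z(2) insert.hyps insert.prems by blast
    define Z' where "Z' = Z - R \<union> (R - Z)"
    have "Z' \<subseteq> E" using Z(1) Req P(1) Q(1) s by (auto simp: Z'_def)
    moreover have "Z' \<inter> cut Y = insert s W"
      using Z(2) PQ \<open>s \<notin> Z\<close> insert.prems unfolding Z'_def Req by blast
    moreover have "odd (card (cut U \<inter> Z')) \<longleftrightarrow> odd (card (insert s W)) \<and> (x0 \<in> U) \<noteq> (y0 \<in> U)" for U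
    proof -
      have "finite R" using fin Req by simp
      then show ?thesis
        using odd_card_sym_diff[OF fin(3), of R "cut U"] parZ[of U]
          R[unfolded joins_def, rule_format, of U] insert.hyps unfolding Z'_def by auto
    qed
    ultimately show ?case by blast
  qed
qed

text \<open>One contracted arc per side is enough, because a dibond without arcs inside
  \<open>Y\<close> in particular avoids \<open>e1\<close>. Both given sets are odd on
  \<open>Y\<close>, so they differ there in an even number of arcs, and the first can be
  corrected.\<close>

lemma aligned_join:
  assumes Y: "dibond Y" and e1: "e1 \<in> inside Y" and e2: "e2 \<in> inside (- Y)"
  obtains J where "\<And>X. dibond X \<Longrightarrow> cut X \<inter> inside Y = {} \<or> cut X \<inter> inside (- Y) = {} \<Longrightarrow>
    odd (card (cut X \<inter> J))"
proof -
  have E12: "e1 \<in> E" "e2 \<in> E" using e1 e2 by (auto simp: inside_def)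
  obtain J1 where J1: "J1 \<subseteq> E" "\<And>X. dibond X \<Longrightarrow> e1 \<notin> cut X \<Longrightarrow> odd (card (cut X \<inter> J1))"
    using odd_join_avoiding[OF E12(1)] by blast
  obtain J2 where J2: "J2 \<subseteq> E" "\<And>X. dibond X \<Longrightarrow> e2 \<notin> cut X \<Longrightarrow> odd (card (cut X \<inter> J2))"
    using odd_join_avoiding[OF E12(2)] by blast
  have fin: "finite J1" "finite J2" using J1(1) J2(1) finite_E finite_subset by blast+
  have e12: "e1 \<notin> cut Y" "e2 \<notin> cut Y" using e1 e2 by (auto simp: inside_def cut_def)
  define W where "W = cut Y \<inter> (J1 - J2 \<union> (J2 - J1))"
  have "even (card W)"
    using J1(2)[OF Y] J2(2)[OF Y] e12 odd_card_sym_diff[OF fin, of "cut Y"] unfolding W_def by blast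
  moreover have "t e2 \<in> - Y \<inter> ends" "t e1 \<in> Y \<inter> ends"
    using e1 e2 arc_ends E12 by (auto simp: inside_def)
  moreover have "W \<subseteq> cut Y" by (simp add: W_def)
  ultimately obtain Z where Z: "Z \<subseteq> E" "Z \<inter> cut Y = W" and evenZ: "\<And>U. even (card (cut U \<inter> Z))"
    using even_through_dibond[OF Y, of "t e2" "t e1" W] by blast
  have finZ: "finite Z" using Z(1) finite_E finite_subset by blast
  define J1' where "J1' = J1 - Z \<union> (Z - J1)"
  have J1': "odd (card (cut X \<inter> J1'))" if "dibond X" "e1 \<notin> cut X" for X
    using odd_card_sym_diff[OF fin(1) finZ, of "cut X"] evenZ[of X] J1(2)[OF that] by (simp add: J1'_def)
  have agree: "J1' \<inter> cut Y = J2 \<inter> cut Y" using Z(2) unfolding J1'_def W_def by blast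
  define J where "J = J1' \<inter> inside (- Y) \<union> J2 \<inter> (inside Y \<union> cut Y)"
  have arcs: "e \<in> inside Y \<or> e \<in> inside (- Y) \<or> e \<in> cut Y" if "e \<in> E" for e
    using that by (auto simp: inside_def cut_def)
  have disj: "inside Y \<inter> inside (- Y) = {}" "inside Y \<inter> cut Y = {}" "inside (- Y) \<inter> cut Y = {}"
    by (auto simp: inside_def cut_def)
  have "odd (card (cut X \<inter> J))"
    if X: "dibond X" and av: "cut X \<inter> inside Y = {} \<or> cut X \<inter> inside (- Y) = {}" for X
    using av
  proof
    assume a: "cut X \<inter> inside Y = {}"
    then have "cut X \<inter> J = cut X \<inter> J1'"
      using agree arcs disj cut_subset[of X] unfolding J_def by blast
    then show ?thesis using J1'[OF X] a e1 by auto
  next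
    assume a: "cut X \<inter> inside (- Y) = {}"
    then have "cut X \<inter> J = cut X \<inter> J2" using arcs disj cut_subset[of X] unfolding J_def by blast
    then show ?thesis using J2(2)[OF X] a e2 by auto
  qed
  then show thesis using that by blast
qed

end

text \<open>The names below use \<open>A\<close> for \<open>I \<inter> Y\<close>, \<open>B\<close>
  for the outside of both sets, \<open>P\<close> for \<open>I - Y\<close> and \<open>Q\<close> for
  \<open>Y - I\<close>. By \<open>cover\<close> and the up-set property, arcs run from
  \<open>B\<close> to the other three parts and from \<open>P\<close> and \<open>Q\<close> to
  \<open>A\<close>, and nowhere else.\<close>

locale crossing_pair = minimal_even +
  fixes I Y
  assumes dI: "dibond I" and dY: "dibond Y" and cover: "E \<subseteq> cut I \<union> cut Y"
    and A_ne: "ends \<inter> I \<inter> Y \<noteq> {}" and B_ne: "ends - I - Y \<noteq> {}"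
    and P_ne: "ends \<inter> I - Y \<noteq> {}" and Q_ne: "ends \<inter> Y - I \<noteq> {}"
begin

section \<open>Symmetries of a crossing pair and adjacency of its parts\<close>

lemma swap: "crossing_pair E t h Y I"
  by unfold_locales (use dI dY cover A_ne B_ne P_ne Q_ne in \<open>auto simp: Int_ac\<close>)

text \<open>The two sets trade places so that \<open>P\<close> and \<open>Q\<close> keep their roles
  under reversal while \<open>A\<close> and \<open>B\<close> are interchanged; \<open>swap\<close>
  in turn exchanges \<open>P\<close> and \<open>Q\<close>.\<close>

lemma reverse_pair: "crossing_pair E h t (- Y) (- I)"
proof -
  interpret rev: minimal_even E h t by (rule reverse)
  show ?thesis
    by unfold_locales (use dI dY cover A_ne B_ne P_ne Q_ne in \<open>auto simp: rev_simps\<close>)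
qed

lemma up: "e \<in> E \<Longrightarrow> t e \<in> I \<Longrightarrow> h e \<in> I" "e \<in> E \<Longrightarrow> t e \<in> Y \<Longrightarrow> h e \<in> Y"
  using dI dY by (auto simp: dibond_def upset_def)

lemma arc_cases: "e \<in> E \<Longrightarrow> t e \<notin> I \<and> h e \<in> I \<or> t e \<notin> Y \<and> h e \<in> Y"
  using cover up by (auto simp: cut_def)

lemma sink: "v \<in> I \<Longrightarrow> v \<in> Y \<Longrightarrow> e \<in> E \<Longrightarrow> t e \<noteq> v"
  using arc_cases up by blast

lemma source: "v \<notin> I \<Longrightarrow> v \<notin> Y \<Longrightarrow> e \<in> E \<Longrightarrow> h e \<noteq> v"
  using arc_cases up by blast

lemma connI: "conn I" "conn (- I)" and connY: "conn Y" "conn (- Y)"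
  using dibond_conn dI dY by auto

lemma conn_arc_at:
  assumes "conn X" "v \<in> X" "v \<in> ends" "w \<in> X" "w \<in> ends" "w \<noteq> v"
  shows "\<exists>e\<in>E. t e \<in> X \<and> h e \<in> X \<and> (t e = v \<or> h e = v) \<and> t e \<noteq> h e"
proof (rule ccontr)
  assume none: "\<not> ?thesis"
  have "X \<inter> ends \<subseteq> {v} \<or> X \<inter> ends \<inter> {v} = {}"
    by (rule conn_cases[OF assms(1)]) (use none in auto)
  then show False using assms by blast
qed

text \<open>In the connected set \<open>I\<close> a vertex of \<open>P\<close> lies on an arc inside
  \<open>I\<close>, and every such arc enters \<open>Y\<close>. The neighbours in the lemmas that
  follow are found in the same way or by symmetry.\<close>

lemma P_out:
  assumes "v \<in> ends" "v \<in> I" "v \<notin> Y"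
  obtains e where "e \<in> E" "t e = v" "h e \<in> I" "h e \<in> Y"
proof -
  obtain a where "a \<in> ends" "a \<in> I" "a \<in> Y" using A_ne by blast
  then obtain e where "e \<in> E" "t e \<in> I" "h e \<in> I" "t e = v \<or> h e = v"
    using conn_arc_at[OF connI(1), of v a] assms by blast
  then show thesis using that arc_cases[of e] assms by blast
qed

lemma A_in_P:
  assumes "v \<in> ends" "v \<in> I" "v \<in> Y"
  obtains e where "e \<in> E" "h e = v" "t e \<in> I" "t e \<notin> Y"
proof -
  obtain p where "p \<in> ends" "p \<in> I" "p \<notin> Y" using P_ne by blast
  then obtain e where "e \<in> E" "t e \<in> I" "h e \<in> I" "t e = v \<or> h e = v"
    using conn_arc_at[OF connI(1), of v p] assms by blast
  then show thesis using that arc_cases[of e] sink[of v e] assms by blast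
qed

lemma A_in_Q:
  assumes "v \<in> ends" "v \<in> I" "v \<in> Y"
  obtains e where "e \<in> E" "h e = v" "t e \<in> Y" "t e \<notin> I"
  using crossing_pair.A_in_P[OF swap] assms by metis

lemma P_in:
  assumes "v \<in> ends" "v \<in> I" "v \<notin> Y"
  obtains e where "e \<in> E" "h e = v" "t e \<notin> I" "t e \<notin> Y"
  using crossing_pair.P_out[OF reverse_pair, unfolded rev_simps, of v] assms by auto

lemma B_out_P:
  assumes "v \<in> ends" "v \<notin> I" "v \<notin> Y"
  obtains e where "e \<in> E" "t e = v" "h e \<in> I" "h e \<notin> Y"
  using crossing_pair.A_in_P[OF reverse_pair, unfolded rev_simps, of v] assms by auto

lemma B_out_Q:
  assumes "v \<in> ends" "v \<notin> I" "v \<notin> Y"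
  obtains e where "e \<in> E" "t e = v" "h e \<in> Y" "h e \<notin> I"
  using crossing_pair.B_out_P[OF swap] assms by metis

lemma sink_in_Y:
  assumes "v \<in> ends" "\<And>e. e \<in> E \<Longrightarrow> t e \<noteq> v"
  shows "v \<in> Y"
  using P_out[of v] B_out_P[of v] assms by metis

lemma source_notin_Y:
  assumes "v \<in> ends" "\<And>e. e \<in> E \<Longrightarrow> h e \<noteq> v"
  shows "v \<notin> Y"
  using crossing_pair.sink_in_Y[OF crossing_pair.swap[OF reverse_pair], unfolded rev_simps, of v] assms by auto

lemma A_star_dibond:
  assumes "a \<in> ends" "a \<in> I" "a \<in> Y"
  shows "dibond {a}"
proof -
  obtain e where e: "e \<in> E" "h e = a" "t e \<in> Y" "t e \<notin> I" using A_in_Q[OF assms] .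
  show ?thesis
  proof (rule dibondI[OF _ _ _ e(1)])
    show "upset {a}" using sink[OF assms(2,3)] by (auto simp: upset_def)
    show "conn {a}" by (rule conn_singleton)
    show "conn (- {a})"
    proof (rule conn_attach[OF connI(2)])
      show "- I \<subseteq> - {a}" using assms by blast
      fix v assume "v \<in> - {a} \<inter> ends - - I"
      then have v: "v \<in> ends" "v \<in> I" by auto
      show "\<exists>e\<in>E. t e = v \<and> h e \<in> - I \<or> h e = v \<and> t e \<in> - I"
      proof (cases "v \<in> Y")
        case True
        then show ?thesis using A_in_Q[OF v] by blast
      next
        case False
        then show ?thesis using P_in[OF v] by blast
      qed
    qed
  qed (use e assms in auto)
qed

text \<open>All vertices of \<open>A\<close> are sinks, so the cut around \<open>A\<close> is the
  disjoint union of their stars, each contributing an odd number.\<close>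

lemma A_parity:
  assumes "\<And>a. a \<in> ends \<inter> I \<inter> Y \<Longrightarrow> odd (card (cut {a} \<inter> J))"
  shows "odd (card (cut (I \<inter> Y) \<inter> J)) \<longleftrightarrow> odd (card (ends \<inter> I \<inter> Y))"
proof -
  let ?A = "ends \<inter> I \<inter> Y"
  have fin: "finite ?A" using finite_ends by blast
  have mem: "e \<in> cut {a} \<longleftrightarrow> e \<in> E \<and> h e = a" if "a \<in> ?A" for a e
    using sink[of a e] that by (auto simp: cut_def)
  have "cut (I \<inter> Y) = (\<Union>a\<in>?A. cut {a})"
  proof (intro equalityI subsetI)
    fix e assume e: "e \<in> cut (I \<inter> Y)"
    then have "e \<in> E" "h e \<in> ?A" using up arc_ends[of e] by (auto simp: cut_def)
    then show "e \<in> (\<Union>a\<in>?A. cut {a})" using mem by blast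
  next
    fix e assume "e \<in> (\<Union>a\<in>?A. cut {a})"
    then obtain a where "a \<in> ?A" "e \<in> E" "h e = a" using mem by blast
    then show "e \<in> cut (I \<inter> Y)" using sink[of "t e" e] by (auto simp: cut_def)
  qed
  then have eq: "cut (I \<inter> Y) \<inter> J = (\<Union>a\<in>?A. cut {a} \<inter> J)" by blast
  have "card (cut (I \<inter> Y) \<inter> J) = (\<Sum>a\<in>?A. card (cut {a} \<inter> J))"
    unfolding eq
  proof (rule card_UN_disjoint[OF fin]; intro ballI impI)
    fix a b assume "a \<in> ?A" "b \<in> ?A" "a \<noteq> b"
    then show "(cut {a} \<inter> J) \<inter> (cut {b} \<inter> J) = {}" using mem by auto
  qed simp
  moreover have "{a \<in> ?A. odd (card (cut {a} \<inter> J))} = ?A" using assms by blast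
  ultimately show ?thesis using even_sum_iff[OF fin, of "\<lambda>a. card (cut {a} \<inter> J)"] by simp
qed

text \<open>\<open>J\<close> is even on \<open>I\<close> and odd on \<open>Y\<close>, hence by
  uncrossing of different parity on the cuts around \<open>A\<close> and around \<open>B\<close>.
  These are the parities of the numbers of stars, since no star of a vertex in \<open>A\<close> or
  \<open>B\<close> has arcs inside both shores of \<open>Y\<close>.\<close>

lemma total_odd:
  assumes J: "\<And>X. dibond X \<Longrightarrow> cut X \<inter> inside Y = {} \<or> cut X \<inter> inside (- Y) = {} \<Longrightarrow>
      odd (card (cut X \<inter> J))"
    and even_I: "even (card (cut I \<inter> J))"
  shows "odd (card (ends \<inter> I \<inter> Y) + card (ends - I - Y))"
proof -
  interpret R: crossing_pair E h t "- Y" "- I" by (rule reverse_pair)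
  have oddY: "odd (card (cut Y \<inter> J))" by (rule J[OF dY]) (auto simp: cut_def inside_def)
  have "odd (card (cut {a} \<inter> J))" if "a \<in> ends \<inter> I \<inter> Y" for a
    by (rule J[OF A_star_dibond]) (use that in \<open>auto simp: cut_def inside_def\<close>)
  then have A: "odd (card (cut (I \<inter> Y) \<inter> J)) \<longleftrightarrow> odd (card (ends \<inter> I \<inter> Y))" by (rule A_parity)
  have "odd (card (cut {b} \<inter> J))" if b: "b \<in> ends \<inter> - Y \<inter> - I" for b
  proof -
    have "dibond (- {b})" using R.A_star_dibond[unfolded rev_simps, of b] b by auto
    then show ?thesis using J[of "- {b}"] b by (auto simp: cut_def inside_def)
  qed
  then have "odd (card (cut (- Y \<inter> - I) \<inter> J)) \<longleftrightarrow> odd (card (ends \<inter> - Y \<inter> - I))"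
    by (rule R.A_parity[unfolded rev_simps])
  moreover have "cut (- Y \<inter> - I) = cut (I \<union> Y)" using cut_Compl[of "I \<union> Y"] by (simp add: Int_commute)
  moreover have "ends \<inter> - Y \<inter> - I = ends - I - Y" by blast
  ultimately have B: "odd (card (cut (I \<union> Y) \<inter> J)) \<longleftrightarrow> odd (card (ends - I - Y))" by simp
  have "upset I" "upset Y" using dI dY by (simp_all add: dibond_def)
  from uncross_parity[OF this, of J] show ?thesis using A B oddY even_I by simp
qed

end

section \<open>The dibond crossing a nontrivial one\<close>

context minimal_even
begin

lemma nontrivial_dibond:
  assumes Y: "dibond Y" and e1: "e1 \<in> inside Y" and e2: "e2 \<in> inside (- Y)"
  obtains I where "crossing_pair E t h I Y" "odd (card (ends \<inter> I \<inter> Y) + card (ends - I - Y))"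
proof -
  obtain J where J: "\<And>X. dibond X \<Longrightarrow> cut X \<inter> inside Y = {} \<or> cut X \<inter> inside (- Y) = {} \<Longrightarrow>
      odd (card (cut X \<inter> J))"
    using aligned_join[OF Y e1 e2] by blast
  have "\<not> (\<forall>X. dibond X \<longrightarrow> odd (card (cut X \<inter> (J \<inter> E))))"
    using no_odd_join unfolding has_odd_join_def by blast
  moreover have "cut X \<inter> (J \<inter> E) = cut X \<inter> J" for X using cut_subset by blast
  ultimately obtain I where I: "dibond I" and evI: "even (card (cut I \<inter> J))" by auto
  obtain f g where f: "f \<in> cut I" "f \<in> inside Y" and g: "g \<in> cut I" "g \<in> inside (- Y)"
    using J[OF I] evI by blast
  have upI: "upset I" and upY: "upset Y" using I Y by (simp_all add: dibond_def)
  have fI: "f \<in> E" "t f \<notin> I" "h f \<in> I" "t f \<in> Y" "h f \<in> Y"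
    using f upI by (auto simp: cut_def inside_def upset_def)
  have gI: "g \<in> E" "t g \<notin> I" "h g \<in> I" "t g \<notin> Y" "h g \<notin> Y"
    using g upI by (auto simp: cut_def inside_def upset_def)
  have oddY: "odd (card (cut Y \<inter> J))" by (rule J[OF Y]) (auto simp: cut_def inside_def)
  \<comment> \<open>The arcs \<open>g\<close> and \<open>f\<close> supply a vertex outside both sets
    and one inside both, which ties together the two complements and the two sets.\<close>
  have A: "upset (I \<inter> Y)" "conn (- (I \<inter> Y))"
  proof -
    show "upset (I \<inter> Y)" using upI upY by (auto simp: upset_def)
    have "conn (- I \<union> - Y)"
      using conn_Un[OF dibond_conn(2)[OF I] dibond_conn(2)[OF Y], of "t g"] gI arc_ends by auto
    then show "conn (- (I \<inter> Y))" by simp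
  qed
  have B: "upset (I \<union> Y)" "conn (I \<union> Y)"
  proof -
    show "upset (I \<union> Y)" using upI upY by (auto simp: upset_def)
    show "conn (I \<union> Y)"
      using conn_Un[OF dibond_conn(1)[OF I] dibond_conn(1)[OF Y], of "h f"] fI arc_ends by auto
  qed
  obtain n where n: "\<And>J. (\<forall>K. dibond K \<and> cut K \<subseteq> cut (I \<inter> Y) \<longrightarrow> odd (card (cut K \<inter> J))) \<Longrightarrow>
      (odd (card (cut (I \<inter> Y) \<inter> J)) \<longleftrightarrow> odd (n :: nat))"
    using dicut_parity[OF connected A] by blast
  interpret rev: minimal_even E h t by (rule reverse)
  obtain m where m: "\<And>J. (\<forall>K. dibond (- K) \<and> cut K \<subseteq> cut (I \<union> Y) \<longrightarrow> odd (card (cut K \<inter> J))) \<Longrightarrow>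
      (odd (card (cut (I \<union> Y) \<inter> J)) \<longleftrightarrow> odd (m :: nat))"
    using rev.dicut_parity[OF rev.connected, of "- (I \<union> Y)", unfolded rev_simps cut_Compl double_complement] B
    by blast
  have "odd (card (cut (I \<inter> Y) \<inter> J)) \<longleftrightarrow> odd n"
  proof (intro n allI impI)
    fix K assume K: "dibond K \<and> cut K \<subseteq> cut (I \<inter> Y)"
    have "cut (I \<inter> Y) \<inter> inside (- Y) = {}" by (auto simp: cut_def inside_def)
    then show "odd (card (cut K \<inter> J))" using J[of K] K by blast
  qed
  moreover have "odd (card (cut (I \<union> Y) \<inter> J)) \<longleftrightarrow> odd m"
  proof (intro m allI impI)
    fix K assume K: "dibond (- K) \<and> cut K \<subseteq> cut (I \<union> Y)"
    have "cut (I \<union> Y) \<inter> inside Y = {}" by (auto simp: cut_def inside_def)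
    then have "cut (- K) \<inter> inside Y = {}" using K by auto
    then show "odd (card (cut K \<inter> J))" using J[of "- K"] K by auto
  qed
  \<comment> \<open>This relation no longer mentions \<open>J\<close>, although \<open>J\<close> was
    used to find it, and can be tested against the set \<open>K\<close> of any contraction.\<close>
  ultimately have nm: "odd n \<noteq> odd m" using uncross_parity[OF upI upY, of J] evI oddY by simp
  have cover: "E \<subseteq> cut I \<union> cut Y"
  proof (rule ccontr)
    assume "\<not> ?thesis"
    then obtain e where e: "e \<in> E" "e \<notin> cut I" "e \<notin> cut Y" by blast
    obtain K where K: "\<And>X. dibond X \<Longrightarrow> e \<notin> cut X \<Longrightarrow> odd (card (cut X \<inter> K))"
      using odd_join_avoiding[OF e(1)] by blast
    have ne: "e \<notin> cut (I \<inter> Y)" "e \<notin> cut (I \<union> Y)" using e by (auto simp: cut_def)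
    have "odd (card (cut (I \<inter> Y) \<inter> K)) \<longleftrightarrow> odd n" by (intro n allI impI K) (use ne in auto)
    moreover have "odd (card (cut (I \<union> Y) \<inter> K)) \<longleftrightarrow> odd m"
    proof (intro m allI impI)
      fix X assume "dibond (- X) \<and> cut X \<subseteq> cut (I \<union> Y)"
      then show "odd (card (cut X \<inter> K))" using K[of "- X"] ne by auto
    qed
    ultimately show False
      using uncross_parity[OF upI upY, of K] K[OF I e(2)] K[OF Y e(3)] nm by simp
  qed
  have "crossing_pair E t h I Y"
    by unfold_locales (use I Y cover fI gI arc_ends in blast)+
  moreover from crossing_pair.total_odd[OF this J evI]
  have "odd (card (ends \<inter> I \<inter> Y) + card (ends - I - Y))" by blast
  ultimately show thesis using that by blast
qed

text \<open>A test for vertices: as soon as a further set is known to be a dibond with arcs on both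
  sides, the position of every sink and source is forced. In \<open>complete_to_B\<close> this
  yields adjacencies.\<close>

lemma nontrivial_dibond_sink:
  assumes "dibond Y" "e1 \<in> inside Y" "e2 \<in> inside (- Y)" "v \<in> ends"
  shows "(\<And>e. e \<in> E \<Longrightarrow> t e \<noteq> v) \<Longrightarrow> v \<in> Y" "(\<And>e. e \<in> E \<Longrightarrow> h e \<noteq> v) \<Longrightarrow> v \<notin> Y"
proof -
  obtain I where "crossing_pair E t h I Y" using nontrivial_dibond[OF assms(1-3)] .
  then interpret crossing_pair E t h I Y .
  show "(\<And>e. e \<in> E \<Longrightarrow> t e \<noteq> v) \<Longrightarrow> v \<in> Y" "(\<And>e. e \<in> E \<Longrightarrow> h e \<noteq> v) \<Longrightarrow> v \<notin> Y"
    using sink_in_Y source_notin_Y assms(4) by blast+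
qed

end

section \<open>The parts \<open>P\<close> and \<open>Q\<close> are single vertices\<close>

context crossing_pair
begin

text \<open>The vertex \<open>r\<close> with its in-neighbours, all of them in \<open>B\<close>,
  forms the tail side of a dibond. This dibond has arcs on both sides, so no source lies on its head
  side; hence \<open>b\<close> is among the in-neighbours.\<close>

lemma complete_to_B:
  assumes r: "r \<in> ends" "r \<in> I" "r \<notin> Y" and b: "b \<in> ends" "b \<notin> I" "b \<notin> Y"
  shows "\<exists>e\<in>E. t e = b \<and> h e = r"
proof -
  define D where "D = insert r {t e | e. e \<in> E \<and> h e = r}"
  have nbr: "v \<notin> I \<and> v \<notin> Y" if v: "v \<in> D" "v \<noteq> r" for v
  proof -
    obtain e where "e \<in> E" "h e = r" "v = t e" using v by (auto simp: D_def)
    then show ?thesis using arc_cases[of e] up[of e] r by blast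
  qed
  have YD: "Y \<subseteq> - D" using nbr r by blast
  obtain e0 where e0: "e0 \<in> E" "t e0 = r" "h e0 \<in> I" "h e0 \<in> Y" using P_out[OF r] .
  obtain e1 where e1: "e1 \<in> E" "h e1 = r" "t e1 \<notin> I" "t e1 \<notin> Y" using P_in[OF r] .
  have d: "dibond (- D)"
  proof (rule dibondI[OF _ _ _ e0(1)])
    show "upset (- D)"
      unfolding upset_def
    proof (intro ballI impI)
      fix e assume e: "e \<in> E" "t e \<in> - D"
      have "h e \<noteq> r" using e by (auto simp: D_def)
      then show "h e \<in> - D" using nbr[of "h e"] source[of "h e" e] e(1) by blast
    qed
    show "conn (- D)"
    proof (rule conn_attach[OF connY(1) YD])
      fix v assume "v \<in> - D \<inter> ends - Y"
      then have v: "v \<in> ends" "v \<notin> Y" by auto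
      show "\<exists>e\<in>E. t e = v \<and> h e \<in> Y \<or> h e = v \<and> t e \<in> Y"
      proof (cases "v \<in> I")
        case True
        then show ?thesis using P_out[OF v(1) _ v(2)] by blast
      next
        case False
        then show ?thesis using B_out_Q[OF v(1) _ v(2)] by blast
      qed
    qed
    have "conn D"
    proof (rule conn_attach[OF conn_singleton[of r]])
      fix v assume "v \<in> D \<inter> ends - {r}"
      then show "\<exists>e\<in>E. t e = v \<and> h e \<in> {r} \<or> h e = v \<and> t e \<in> {r}" by (auto simp: D_def)
    qed (simp add: D_def)
    then show "conn (- (- D))" by simp
    show "t e0 \<notin> - D" using e0 by (simp add: D_def)
    show "h e0 \<in> - D" using e0 YD by blast
  qed
  obtain a where a: "a \<in> ends" "a \<in> I" "a \<in> Y" using A_ne by blast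
  obtain e2 where e2: "e2 \<in> E" "h e2 = a" "t e2 \<in> Y" using A_in_Q[OF a] by blast
  have "e2 \<in> inside (- D)" using e2 a YD by (auto simp: inside_def)
  moreover have "e1 \<in> inside (- (- D))" using e1 by (auto simp: inside_def D_def)
  ultimately have "b \<notin> - D" using nontrivial_dibond_sink(2)[OF d _ _ b(1)] source[OF b(2,3)] by blast
  then show ?thesis using b r by (auto simp: D_def)
qed

lemma complete_to_A:
  assumes "r \<in> ends" "r \<in> I" "r \<notin> Y" "a \<in> ends" "a \<in> I" "a \<in> Y"
  shows "\<exists>e\<in>E. t e = r \<and> h e = a"
  using crossing_pair.complete_to_B[OF reverse_pair, unfolded rev_simps, of r a] assms by auto

text \<open>Thanks to \<open>p\<close>, the set \<open>I - {r}\<close> is still connected and gives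
  a dibond. An arc from \<open>B\<close> to \<open>r\<close> avoids this dibond, \<open>Y\<close>,
  and the cuts around their union and around \<open>A\<close>; the set of its contraction makes
  three of the four terms of the uncrossing odd, hence also the one around \<open>A\<close>. By
  reversal \<open>B\<close> is odd too, against \<open>total_odd\<close>.\<close>

lemma A_odd:
  assumes r: "r \<in> ends" "r \<in> I" "r \<notin> Y" and p: "p \<in> ends" "p \<in> I" "p \<notin> Y" and "r \<noteq> p"
  shows "odd (card (ends \<inter> I \<inter> Y))"
proof -
  obtain e where e: "e \<in> E" "h e = r" "t e \<notin> I" "t e \<notin> Y" using P_in[OF r] .
  obtain ep where ep: "ep \<in> E" "h ep = p" "t ep \<notin> I" "t ep \<notin> Y" using P_in[OF p] .
  obtain er where er: "er \<in> E" "t er = r" "h er \<in> I" "h er \<in> Y" using P_out[OF r] .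
  let ?I = "I - {r}"
  have upI: "upset ?I" unfolding upset_def using up source arc_cases r by blast
  have upU: "upset (?I \<union> Y)" using upI up by (auto simp: upset_def)
  have dI': "dibond ?I"
  proof (rule dibondI[OF upI _ _ ep(1)])
    have star: "conn (insert p (I \<inter> Y))"
    proof (rule conn_attach[OF conn_singleton[of p]])
      fix v assume "v \<in> insert p (I \<inter> Y) \<inter> ends - {p}"
      then show "\<exists>e\<in>E. t e = v \<and> h e \<in> {p} \<or> h e = v \<and> t e \<in> {p}"
        using complete_to_A[OF p, of v] by blast
    qed simp
    show "conn ?I"
    proof (rule conn_attach[OF star])
      fix v assume "v \<in> ?I \<inter> ends - insert p (I \<inter> Y)"
      then show "\<exists>e\<in>E. t e = v \<and> h e \<in> insert p (I \<inter> Y) \<or> h e = v \<and> t e \<in> insert p (I \<inter> Y)"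
        using P_out[of v] by blast
    qed (use r p \<open>r \<noteq> p\<close> in blast)
    show "conn (- ?I)"
    proof (rule conn_attach[OF connI(2)])
      fix v assume "v \<in> - ?I \<inter> ends - - I"
      then have "v = r" by blast
      then show "\<exists>e\<in>E. t e = v \<and> h e \<in> - I \<or> h e = v \<and> t e \<in> - I" using e by blast
    qed blast
  qed (use ep p \<open>r \<noteq> p\<close> in auto)
  have dU: "dibond (?I \<union> Y)"
  proof (rule dibondI[OF upU _ _ er(1)])
    show "conn (?I \<union> Y)"
    proof (rule conn_attach[OF connY(1)])
      fix v assume "v \<in> (?I \<union> Y) \<inter> ends - Y"
      then show "\<exists>e\<in>E. t e = v \<and> h e \<in> Y \<or> h e = v \<and> t e \<in> Y" using P_out[of v] by blast
    qed blast
    show "conn (- (?I \<union> Y))"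
    proof (rule conn_attach[OF conn_singleton[of r]])
      fix v assume "v \<in> - (?I \<union> Y) \<inter> ends - {r}"
      then show "\<exists>e\<in>E. t e = v \<and> h e \<in> {r} \<or> h e = v \<and> t e \<in> {r}"
        using complete_to_B[OF r, of v] by blast
    qed (use r in blast)
  qed (use er r in auto)
  obtain J where J: "\<And>X. dibond X \<Longrightarrow> e \<notin> cut X \<Longrightarrow> odd (card (cut X \<inter> J))"
    using odd_join_avoiding[OF e(1)] by blast
  have "odd (card (cut ?I \<inter> J))" by (rule J[OF dI']) (use e in \<open>auto simp: cut_def\<close>)
  moreover have "odd (card (cut Y \<inter> J))" by (rule J[OF dY]) (use e r in \<open>auto simp: cut_def\<close>)
  moreover have "odd (card (cut (?I \<union> Y) \<inter> J))" by (rule J[OF dU]) (use e r in \<open>auto simp: cut_def\<close>)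
  moreover have "odd (card (cut (I \<inter> Y) \<inter> J)) \<longleftrightarrow> odd (card (ends \<inter> I \<inter> Y))"
  proof (rule A_parity)
    fix a assume a: "a \<in> ends \<inter> I \<inter> Y"
    show "odd (card (cut {a} \<inter> J))" by (rule J[OF A_star_dibond]) (use a e r in \<open>auto simp: cut_def\<close>)
  qed
  moreover have "?I \<inter> Y = I \<inter> Y" using r by blast
  moreover have "upset Y" using dY by (simp add: dibond_def)
  ultimately show ?thesis using uncross_parity[OF upI, of Y J] by simp
qed

lemma P_unique:
  assumes "odd (card (ends \<inter> I \<inter> Y) + card (ends - I - Y))"
    and r: "r \<in> ends" "r \<in> I" "r \<notin> Y" and p: "p \<in> ends" "p \<in> I" "p \<notin> Y"
  shows "r = p"
proof (rule ccontr)
  assume ne: "r \<noteq> p"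
  have "odd (card (ends \<inter> - Y \<inter> - I))"
    using crossing_pair.A_odd[OF reverse_pair, unfolded rev_simps, of r p] r p ne by auto
  moreover have "ends \<inter> - Y \<inter> - I = ends - I - Y" by blast
  ultimately show False using A_odd[OF r p ne] assms(1) by simp
qed

lemma P_Q_unique:
  assumes "odd (card (ends \<inter> I \<inter> Y) + card (ends - I - Y))"
  obtains p q where "ends \<inter> I - Y = {p}" "ends \<inter> Y - I = {q}"
proof -
  interpret S: crossing_pair E t h Y I by (rule swap)
  have *: "ends \<inter> Y \<inter> I = ends \<inter> I \<inter> Y" "ends - Y - I = ends - I - Y" by blast+
  obtain p q where p: "p \<in> ends \<inter> I - Y" and q: "q \<in> ends \<inter> Y - I" using P_ne Q_ne by blast
  have "ends \<inter> I - Y = {p}" using P_unique[OF assms, of _ p] p by blast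
  moreover have "ends \<inter> Y - I = {q}" using S.P_unique[unfolded *, OF assms, of _ q] q by blast
  ultimately show thesis using that by blast
qed

end

section \<open>Minimal even bond matroids are forbidden ones\<close>

text \<open>Intersecting with \<open>verts D\<close> changes no cut, so ranging over all sets of the
  vertex type gives the same bonds.\<close>

lemma bond_matroid_eq_bmat:
  assumes "wf_digraph D"
  shows "bond_matroid D = arc_system.bmat (arcs D) (tail D) (head D)"
proof -
  interpret wf_digraph D by fact
  interpret G: arc_system "arcs D" "tail D" "head D" .
  have leave: "arcs_between D X (verts D - X) = G.leave X" "arcs_between D (verts D - X) X = G.leave (- X)"
    for X by (auto simp: arcs_between_def G.leave_def)
  have cut: "edge_cut D X = G.cut X" for X unfolding edge_cut_def leave G.cut_eq_leave ..
  have restrict: "G.cut (X \<inter> verts D) = G.cut X" "G.leave (X \<inter> verts D) = G.leave X"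
    "G.leave (- (X \<inter> verts D)) = G.leave (- X)" for X
    by (auto simp: G.cut_def G.leave_def)
  have all: "(\<forall>X\<subseteq>verts D. Q (G.cut X)) \<longleftrightarrow> (\<forall>X. Q (G.cut X))" for Q
    using restrict(1) by (metis inf_le2)
  have bond: "bond D (G.cut X) \<longleftrightarrow> G.is_bond X" for X
  proof -
    have "\<exists>Z\<subseteq>verts D. G.cut X = G.cut Z" using restrict(1) by (metis inf_le2)
    then show ?thesis unfolding bond_def G.is_bond_def cut all[of "\<lambda>C. C \<subseteq> _ \<and> C \<noteq> {} \<longrightarrow> C = _"] by blast
  qed
  have "{(G.leave X, G.leave (- X)) | X. X \<subseteq> verts D \<and> G.is_bond X} =
      {(G.leave X, G.leave (- X)) | X. G.is_bond X}" (is "?L = ?R")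
  proof
    show "?R \<subseteq> ?L"
    proof
      fix C assume "C \<in> ?R"
      then obtain X where X: "C = (G.leave X, G.leave (- X))" "G.is_bond X" by blast
      have "C = (G.leave (X \<inter> verts D), G.leave (- (X \<inter> verts D)))" unfolding restrict X(1) ..
      moreover have "G.is_bond (X \<inter> verts D)" using X(2) unfolding G.is_bond_def restrict .
      ultimately show "C \<in> ?L" by blast
    qed
  qed blast
  then show ?thesis unfolding bond_matroid_def G.bmat_def leave cut bond by simp
qed

lemma wf_complete_bipartite: "wf_digraph (complete_bipartite_dir m n)"
  by unfold_locales (auto simp: complete_bipartite_dir_def)

lemma bond_matroid_complete_bipartite:
  "bond_matroid (complete_bipartite_dir m n) =
    arc_system.bmat ({..<m} \<times> {..<n}) (\<lambda>e. Inl (fst e)) (\<lambda>e. Inr (snd e))"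
  by (subst bond_matroid_eq_bmat[OF wf_complete_bipartite]) (simp add: complete_bipartite_dir_def)

lemma signed_circuits_bmat_image:
  fixes t h :: "'a \<Rightarrow> 'v" and t' h' :: "'b \<Rightarrow> 'w"
  assumes f: "bij_betw f E E'" and p: "inj_on p (arc_system.ends E t h)"
    and th: "\<And>e. e \<in> E \<Longrightarrow> t' (f e) = p (t e) \<and> h' (f e) = p (h e)"
  shows "signed_circuits (arc_system.bmat E' t' h') =
    (\<lambda>C. (f ` fst C, f ` snd C)) ` signed_circuits (arc_system.bmat E t h)"
proof -
  interpret G: arc_system E t h .
  interpret H: arc_system E' t' h' .
  have E': "E' = f ` E" using f by (simp add: bij_betw_def)
  have inj: "inj_on f E" using f by (simp add: bij_betw_def)
  have leave: "H.leave X = f ` G.leave (p -` X)" for X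
    unfolding H.leave_def G.leave_def unfolding E' using th by auto
  have cut: "H.cut X = f ` G.cut (p -` X)" for X
    unfolding H.cut_def G.cut_def unfolding E' using th by auto
  have pull: "G.leave (p -` (p ` (X \<inter> G.ends))) = G.leave X"
      "G.leave (p -` (- (p ` (X \<inter> G.ends)))) = G.leave (- X)"
      "G.cut (p -` (p ` (X \<inter> G.ends))) = G.cut X" for X
  proof -
    have "p v \<in> p ` (X \<inter> G.ends) \<longleftrightarrow> v \<in> X" if "v \<in> G.ends" for v
      using inj_on_image_mem_iff[OF p that, of "X \<inter> G.ends"] that by blast
    then show "G.leave (p -` (p ` (X \<inter> G.ends))) = G.leave X"
      "G.leave (p -` (- (p ` (X \<inter> G.ends)))) = G.leave (- X)"
      "G.cut (p -` (p ` (X \<inter> G.ends))) = G.cut X"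
      using G.arc_ends by (auto simp: G.leave_def G.cut_def)
  qed
  have sub: "f ` G.cut X \<subseteq> f ` G.cut Z \<longleftrightarrow> G.cut X \<subseteq> G.cut Z"
    "f ` G.cut X = f ` G.cut Z \<longleftrightarrow> G.cut X = G.cut Z" for X Z
  proof -
    have mem: "f e \<in> f ` G.cut Z \<longleftrightarrow> e \<in> G.cut Z" if "e \<in> E" for e Z
      using inj_on_image_mem_iff[OF inj that G.cut_subset] .
    show "f ` G.cut X \<subseteq> f ` G.cut Z \<longleftrightarrow> G.cut X \<subseteq> G.cut Z"
      using mem G.cut_subset[of X] by blast
    show "f ` G.cut X = f ` G.cut Z \<longleftrightarrow> G.cut X = G.cut Z"
      by (rule inj_on_image_eq_iff[OF inj G.cut_subset G.cut_subset])
  qed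
  have bond: "H.is_bond X \<longleftrightarrow> G.is_bond (p -` X)" for X
  proof -
    have "(\<forall>Z. Q (G.cut (p -` Z))) \<longleftrightarrow> (\<forall>Z. Q (G.cut Z))" for Q using pull(3) by metis
    from this[of "\<lambda>C. C \<subseteq> G.cut (p -` X) \<and> C \<noteq> {} \<longrightarrow> C = G.cut (p -` X)"]
    show ?thesis unfolding H.is_bond_def G.is_bond_def cut sub by simp
  qed
  have "{(H.leave X, H.leave (- X)) | X. H.is_bond X} =
      (\<lambda>C. (f ` fst C, f ` snd C)) ` {(G.leave X, G.leave (- X)) | X. G.is_bond X}" (is "?L = ?R")
  proof (intro equalityI subsetI)
    fix C assume "C \<in> ?L"
    then obtain X where "C = (H.leave X, H.leave (- X))" "H.is_bond X" by blast
    then have "C = (f ` G.leave (p -` X), f ` G.leave (- (p -` X)))" "G.is_bond (p -` X)"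
      by (simp_all add: leave bond vimage_Compl)
    then show "C \<in> ?R" by force
  next
    fix C assume "C \<in> ?R"
    then obtain X where X: "C = (f ` G.leave X, f ` G.leave (- X))" "G.is_bond X" by auto
    let ?X = "p ` (X \<inter> G.ends)"
    have "C = (H.leave ?X, H.leave (- ?X))" unfolding leave X pull ..
    moreover have "H.is_bond ?X" using X(2) unfolding bond G.is_bond_def pull .
    ultimately show "C \<in> ?L" by blast
  qed
  then show ?thesis by (simp only: G.signed_circuits_bmat H.signed_circuits_bmat)
qed

lemma bmat_iso:
  fixes t h :: "'a \<Rightarrow> 'v" and t' h' :: "'b \<Rightarrow> 'w"
  assumes "bij_betw f E E'" and "inj_on p (arc_system.ends E t h)"
    and "\<And>e. e \<in> E \<Longrightarrow> t' (f e) = p (t e) \<and> h' (f e) = p (h e)"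
  shows "om_iso (arc_system.bmat E t h) (arc_system.bmat E' t' h')"
  unfolding om_iso_def using signed_circuits_bmat_image[OF assms] assms(1)
  by (intro exI[of _ f]) (simp add: arc_system.elements_bmat)

text \<open>
  Two hubs \<open>p\<close> and \<open>q\<close> joined through legs that are sinks (if \<open>sk l\<close>) or sources. At a source leg
  the labels of the two arcs are exchanged: this is the twist at the 2-separation \<open>{p, q}\<close> that makes
  the bond matroid independent of \<open>sk\<close>.
\<close>

locale theta = arc_system E t h for E :: "'a set" and t h :: "'a \<Rightarrow> 'v" +
  fixes p q :: 'v and L :: "'v set" and sk :: "'v \<Rightarrow> bool" and a0 a1 :: "'v \<Rightarrow> 'a"
  assumes E_eq: "E = a0 ` L \<union> a1 ` L" and pq: "p \<noteq> q" "p \<notin> L" "q \<notin> L"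
    and a0: "l \<in> L \<Longrightarrow> t (a0 l) = (if sk l then p else l) \<and> h (a0 l) = (if sk l then l else q)"
    and a1: "l \<in> L \<Longrightarrow> t (a1 l) = (if sk l then q else l) \<and> h (a1 l) = (if sk l then l else p)"
    and two_legs: "\<exists>l\<in>L. \<exists>l'\<in>L. l \<noteq> l'"
begin

lemma inj_a0: "inj_on a0 L"
proof (rule inj_onI)
  fix x y assume "x \<in> L" "y \<in> L" "a0 x = a0 y"
  then show "x = y" using a0[of x] a0[of y] pq by (auto split: if_splits)
qed

lemma inj_a1: "inj_on a1 L"
proof (rule inj_onI)
  fix x y assume "x \<in> L" "y \<in> L" "a1 x = a1 y"
  then show "x = y" using a1[of x] a1[of y] pq by (auto split: if_splits)
qed

lemma a0_neq_a1: "x \<in> L \<Longrightarrow> y \<in> L \<Longrightarrow> a0 x \<noteq> a1 y"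
  using a0[of x] a1[of y] pq by (auto split: if_splits)

lemma a_in_E: "l \<in> L \<Longrightarrow> a0 l \<in> E" "l \<in> L \<Longrightarrow> a1 l \<in> E"
  by (auto simp: E_eq)

lemma leg_separated:
  "l \<in> L \<Longrightarrow> (p \<in> Z) \<noteq> (q \<in> Z) \<Longrightarrow> a0 l \<in> cut Z \<longleftrightarrow> a1 l \<notin> cut Z"
  using a0[of l] a1[of l] a_in_E[of l] by (auto simp: cut_def)

lemma leg_together:
  "l \<in> L \<Longrightarrow> (p \<in> Z) = (q \<in> Z) \<Longrightarrow> (a0 l \<in> cut Z \<longleftrightarrow> (l \<in> Z) \<noteq> (p \<in> Z)) \<and> (a1 l \<in> cut Z \<longleftrightarrow> (l \<in> Z) \<noteq> (p \<in> Z))"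
  using a0[of l] a1[of l] a_in_E[of l] by (auto simp: cut_def)

text \<open>A cut separating the hubs contains exactly one arc of each leg, and any other nonempty
  cut contains both arcs of some leg. Inclusion in a cut of the first kind thus forces
  equality.\<close>

lemma bond_separated:
  assumes "(p \<in> Z) \<noteq> (q \<in> Z)"
  shows "is_bond Z"
  unfolding is_bond_def
proof (intro conjI allI impI)
  show "cut Z \<noteq> {}" using two_legs leg_separated[OF _ assms] by blast
  fix W assume W: "cut W \<subseteq> cut Z \<and> cut W \<noteq> {}"
  have sep: "(p \<in> W) \<noteq> (q \<in> W)"
  proof (rule ccontr)
    assume tog: "\<not> ?thesis"
    obtain e where e: "e \<in> cut W" using W by blast
    then obtain l where l: "l \<in> L" "e = a0 l \<or> e = a1 l" using cut_subset[of W] E_eq by blast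
    then have "a0 l \<in> cut W" "a1 l \<in> cut W" using leg_together[of l W] tog e by auto
    then show False using leg_separated[OF l(1) assms] W by blast
  qed
  have "cut Z \<subseteq> cut W"
  proof
    fix e assume e: "e \<in> cut Z"
    then obtain l where l: "l \<in> L" "e = a0 l \<or> e = a1 l" using cut_subset[of Z] E_eq by blast
    then show "e \<in> cut W" using leg_separated[OF l(1) assms] leg_separated[OF l(1) sep] e W by blast
  qed
  then show "cut W = cut Z" using W by blast
qed

lemma cut_leg: "l \<in> L \<Longrightarrow> cut {l} = {a0 l, a1 l}"
  using a0 a1 pq unfolding cut_def unfolding E_eq by (auto split: if_splits)

lemma bond_leg:
  assumes l: "l \<in> L"
  shows "is_bond {l}"
  unfolding is_bond_def
proof (intro conjI allI impI)
  show "cut {l} \<noteq> {}" using cut_leg[OF l] by blast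
  fix W assume W: "cut W \<subseteq> cut {l} \<and> cut W \<noteq> {}"
  have "\<not> (p \<in> W) \<noteq> (q \<in> W)"
  proof
    assume sep: "(p \<in> W) \<noteq> (q \<in> W)"
    \<comment> \<open>A cut separating the hubs needs an arc on the second leg \<open>k\<close>, so
      it does not fit into \<open>cut {l}\<close>.\<close>
    obtain k where k: "k \<in> L" "k \<noteq> l" using two_legs by blast
    have "a0 k \<in> cut W \<or> a1 k \<in> cut W" using leg_separated[OF k(1) sep] by blast
    then have "a0 k \<in> {a0 l, a1 l} \<or> a1 k \<in> {a0 l, a1 l}" using W cut_leg[OF l] by blast
    then show False
      using k l a0_neq_a1[of k l] a0_neq_a1[of l k] inj_onD[OF inj_a0, of k l] inj_onD[OF inj_a1, of k l]
      by auto
  qed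
  then have tog: "(p \<in> W) = (q \<in> W)" by blast
  show "cut W = cut {l}" using leg_together[OF l tog] W unfolding cut_leg[OF l] by blast
qed

lemma bond_together:
  assumes "is_bond Z" and tog: "(p \<in> Z) = (q \<in> Z)"
  obtains l where "l \<in> L" "cut Z = {a0 l, a1 l}" "leave Z = {} \<or> leave (- Z) = {}"
proof -
  obtain e where e: "e \<in> cut Z" using assms(1) by (auto simp: is_bond_def)
  then obtain l where l: "l \<in> L" "e = a0 l \<or> e = a1 l" using cut_subset[of Z] E_eq by blast
  have both: "a0 l \<in> cut Z" "a1 l \<in> cut Z" using leg_together[OF l(1) tog] e l(2) by auto
  then have eq: "cut Z = {a0 l, a1 l}"
    using assms(1) cut_leg[OF l(1)] unfolding is_bond_def by (metis empty_subsetI insert_not_empty insert_subset)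
  have "leave Z \<subseteq> {a0 l, a1 l}" "leave (- Z) \<subseteq> {a0 l, a1 l}" using eq by (auto simp: cut_eq_leave)
  then have "leave Z = {} \<or> leave (- Z) = {}"
    using both a0[OF l(1)] a1[OF l(1)] tog by (auto simp: leave_def cut_def split: if_splits)
  then show thesis using that l(1) eq by blast
qed

text \<open>Along each leg \<open>a0 l\<close> points from \<open>p\<close> towards \<open>q\<close>
  and \<open>a1 l\<close> from \<open>q\<close> towards \<open>p\<close>, at sinks and sources
  alike; this is what the exchange of labels achieves.\<close>

lemma leave_separated:
  assumes "p \<in> Z" "q \<notin> Z"
  defines "U \<equiv> {l \<in> L. sk l \<longleftrightarrow> l \<notin> Z}"
  shows "leave Z = a0 ` U" "leave (- Z) = a1 ` (L - U)"
  using assms(1,2) a0 a1 pq unfolding leave_def U_def unfolding E_eq by (auto split: if_splits)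

text \<open>The right-hand side is free of \<open>sk\<close>: only the grouping of the arcs into
  labelled pairs counts. This makes the comparison with the all-sink case, \<open>K_(2,n)\<close>,
  possible.\<close>

lemma signed_circuits_theta:
  "signed_circuits bmat =
    (\<Union>l\<in>L. {({a0 l, a1 l}, {}), ({}, {a0 l, a1 l})}) \<union>
    (\<Union>U\<in>Pow L. {(a0 ` U, a1 ` (L - U)), (a1 ` (L - U), a0 ` U)})" (is "_ = ?R")
proof (intro equalityI subsetI)
  fix C assume "C \<in> signed_circuits bmat"
  then obtain Z where Z: "is_bond Z" "C = (leave Z, leave (- Z))" unfolding signed_circuits_bmat by blast
  have sep: "\<exists>U\<in>Pow L. leave W = a0 ` U \<and> leave (- W) = a1 ` (L - U)" if "p \<in> W" "q \<notin> W" for W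
    using leave_separated[OF that] by (intro bexI[of _ "{l \<in> L. sk l \<longleftrightarrow> l \<notin> W}"]) auto
  consider "p \<in> Z" "q \<notin> Z" | "p \<notin> Z" "q \<in> Z" | "(p \<in> Z) = (q \<in> Z)" by blast
  then show "C \<in> ?R"
  proof cases
    case 1
    from sep[OF this] obtain U where U: "U \<in> Pow L" "leave Z = a0 ` U \<and> leave (- Z) = a1 ` (L - U)" ..
    show ?thesis unfolding Z(2) by (intro UnI2 UN_I[OF U(1)]) (simp add: U(2))
  next
    case 2
    then have "p \<in> - Z" "q \<notin> - Z" by auto
    from sep[OF this] obtain U where U: "U \<in> Pow L" "leave (- Z) = a0 ` U \<and> leave (- (- Z)) = a1 ` (L - U)" ..
    show ?thesis unfolding Z(2) by (intro UnI2 UN_I[OF U(1)]) (use U(2) in simp)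
  next
    case 3
    obtain l where l: "l \<in> L" "cut Z = {a0 l, a1 l}" "leave Z = {} \<or> leave (- Z) = {}"
      by (rule bond_together[OF Z(1) 3])
    have "C \<in> {({a0 l, a1 l}, {}), ({}, {a0 l, a1 l})}" using l(2,3) unfolding Z(2) cut_eq_leave by auto
    then show ?thesis using l(1) by blast
  qed
next
  have circ: "(leave Z, leave (- Z)) \<in> signed_circuits bmat" if "is_bond Z" for Z
    using that unfolding signed_circuits_bmat by blast
  fix C assume "C \<in> ?R"
  then consider l where "l \<in> L" "C = ({a0 l, a1 l}, {}) \<or> C = ({}, {a0 l, a1 l})"
    | U where "U \<subseteq> L" "C = (a0 ` U, a1 ` (L - U)) \<or> C = (a1 ` (L - U), a0 ` U)" by blast
  then show "C \<in> signed_circuits bmat"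
  proof cases
    case (1 l)
    have tog: "(p \<in> {l}) = (q \<in> {l})" using pq 1(1) by blast
    have "leave {l} = {} \<or> leave (- {l}) = {}"
      by (rule bond_together[OF bond_leg[OF 1(1)] tog])
    moreover have "leave {l} \<union> leave (- {l}) = {a0 l, a1 l}" using cut_leg[OF 1(1)] by (simp add: cut_eq_leave)
    ultimately have "C = (leave {l}, leave (- {l})) \<or> C = (leave (- {l}), leave (- (- {l})))"
      using 1(2) by auto
    then show ?thesis using circ[of "{l}"] circ[of "- {l}"] bond_leg[OF 1(1)] by auto
  next
    case (2 U)
    define Z where "Z = insert p {l \<in> L. sk l \<longleftrightarrow> l \<notin> U}"
    have Z: "p \<in> Z" "q \<notin> Z" using pq by (auto simp: Z_def)
    have "{l \<in> L. sk l \<longleftrightarrow> l \<notin> Z} = U" using 2(1) pq by (auto simp: Z_def)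
    with leave_separated[OF Z] have "leave Z = a0 ` U" "leave (- Z) = a1 ` (L - U)" by simp_all
    then have "C = (leave Z, leave (- Z)) \<or> C = (leave (- Z), leave (- (- Z)))" using 2(2) by simp
    then show ?thesis using circ[of Z] circ[of "- Z"] bond_separated[of Z] Z by auto
  qed
qed

end

lemma theta_iso:
  assumes "theta E t h p q L sk a0 a1" "theta E' t' h' p' q' L' sk' b0 b1" and \<pi>: "bij_betw \<pi> L L'"
  shows "om_iso (arc_system.bmat E t h) (arc_system.bmat E' t' h')"
proof -
  interpret G: theta E t h p q L sk a0 a1 by fact
  interpret H: theta E' t' h' p' q' L' sk' b0 b1 by fact
  define f where "f e = (if e \<in> a0 ` L then b0 (\<pi> (inv_into L a0 e)) else b1 (\<pi> (inv_into L a1 e)))" for e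
  have f0: "f (a0 l) = b0 (\<pi> l)" if "l \<in> L" for l
    using that by (simp add: f_def inv_into_f_f[OF G.inj_a0])
  have f1: "f (a1 l) = b1 (\<pi> l)" if "l \<in> L" for l
  proof -
    have "a1 l \<notin> a0 ` L" by (metis G.a0_neq_a1 imageE that)
    then show ?thesis using that by (simp add: f_def inv_into_f_f[OF G.inj_a1])
  qed
  have \<pi>L: "\<pi> ` L = L'" "inj_on \<pi> L" using \<pi> by (auto simp: bij_betw_def)
  have im0: "f ` a0 ` U = b0 ` \<pi> ` U" and im1: "f ` a1 ` U = b1 ` \<pi> ` U" if "U \<subseteq> L" for U
    using that f0 f1 by (auto simp: image_image intro!: image_cong)
  have "inj_on f E"
  proof (rule inj_onI)
    fix x y assume xy: "x \<in> E" "y \<in> E" "f x = f y"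
    have \<pi>m: "\<pi> l \<in> L'" if "l \<in> L" for l using \<pi>L(1) that by blast
    have c0: "l = k" if "l \<in> L" "k \<in> L" "b0 (\<pi> l) = b0 (\<pi> k)" for l k
      using that \<pi>m inj_onD[OF H.inj_a0] inj_onD[OF \<pi>L(2)] by blast
    have c1: "l = k" if "l \<in> L" "k \<in> L" "b1 (\<pi> l) = b1 (\<pi> k)" for l k
      using that \<pi>m inj_onD[OF H.inj_a1] inj_onD[OF \<pi>L(2)] by blast
    have c01: "b0 (\<pi> l) \<noteq> b1 (\<pi> k)" if "l \<in> L" "k \<in> L" for l k
      using that \<pi>m H.a0_neq_a1 by blast
    from xy(1,2) obtain l k where "l \<in> L" "k \<in> L" "x = a0 l \<or> x = a1 l" "y = a0 k \<or> y = a1 k"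
      unfolding G.E_eq by blast
    then show "x = y" using xy(3) c0[of l k] c1[of l k] c01[of l k] c01[of k l] by (auto simp: f0 f1)
  qed
  moreover have "f ` E = E'"
    unfolding G.E_eq H.E_eq image_Un im0[OF subset_refl] im1[OF subset_refl] \<pi>L(1) ..
  ultimately have bij: "bij_betw f E E'" by (simp add: bij_betw_def)
  let ?F = "\<lambda>C. (f ` fst C, f ` snd C)"
  have 1: "?F ` (\<Union>l\<in>L. {({a0 l, a1 l}, {}), ({}, {a0 l, a1 l})}) =
      (\<Union>l\<in>L'. {({b0 l, b1 l}, {}), ({}, {b0 l, b1 l})})"
  proof -
    have "?F ` (\<Union>l\<in>L. {({a0 l, a1 l}, {}), ({}, {a0 l, a1 l})}) =
        (\<Union>l\<in>L. {({b0 (\<pi> l), b1 (\<pi> l)}, {}), ({}, {b0 (\<pi> l), b1 (\<pi> l)})})"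
      unfolding image_UN by (intro SUP_cong refl) (simp add: f0 f1)
    then show ?thesis unfolding \<pi>L(1)[symmetric] by simp
  qed
  have 2: "?F ` (\<Union>U\<in>Pow L. {(a0 ` U, a1 ` (L - U)), (a1 ` (L - U), a0 ` U)}) =
      (\<Union>U\<in>Pow L'. {(b0 ` U, b1 ` (L' - U)), (b1 ` (L' - U), b0 ` U)})"
  proof -
    have "\<pi> ` (L - U) = L' - \<pi> ` U" if "U \<subseteq> L" for U
      using \<pi>L that inj_on_image_set_diff[of \<pi> L L U] by auto
    then have "?F ` (\<Union>U\<in>Pow L. {(a0 ` U, a1 ` (L - U)), (a1 ` (L - U), a0 ` U)}) =
        (\<Union>U\<in>Pow L. {(b0 ` \<pi> ` U, b1 ` (L' - \<pi> ` U)), (b1 ` (L' - \<pi> ` U), b0 ` \<pi> ` U)})"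
      unfolding image_UN by (intro SUP_cong refl) (simp add: im0 im1)
    also have "\<dots> = (\<Union>U\<in>image \<pi> ` Pow L. {(b0 ` U, b1 ` (L' - U)), (b1 ` (L' - U), b0 ` U)})"
      by simp
    also have "image \<pi> ` Pow L = Pow L'" using image_Pow_surj[OF \<pi>L(1)] .
    finally show ?thesis .
  qed
  show ?thesis
    unfolding om_iso_def
    using bij by (intro exI[of _ f])
      (simp add: G.signed_circuits_theta H.signed_circuits_theta image_Un 1 2)
qed

lemma theta_complete_bipartite:
  assumes "n \<ge> 2"
  shows "theta ({..<2 :: nat} \<times> {..<n}) (\<lambda>e. Inl (fst e)) (\<lambda>e. Inr (snd e))
    (Inl 0 :: nat + nat) (Inl 1) (Inr ` {..<n}) (\<lambda>_. True) (\<lambda>l. (0, projr l)) (\<lambda>l. (1, projr l))"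
proof
  show "{..<2 :: nat} \<times> {..<n} = (\<lambda>l :: nat + nat. (0, projr l)) ` Inr ` {..<n} \<union>
      (\<lambda>l :: nat + nat. (1, projr l)) ` Inr ` {..<n}"
    by (auto simp: image_image less_2_cases_iff)
  show "\<exists>l\<in>Inr ` {..<n}. \<exists>l'\<in>Inr ` {..<n}. (l :: nat + nat) \<noteq> l'"
    using assms by (intro bexI[of _ "Inr 0"] bexI[of _ "Inr 1"]) auto
qed auto

context fin_arc_system
begin

lemma cut_cong:
  assumes "X \<inter> ends = Z \<inter> ends"
  shows "cut X = cut Z"
proof -
  have "v \<in> X \<longleftrightarrow> v \<in> Z" if "v \<in> ends" for v using assms that by blast
  then show ?thesis using arc_ends by (auto simp: cut_def)
qed

text \<open>Paths from all vertices of \<open>U\<close> to \<open>x0\<close>, added modulo 2, form a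
  \<open>U\<close>-join; for odd \<open>card U\<close> the vertex \<open>x0\<close> absorbs the
  defect.\<close>

lemma vertex_join:
  assumes "conn UNIV" "x0 \<in> ends" "U \<subseteq> ends"
  shows "\<exists>J\<subseteq>E. \<forall>Z. odd (card (cut Z \<inter> J)) \<longleftrightarrow> odd (card (U \<inter> Z)) \<noteq> (odd (card U) \<and> x0 \<in> Z)"
proof -
  have "finite U" using assms(3) finite_ends finite_subset by blast
  then show ?thesis using assms(3)
  proof (induction U)
    case empty
    then show ?case by (intro exI[of _ "{}"]) auto
  next
    case (insert u U)
    then obtain J where J: "J \<subseteq> E"
      "\<And>Z. odd (card (cut Z \<inter> J)) \<longleftrightarrow> odd (card (U \<inter> Z)) \<noteq> (odd (card U) \<and> x0 \<in> Z)" by auto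
    obtain P where P: "P \<subseteq> {e \<in> E. t e \<in> UNIV \<and> h e \<in> UNIV}" "joins P u x0"
      using conn_joins[OF assms(1), of u x0] insert.prems assms(2) by blast
    have fin: "finite J" "finite P" using J(1) P(1) finite_E by (auto intro: finite_subset)
    have "odd (card (cut Z \<inter> (J - P \<union> (P - J)))) \<longleftrightarrow>
        odd (card (insert u U \<inter> Z)) \<noteq> (odd (card (insert u U)) \<and> x0 \<in> Z)" for Z
    proof -
      have "card (insert u U \<inter> Z) = (if u \<in> Z then Suc (card (U \<inter> Z)) else card (U \<inter> Z))"
        using insert.hyps by simp
      then show ?thesis
        using odd_card_sym_diff[OF fin, of "cut Z"] J(2)[of Z] P(2)[unfolded joins_def, rule_format, of Z]
          insert.hyps by auto
    qed
    then show ?case using J(1) P(1) by (intro exI[of _ "J - P \<union> (P - J)"]) auto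
  qed
qed

end

section \<open>The two shapes of a minimal even arc system\<close>

context minimal_even
begin

lemma no_loop: "e \<in> E \<Longrightarrow> t e \<noteq> h e"
  using no_transitive_arc[of e] by (auto simp: transitive_arc_def leave_def)

lemma no_parallel:
  assumes "e \<in> E" "f \<in> E" "t e = t f" "h e = h f"
  shows "e = f"
proof (rule ccontr)
  assume "e \<noteq> f"
  then have "transitive_arc e" using assms by (auto simp: transitive_arc_def leave_def)
  then show False using no_transitive_arc by blast
qed

lemma no_shortcut:
  assumes "e \<in> E" "f \<in> E" "g \<in> E" "t f = t e" "h f = t g" "h g = h e"
  shows False
proof -
  have ne: "f \<noteq> e" "g \<noteq> e" using assms no_loop[of f] no_loop[of g] by auto
  have "\<exists>f\<in>leave X. f \<noteq> e" if "e \<in> leave X" for X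
  proof (cases "h f \<in> X")
    case True
    then have "g \<in> leave X" using that assms by (simp add: leave_def)
    then show ?thesis using ne by blast
  next
    case False
    then have "f \<in> leave X" using that assms by (simp add: leave_def)
    then show ?thesis using ne by blast
  qed
  then show False using no_transitive_arc[of e] assms(1) by (simp add: transitive_arc_def)
qed

lemma iso_theta:
  assumes "dibond Y" "e1 \<in> inside Y" "e2 \<in> inside (- Y)"
  obtains n where "n \<ge> 2" "odd n" "om_iso bmat (bond_matroid (complete_bipartite_dir 2 n))"
proof -
  obtain I where cp: "crossing_pair E t h I Y"
    and odd: "odd (card (ends \<inter> I \<inter> Y) + card (ends - I - Y))"
    using nontrivial_dibond[OF assms] .
  interpret crossing_pair E t h I Y by (rule cp)
  interpret S: crossing_pair E t h Y I by (rule swap)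
  obtain p q where p: "ends \<inter> I - Y = {p}" and q: "ends \<inter> Y - I = {q}" using P_Q_unique[OF odd] .
  have pq: "p \<in> ends" "p \<in> I" "p \<notin> Y" "q \<in> ends" "q \<in> Y" "q \<notin> I" using p q by blast+
  define A B where "A = ends \<inter> I \<inter> Y" and "B = ends - I - Y"
  have fin: "finite A" "finite B" using finite_ends by (auto simp: A_def B_def)
  have disj: "A \<inter> B = {}" by (auto simp: A_def B_def)
  have card: "card (A \<union> B) = card A + card B" using fin disj by (rule card_Un_disjoint)
  have odd': "odd (card (A \<union> B))" using odd unfolding card by (simp add: A_def B_def)
  have "A \<noteq> {}" "B \<noteq> {}" using A_ne B_ne by (auto simp: A_def B_def)
  then have "card A > 0" "card B > 0" using fin by (auto simp: card_gt_0_iff)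
  then have two: "card (A \<union> B) \<ge> 2" using card by linarith
  have "\<exists>e. e \<in> E \<and> t e = (if l \<in> I then p else l) \<and> h e = (if l \<in> I then l else q)" if "l \<in> A \<union> B" for l
    using that complete_to_A[OF pq(1-3), of l] S.complete_to_B[OF pq(4-6), of l]
    by (auto simp: A_def B_def)
  then obtain a0 where a0: "\<And>l. l \<in> A \<union> B \<Longrightarrow>
      a0 l \<in> E \<and> t (a0 l) = (if l \<in> I then p else l) \<and> h (a0 l) = (if l \<in> I then l else q)" by metis
  have "\<exists>e. e \<in> E \<and> t e = (if l \<in> I then q else l) \<and> h e = (if l \<in> I then l else p)" if "l \<in> A \<union> B" for l
    using that S.complete_to_A[OF pq(4-6), of l] complete_to_B[OF pq(1-3), of l]
    by (auto simp: A_def B_def)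
  then obtain a1 where a1: "\<And>l. l \<in> A \<union> B \<Longrightarrow>
      a1 l \<in> E \<and> t (a1 l) = (if l \<in> I then q else l) \<and> h (a1 l) = (if l \<in> I then l else p)" by metis
  have E_eq: "E = a0 ` (A \<union> B) \<union> a1 ` (A \<union> B)"
  proof (intro equalityI subsetI)
    fix e assume e: "e \<in> E"
    have ends: "t e \<in> ends" "h e \<in> ends" using arc_ends e by blast+
    have cls: "v \<in> A \<or> v \<in> B \<or> v = p \<or> v = q" if "v \<in> ends" for v
      using that p q unfolding A_def B_def by blast
    have tA: "t e \<notin> A" using sink e by (auto simp: A_def)
    have hB: "h e \<notin> B" using source e by (auto simp: B_def)
    have mid: "t e \<in> B \<or> h e \<in> A"
      using cls[OF ends(1)] cls[OF ends(2)] tA hB arc_cases[OF e] up[OF e] pq by auto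
    \<comment> \<open>Completeness provides the path from \<open>t e\<close> over \<open>p\<close>
      to \<open>h e\<close>, so the arc would be transitive.\<close>
    have notBA: "\<not> (t e \<in> B \<and> h e \<in> A)"
    proof
      assume "t e \<in> B \<and> h e \<in> A"
      then have "a1 (t e) \<in> E" "t (a1 (t e)) = t e" "h (a1 (t e)) = p"
        "a0 (h e) \<in> E" "t (a0 (h e)) = p" "h (a0 (h e)) = h e"
        using a1[of "t e"] a0[of "h e"] by (auto simp: A_def B_def)
      then show False using no_shortcut[of e "a1 (t e)" "a0 (h e)"] e by simp
    qed
    consider "t e = p" "h e \<in> A" | "t e = q" "h e \<in> A" | "t e \<in> B" "h e = p" | "t e \<in> B" "h e = q"
      using mid notBA cls[OF ends(1)] cls[OF ends(2)] tA hB by blast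
    then have "e = a0 (h e) \<and> h e \<in> A \<or> e = a1 (h e) \<and> h e \<in> A \<or>
        e = a1 (t e) \<and> t e \<in> B \<or> e = a0 (t e) \<and> t e \<in> B"
    proof cases
      case 1
      have "a0 (h e) = e" by (rule no_parallel) (use 1 a0[of "h e"] e in \<open>auto simp: A_def\<close>)
      then show ?thesis using 1 by simp
    next
      case 2
      have "a1 (h e) = e" by (rule no_parallel) (use 2 a1[of "h e"] e in \<open>auto simp: A_def\<close>)
      then show ?thesis using 2 by simp
    next
      case 3
      have "a1 (t e) = e" by (rule no_parallel) (use 3 a1[of "t e"] e in \<open>auto simp: B_def\<close>)
      then show ?thesis using 3 by simp
    next
      case 4
      have "a0 (t e) = e" by (rule no_parallel) (use 4 a0[of "t e"] e in \<open>auto simp: B_def\<close>)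
      then show ?thesis using 4 by simp
    qed
    then show "e \<in> a0 ` (A \<union> B) \<union> a1 ` (A \<union> B)" by blast
  qed (use a0 a1 in blast)
  have th: "theta E t h p q (A \<union> B) (\<lambda>l. l \<in> I) a0 a1"
  proof
    show "E = a0 ` (A \<union> B) \<union> a1 ` (A \<union> B)" by (rule E_eq)
    show "p \<noteq> q" "p \<notin> A \<union> B" "q \<notin> A \<union> B" using pq by (auto simp: A_def B_def)
    show "\<exists>l\<in>A \<union> B. \<exists>l'\<in>A \<union> B. l \<noteq> l'" 
    proof -
      obtain a b where "a \<in> A" "b \<in> B" using \<open>A \<noteq> {}\<close> \<open>B \<noteq> {}\<close> by blast
      then show ?thesis using disj by (intro bexI[of _ a] bexI[of _ b]) auto
    qed
  qed (use a0 a1 in simp_all)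
  let ?n = "card (A \<union> B)"
  have "finite (A \<union> B)" using fin by simp
  then obtain \<pi> where "bij_betw \<pi> (A \<union> B) {..<?n}"
    using ex_bij_betw_finite_nat by (metis atLeast0LessThan)
  then have "bij_betw (Inr \<circ> \<pi>) (A \<union> B) (Inr ` {..<?n} :: (nat + nat) set)"
    by (rule bij_betw_trans) (simp add: bij_betw_def)
  from theta_iso[OF th theta_complete_bipartite[OF two] this]
  have "om_iso bmat (bond_matroid (complete_bipartite_dir 2 ?n))"
    unfolding bond_matroid_complete_bipartite .
  then show thesis using that two odd' by blast
qed

lemma iso_complete_bipartite:
  assumes triv: "\<And>Y. dibond Y \<Longrightarrow> inside Y = {} \<or> inside (- Y) = {}"
  obtains m n where "m \<ge> 2" "n \<ge> 2" "odd (m + n)" "om_iso bmat (bond_matroid (complete_bipartite_dir m n))"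
proof -
  have star: "\<exists>v\<in>ends. cut Y = cut {v}" if Y: "dibond Y" for Y
  proof -
    have *: "\<exists>v\<in>ends. cut X = cut {v}" if X: "conn X" "inside X = {}" "cut X \<noteq> {}" for X
    proof -
      obtain e where "e \<in> cut X" using X(3) by blast
      then obtain v where v: "v \<in> X \<inter> ends" using arc_ends by (auto simp: cut_def)
      then have "X \<inter> ends = {v}" using conn_no_arcs[OF X(1) _ v] X(2) by (auto simp: inside_def)
      then have "cut X = cut {v}" using v by (intro cut_cong) auto
      then show ?thesis using v by blast
    qed
    have "cut Y \<noteq> {}" using Y by (auto simp: dibond_def is_bond_def)
    then show ?thesis using triv[OF Y] *[of Y] *[of "- Y"] dibond_conn[OF Y] by auto
  qed
  define W where "W = {v \<in> ends. \<exists>Y. dibond Y \<and> cut Y = cut {v}}"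
  have Wends: "W \<subseteq> ends" by (auto simp: W_def)
  have finW: "finite W" using Wends finite_ends finite_subset by blast
  \<comment> \<open>A \<open>U\<close>-join would be odd on the star of each vertex of
    \<open>U\<close>, hence on every dibond. With \<open>U\<close> chosen as \<open>W\<close>, and
    as \<open>W\<close> with one more vertex, this shows that \<open>W\<close> is odd and equals
    \<open>ends\<close>.\<close>
  have no: False if U: "W \<subseteq> U" "U \<subseteq> ends" "even (card U)" for U
  proof -
    have "ends \<noteq> {}"
    proof
      assume "ends = {}"
      then have "E = {}" by (auto simp: ends_def)
      then have "cut X = {}" for X using cut_subset by blast
      then have has_odd_join by (auto simp: has_odd_join_def dibond_def is_bond_def)
      then show False using no_odd_join by blast
    qed
    then obtain x0 where "x0 \<in> ends" by blast
    from vertex_join[OF connected this U(2)] obtain J where J: "J \<subseteq> E"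
      "\<And>Z. odd (card (cut Z \<inter> J)) \<longleftrightarrow> odd (card (U \<inter> Z))" using U(3) by auto
    have "odd (card (cut Y \<inter> J))" if Y: "dibond Y" for Y
    proof -
      obtain v where v: "v \<in> ends" "cut Y = cut {v}" using star[OF Y] by blast
      then have "v \<in> U" using Y U(1) by (auto simp: W_def)
      then show ?thesis using J(2)[of "{v}"] v by simp
    qed
    then show False using no_odd_join J(1) unfolding has_odd_join_def by blast
  qed
  have oddW: "odd (card W)" using no[OF subset_refl Wends] by blast
  have W_all: "W = ends"
  proof (rule ccontr)
    assume "W \<noteq> ends"
    then obtain v where "v \<in> ends" "v \<notin> W" using Wends by blast
    then show False using no[of "insert v W"] Wends finW oddW by auto
  qed
  have bond_v: "is_bond {v}" if v: "v \<in> ends" for v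
  proof -
    have "v \<in> W" using v W_all by simp
    then obtain Y where "is_bond Y" "cut Y = cut {v}" by (auto simp: W_def dibond_def)
    then show ?thesis by (simp add: is_bond_def)
  qed
  have pure: "(\<forall>e\<in>E. t e \<noteq> v) \<or> (\<forall>e\<in>E. h e \<noteq> v)" if v: "v \<in> ends" for v
  proof (rule ccontr)
    assume "\<not> ?thesis"
    then obtain e f where e: "e \<in> E" "t e = v" and f: "f \<in> E" "h f = v" by blast
    have "v \<in> W" using v W_all by simp
    then obtain Y where Y: "dibond Y" "cut Y = cut {v}" by (auto simp: W_def)
    have up: "upset Y" using Y(1) by (simp add: dibond_def)
    have "e \<in> cut Y" "f \<in> cut Y" using e f no_loop[of e] no_loop[of f] Y(2) by (auto simp: cut_def)
    then show False using up e f by (auto simp: cut_def upset_def)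
  qed
  define S T where "S = t ` E" and "T = h ` E"
  have ST: "S \<inter> T = {}" "ends = S \<union> T"
  proof -
    show "ends = S \<union> T" by (simp add: S_def T_def ends_def)
    show "S \<inter> T = {}"
    proof (rule ccontr)
      assume "S \<inter> T \<noteq> {}"
      then obtain e f where "e \<in> E" "f \<in> E" "t e = h f" by (auto simp: S_def T_def)
      then show False using pure[of "t e"] arc_ends(1)[of e] by auto
    qed
  qed
  have tS: "t e \<in> S" "t e \<notin> T" and hT: "h e \<in> T" "h e \<notin> S" if "e \<in> E" for e
    using that ST(1) by (auto simp: S_def T_def)
  have complete: "\<exists>e\<in>E. t e = s \<and> h e = v" if s: "s \<in> S" and v: "v \<in> T" for s v
  proof -
    define N where "N = {h e | e. e \<in> E \<and> t e = s}"
    have NT: "N \<subseteq> T" using hT by (auto simp: N_def)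
    define I where "I = insert s N"
    have sT: "s \<notin> T" using s ST(1) by blast
    have upI: "upset I" unfolding upset_def I_def using tS(2) NT by (auto simp: N_def)
    \<comment> \<open>If another source \<open>t g\<close> shares an out-neighbour with
      \<open>s\<close>, some dibond inside \<open>cut I\<close> contains \<open>g\<close> and is a
      star. It is not the star of \<open>h g\<close>, which has an arc from \<open>s\<close>; so it
      is the star of \<open>t g\<close>, and all arcs from \<open>t g\<close> enter
      \<open>I\<close>.\<close>
    have all_in: "h e \<in> I" if e: "e \<in> E" and g: "g \<in> E" "h g \<in> N" "t e = t g" for e g
    proof (cases "t g \<in> I")
      case True
      then show ?thesis using upI e g(3) by (auto simp: upset_def)
    next
      case False
      then have gI: "g \<in> cut I" using g by (auto simp: cut_def I_def)
      obtain X where X: "is_bond X" "g \<in> cut X" "leave X \<subseteq> leave I" "leave (- X) \<subseteq> leave (- I)"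
        using bond_refines_cut'[OF gI] .
      have XI: "cut X \<subseteq> cut I" using X(3,4) by (rule finer_leave_imp_cut)
      have "dibond X" using X(1,3) upI unfolding dibond_def upset_iff_leave by blast
      then obtain w where w: "cut X = cut {w}" using star by blast
      have "w = t g \<or> w = h g" using X(2) w by (auto simp: cut_def)
      moreover have "w \<noteq> h g"
      proof
        assume wg: "w = h g"
        obtain f where f: "f \<in> E" "t f = s" "h f = h g" using g(2) by (auto simp: N_def)
        then have "f \<in> cut X" using w wg no_loop[of f] by (auto simp: cut_def)
        moreover have "f \<notin> cut I" using f g(2) by (simp add: cut_def I_def)
        ultimately show False using XI by blast
      qed
      ultimately have "e \<in> cut X" using w e g(3) no_loop[of e] by (auto simp: cut_def)
      then have "e \<in> cut I" using XI by blast
      then show ?thesis using upI by (auto simp: cut_def upset_def)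
    qed
    \<comment> \<open>\<open>Z\<close> is closed under adjacency and so contains every vertex; its
      only members that are heads are those of \<open>N\<close>.\<close>
    define Z where "Z = I \<union> {t e | e. e \<in> E \<and> h e \<in> N}"
    have "UNIV \<inter> ends \<subseteq> Z \<or> UNIV \<inter> ends \<inter> Z = {}"
    proof (rule conn_cases[OF connected])
      fix e assume e: "e \<in> E"
      show "t e \<in> Z \<longleftrightarrow> h e \<in> Z"
      proof
        assume "t e \<in> Z"
        then have "h e \<in> I" using upI e all_in[OF e] by (auto simp: Z_def upset_def)
        then show "h e \<in> Z" by (simp add: Z_def)
      next
        assume "h e \<in> Z"
        then have "h e \<in> N" using hT[OF e] s tS(1) by (auto simp: Z_def I_def)
        then show "t e \<in> Z" using e by (auto simp: Z_def)
      qed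
    qed
    moreover have "s \<in> ends" "s \<in> Z" using s ST(2) by (auto simp: Z_def I_def)
    moreover have "v \<in> ends" using v ST(2) by blast
    ultimately have "v \<in> Z" by blast
    then have "v \<in> N" using v sT tS(2) by (auto simp: Z_def I_def)
    then show ?thesis by (auto simp: N_def)
  qed
  have fin: "finite S" "finite T" using finite_E by (auto simp: S_def T_def)
  have odd: "odd (card S + card T)"
    using oddW unfolding W_all ST(2) card_Un_disjoint[OF fin ST(1)] .
  have E_ne: "S \<noteq> {}" "T \<noteq> {}"
  proof -
    have "E \<noteq> {}" using odd by (auto simp: S_def T_def)
    then show "S \<noteq> {}" "T \<noteq> {}" by (auto simp: S_def T_def)
  qed
  \<comment> \<open>A one-vertex side makes its star all of \<open>E\<close>. As stars are bonds,
    those on the other side coincide with it, which leaves a single vertex there and the even total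
    2.\<close>
  have small: "card T' = 1" if one: "card S' = 1" and sides: "(S', T') = (S, T) \<or> (S', T') = (T, S)" for S' T'
  proof -
    obtain s where s: "S' = {s}" using one card_1_singletonE by blast
    have sE: "s \<in> ends" using s sides ST(2) by auto
    have "cut {s} = E" using s sides tS hT by (auto simp: cut_def)
    moreover have "cut {v} = cut {s}" if v: "v \<in> T'" for v
    proof -
      have "v \<in> ends" using v sides ST(2) by auto
      then have "cut {v} \<noteq> {}" using bond_v by (simp add: is_bond_def)
      moreover have "cut {v} \<subseteq> cut {s}" using \<open>cut {s} = E\<close> cut_subset by blast
      ultimately show ?thesis using bond_v[OF sE] by (simp add: is_bond_def)
    qed
    moreover obtain v where v: "v \<in> T'" using E_ne sides by auto
    ultimately have cutv: "cut {v} = E" by blast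
    have "w = v" if w: "w \<in> T'" for w
    proof -
      obtain e where e: "e \<in> E" "w = t e \<or> w = h e" using w sides by (auto simp: S_def T_def)
      then have "e \<in> cut {v}" using cutv by simp
      then show ?thesis using e(2) w v sides tS[OF e(1)] hT[OF e(1)] by (auto simp: cut_def)
    qed
    then have "T' = {v}" using v by blast
    then show ?thesis by simp
  qed
  have pos: "card S > 0" "card T > 0" using E_ne fin by (auto simp: card_gt_0_iff)
  have "card S \<noteq> 1" using small[of S T] odd by fastforce
  moreover have "card T \<noteq> 1" using small[of T S] odd by fastforce
  ultimately have two: "card S \<ge> 2" "card T \<ge> 2" using pos by linarith+
  obtain \<sigma> \<tau> where \<sigma>: "bij_betw \<sigma> S {..<card S}" and \<tau>: "bij_betw \<tau> T {..<card T}"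
    using ex_bij_betw_finite_nat fin by (metis atLeast0LessThan)
  define f where "f e = (\<sigma> (t e), \<tau> (h e))" for e
  define p :: "_ \<Rightarrow> nat + nat" where "p v = (if v \<in> S then Inl (\<sigma> v) else Inr (\<tau> v))" for v
  have "bij_betw f E ({..<card S} \<times> {..<card T})"
  proof (rule bij_betwI')
    fix x y assume xy: "x \<in> E" "y \<in> E"
    show "f x = f y \<longleftrightarrow> x = y"
    proof
      assume "f x = f y"
      then have "t x = t y" "h x = h y"
        using \<sigma> \<tau> tS(1) hT(1) xy unfolding f_def bij_betw_def inj_on_def by auto
      then show "x = y" using no_parallel[OF xy] by blast
    qed simp
  next
    fix x assume "x \<in> E"
    then show "f x \<in> {..<card S} \<times> {..<card T}"
      using \<sigma> \<tau> tS(1) hT(1) unfolding f_def bij_betw_def by blast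
  next
    fix y assume "y \<in> {..<card S} \<times> {..<card T}"
    then have "fst y \<in> \<sigma> ` S" "snd y \<in> \<tau> ` T" using \<sigma> \<tau> by (auto simp: bij_betw_def)
    then obtain s v where sv: "s \<in> S" "v \<in> T" "fst y = \<sigma> s" "snd y = \<tau> v" by blast
    obtain e where "e \<in> E" "t e = s" "h e = v" using complete[OF sv(1,2)] by blast
    then show "\<exists>x\<in>E. y = f x" using sv by (intro bexI[of _ e]) (auto simp: f_def prod_eq_iff)
  qed
  moreover have "inj_on p ends"
    unfolding ST(2) p_def using \<sigma> \<tau> ST(1) by (auto simp: inj_on_def bij_betw_def)
  moreover have "Inl (fst (f e)) = p (t e) \<and> Inr (snd (f e)) = p (h e)" if "e \<in> E" for e
    using tS[OF that] hT[OF that] by (simp add: f_def p_def)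
  ultimately have "om_iso bmat (arc_system.bmat ({..<card S} \<times> {..<card T}) (\<lambda>e. Inl (fst e)) (\<lambda>e. Inr (snd e)))"
    by (rule bmat_iso)
  then have "om_iso bmat (bond_matroid (complete_bipartite_dir (card S) (card T)))"
    unfolding bond_matroid_complete_bipartite .
  then show thesis using that two odd by blast
qed

lemma iso_forbidden:
  "\<exists>m n. m \<ge> 2 \<and> n \<ge> 2 \<and> odd (m + n) \<and> om_iso bmat (bond_matroid (complete_bipartite_dir m n))"
proof (cases "\<forall>Y. dibond Y \<longrightarrow> inside Y = {} \<or> inside (- Y) = {}")
  case True
  then show ?thesis using iso_complete_bipartite by metis
next
  case False
  then obtain Y e1 e2 where "dibond Y" "e1 \<in> inside Y" "e2 \<in> inside (- Y)" by blast
  then obtain n where "n \<ge> 2" "odd n" "om_iso bmat (bond_matroid (complete_bipartite_dir 2 n))"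
    using iso_theta by blast
  then show ?thesis by (intro exI[of _ 2] exI[of _ n]) auto
qed

end

section \<open>Reduction to the minimal case\<close>

context fin_arc_system
begin

text \<open>Gluing two components at a vertex does not change the bonds and their signs.\<close>

lemma bmat_identify:
  assumes Z: "\<And>e. e \<in> E \<Longrightarrow> t e \<in> Z \<longleftrightarrow> h e \<in> Z" and u: "u \<in> Z" and v: "v \<notin> Z"
  defines "\<pi> \<equiv> \<lambda>w. if w = v then u else w"
  shows "arc_system.bmat E (\<pi> \<circ> t) (\<pi> \<circ> h) = bmat"
proof -
  interpret G: arc_system E "\<pi> \<circ> t" "\<pi> \<circ> h" .
  have leave: "G.leave X = leave (\<pi> -` X)" for X by (auto simp: G.leave_def leave_def)
  have cut: "G.cut X = cut (\<pi> -` X)" for X by (auto simp: G.cut_def cut_def)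
  have fixed: "\<pi> -` X = X" if "(u \<in> X) = (v \<in> X)" for X
    using that by (auto simp: \<pi>_def split: if_splits)
  have every: "\<exists>X'. cut (\<pi> -` X') = cut X" for X
  proof (cases "(u \<in> X) = (v \<in> X)")
    case True
    then show ?thesis using fixed by metis
  next
    case False
    \<comment> \<open>Complementing \<open>X\<close> on the union \<open>Z\<close> of components
      keeps the cut and no longer separates \<open>u\<close> from \<open>v\<close>.\<close>
    have "cut Z = {}" using Z by (auto simp: cut_def)
    then have "cut (X - Z \<union> (Z - X)) = cut X" unfolding cut_sym_diff by blast
    moreover have "\<pi> -` (X - Z \<union> (Z - X)) = X - Z \<union> (Z - X)" using False u v by (intro fixed) auto
    ultimately show ?thesis by metis
  qed
  have bond: "G.is_bond X \<longleftrightarrow> is_bond (\<pi> -` X)" for X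
  proof -
    have "(\<forall>W. Q (cut (\<pi> -` W))) \<longleftrightarrow> (\<forall>W. Q (cut W))" for Q using every by metis
    from this[of "\<lambda>C. C \<subseteq> cut (\<pi> -` X) \<and> C \<noteq> {} \<longrightarrow> C = cut (\<pi> -` X)"]
    show ?thesis unfolding G.is_bond_def is_bond_def cut by simp
  qed
  have signed: "\<exists>X'. \<pi> -` X' = X' \<and> leave X' = leave X \<and> leave (- X') = leave (- X)" if X: "is_bond X" for X
  proof -
    have ZX: "cut (X \<inter> Z) \<subseteq> cut X" using Z by (auto simp: cut_def)
    \<comment> \<open>Complementing on \<open>Z\<close> would reverse signs there. A bond has all
      its arcs on one side of \<open>Z\<close>, so membership can instead be made constant on the
      other side, chosen such that \<open>u\<close> and \<open>v\<close> agree.\<close>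
    define X' where "X' = (if cut (X \<inter> Z) = {} then X - Z \<union> (if v \<in> X then Z else {})
      else X \<inter> Z \<union> (if u \<in> X then - Z else {}))"
    have "(u \<in> X') = (v \<in> X')" using u v by (auto simp: X'_def)
    then have "\<pi> -` X' = X'" by (rule fixed)
    moreover have "leave X' = leave X \<and> leave (- X') = leave (- X)"
    proof (cases "cut (X \<inter> Z) = {}")
      case True
      then have none: "t e \<in> X \<longleftrightarrow> h e \<in> X" if "e \<in> E" "t e \<in> Z" for e
        using that Z by (auto simp: cut_def)
      have "e \<in> leave X' \<longleftrightarrow> e \<in> leave X" "e \<in> leave (- X') \<longleftrightarrow> e \<in> leave (- X)" for e
        using none[of e] Z[of e] True by (auto simp: leave_def X'_def)
      then show ?thesis by blast
    next
      case False
      then have "cut (X \<inter> Z) = cut X" using X ZX by (simp add: is_bond_def)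
      then have none: "t e \<in> X \<longleftrightarrow> h e \<in> X" if "e \<in> E" "t e \<notin> Z" for e
        using that Z[of e] by (auto simp: cut_def)
      have "e \<in> leave X' \<longleftrightarrow> e \<in> leave X" "e \<in> leave (- X') \<longleftrightarrow> e \<in> leave (- X)" for e
        using none[of e] Z[of e] False by (auto simp: leave_def X'_def)
      then show ?thesis by blast
    qed
    ultimately show ?thesis by blast
  qed
  have "signed_circuits G.bmat = signed_circuits bmat"
  proof (intro equalityI subsetI)
    fix C assume "C \<in> signed_circuits G.bmat"
    then obtain X where "C = (leave (\<pi> -` X), leave (- (\<pi> -` X)))" "is_bond (\<pi> -` X)"
      unfolding G.signed_circuits_bmat leave bond vimage_Compl by blast
    then show "C \<in> signed_circuits bmat" unfolding signed_circuits_bmat by blast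
  next
    fix C assume "C \<in> signed_circuits bmat"
    then obtain X where X: "C = (leave X, leave (- X))" "is_bond X" unfolding signed_circuits_bmat by blast
    obtain X' where X': "\<pi> -` X' = X'" "leave X' = leave X" "leave (- X') = leave (- X)"
      using signed[OF X(2)] by blast
    have "C = (G.leave X', G.leave (- X'))" unfolding leave vimage_Compl X'(1) unfolding X'(2,3) X(1) ..
    moreover have cutX': "cut X' = cut X" unfolding cut_eq_leave X'(2,3) ..
    have "G.is_bond X'" using X(2) unfolding bond X'(1) is_bond_def cutX' .
    ultimately show "C \<in> signed_circuits G.bmat" unfolding G.signed_circuits_bmat by blast
  qed
  then show ?thesis by (simp add: G.bmat_def bmat_def)
qed

end

text \<open>The measure counts vertices besides arcs because gluing two components at a vertex keeps
  the matroid and all arcs. Connectedness is thus reached without a minor step.\<close>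

lemma even_has_forbidden_minor:
  fixes t h :: "'a \<Rightarrow> 'v"
  assumes "finite E" "\<not> arc_system.has_odd_join E t h"
  shows "\<exists>N m n. gb_minor (arc_system.bmat E t h) N \<and> m \<ge> 2 \<and> n \<ge> 2 \<and> odd (m + n) \<and>
    om_iso N (bond_matroid (complete_bipartite_dir m n))"
  using assms
proof (induction "card E + card (arc_system.ends E t h)" arbitrary: E t h rule: less_induct)
  case (less E t h)
  interpret fin_arc_system E t h by unfold_locales (rule less.prems)
  have step: ?case
    if smaller: "card E' + card (arc_system.ends E' t' h') < card E + card ends" and fin: "finite E'"
      and even: "\<not> arc_system.has_odd_join E' t' h'" and minor: "gb_minor bmat (arc_system.bmat E' t' h')"
    for E' and t' h' :: "'a \<Rightarrow> 'v"
    using less.hyps[OF smaller fin even] gb_minor_trans[OF minor] by blast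
  have card_E: "card (E - {e}) < card E" if "e \<in> E" for e
    using that finite_E by (rule card_Diff1_less[rotated])
  consider e where "transitive_arc e"
    | e where "e \<in> E" "\<not> arc_system.has_odd_join (E - {e}) (merge e \<circ> t) (merge e \<circ> h)"
    | "\<not> conn UNIV"
    | "\<And>e. \<not> transitive_arc e" "conn UNIV"
      "\<And>e. e \<in> E \<Longrightarrow> arc_system.has_odd_join (E - {e}) (merge e \<circ> t) (merge e \<circ> h)"
    by blast
  then show ?case
  proof cases
    case (1 e)
    have e: "e \<in> E" using 1 by (simp add: transitive_arc_def)
    have "arc_system.ends (E - {e}) t h \<subseteq> ends" by (auto simp: arc_system.ends_def)
    then have "card (arc_system.ends (E - {e}) t h) \<le> card ends" using finite_ends by (intro card_mono)
    then have "card (E - {e}) + card (arc_system.ends (E - {e}) t h) < card E + card ends"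
      using card_E[OF e] by linarith
    moreover have "\<not> arc_system.has_odd_join (E - {e}) t h"
      using less.prems(2) has_odd_join_remove[OF 1] by blast
    moreover have "gb_minor bmat (arc_system.bmat (E - {e}) t h)"
      using gb_minor_contract[OF gb_minor_refl, of bmat e] 1 butterfly_contractible_bmat om_contract_bmat by metis
    ultimately show ?thesis using step finite_E by blast
  next
    case (2 e)
    have "arc_system.ends (E - {e}) (merge e \<circ> t) (merge e \<circ> h) \<subseteq> ends"
      using 2(1) by (auto simp: arc_system.ends_def merge_def)
    then have "card (arc_system.ends (E - {e}) (merge e \<circ> t) (merge e \<circ> h)) \<le> card ends"
      using finite_ends by (intro card_mono)
    then have "card (E - {e}) + card (arc_system.ends (E - {e}) (merge e \<circ> t) (merge e \<circ> h)) < card E + card ends"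
      using card_E[OF 2(1)] by linarith
    moreover have "gb_minor bmat (arc_system.bmat (E - {e}) (merge e \<circ> t) (merge e \<circ> h))"
      using gb_minor_delete[OF gb_minor_refl, of e bmat] 2(1) om_delete_bmat[OF 2(1)] by simp
    ultimately show ?thesis using step 2(2) finite_E by blast
  next
    case 3
    then obtain Z u v where Z: "\<And>e. e \<in> E \<Longrightarrow> t e \<in> Z \<longleftrightarrow> h e \<in> Z"
      and u: "u \<in> ends" "u \<in> Z" and v: "v \<in> ends" "v \<notin> Z"
      unfolding conn_def by auto
    define \<pi> where "\<pi> w = (if w = v then u else w)" for w
    interpret G: fin_arc_system E "\<pi> \<circ> t" "\<pi> \<circ> h" by unfold_locales (rule finite_E)
    have eq: "G.bmat = bmat"
      using bmat_identify[OF Z u(2) v(2)] unfolding \<pi>_def[abs_def] by simp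
    then have "\<not> G.has_odd_join" using less.prems(2) G.has_odd_join_iff has_odd_join_iff by simp
    moreover have "G.ends \<subseteq> ends - {v}" using u v by (auto simp: G.ends_def ends_def \<pi>_def)
    then have "card G.ends < card ends"
      using v(1) finite_ends by (meson card_Diff1_less card_mono finite_Diff order_le_less_trans)
    ultimately show ?thesis using step[of E "\<pi> \<circ> t" "\<pi> \<circ> h"] finite_E eq gb_minor_refl by auto
  next
    case 4
    have "minimal_even E t h"
      by unfold_locales (use less.prems 4 has_odd_join_merge_iff in blast)+
    from minimal_even.iso_forbidden[OF this] show ?thesis using gb_minor_refl by blast
  qed
qed

lemma complete_bipartite_no_odd_join:
  assumes "m \<ge> 2" "n \<ge> 2" "odd (m + n)"
  shows "\<not> arc_system.has_odd_join ({..<m} \<times> {..<n}) (\<lambda>e. Inl (fst e) :: nat + nat) (\<lambda>e. Inr (snd e))"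
proof
  let ?E = "{..<m} \<times> {..<n}"
  let ?t = "\<lambda>e. Inl (fst e) :: nat + nat" and ?h = "\<lambda>e. Inr (snd e) :: nat + nat"
  interpret fin_arc_system ?E ?t ?h by unfold_locales simp
  assume has_odd_join
  then obtain J where J: "J \<subseteq> ?E" "\<And>X. dibond X \<Longrightarrow> odd (card (cut X \<inter> J))" unfolding has_odd_join_def by blast
  have finJ: "finite J" using J(1) finite_E finite_subset by blast
  have ends: "ends \<subseteq> Inl ` {..<m} \<union> Inr ` {..<n}" by (auto simp: ends_def)
  have connI: "conn X" if i: "i < m" "Inl i \<in> X" and j: "j < n" "Inr j \<in> X" for X i j
  proof -
    have star: "conn (insert (Inl i) (X \<inter> range Inr))"
    proof (rule conn_attach[OF conn_singleton[of "Inl i"]])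
      fix v assume "v \<in> insert (Inl i) (X \<inter> range Inr) \<inter> ends - {Inl i}"
      then obtain k where "v = Inr k" "k < n" using ends by blast
      then show "\<exists>e\<in>?E. ?t e = v \<and> ?h e \<in> {Inl i} \<or> ?h e = v \<and> ?t e \<in> {Inl i}"
        using i by (intro bexI[of _ "(i, k)"]) auto
    qed simp
    show ?thesis
    proof (rule conn_attach[OF star])
      show "insert (Inl i) (X \<inter> range Inr) \<subseteq> X" using i by blast
      fix v assume "v \<in> X \<inter> ends - insert (Inl i) (X \<inter> range Inr)"
      then obtain k where "v = Inl k" "k < m" using ends by blast
      then show "\<exists>e\<in>?E. ?t e = v \<and> ?h e \<in> insert (Inl i) (X \<inter> range Inr) \<or>
          ?h e = v \<and> ?t e \<in> insert (Inl i) (X \<inter> range Inr)"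
        using j by (intro bexI[of _ "(k, j)"]) auto
    qed
  qed
  have source: "odd (card (cut {Inl i} \<inter> J))" if i: "i < m" for i
  proof -
    have "dibond (- {Inl i})"
    proof (rule dibondI[of _ "(i, 0)"])
      \<comment> \<open>The witness is a source other than \<open>i\<close>, available because
        \<open>m \<ge> 2\<close>; it holds the sinks together.\<close>
      show "conn (- {Inl i})"
        by (rule connI[of "if i = 0 then 1 else 0" _ 0]) (use assms in auto)
      show "conn (- (- {Inl i}))" using conn_singleton by simp
    qed (use i assms in \<open>auto simp: upset_def\<close>)
    then show ?thesis using J(2)[of "- {Inl i}"] by simp
  qed
  have sink: "odd (card (cut {Inr j} \<inter> J))" if j: "j < n" for j
  proof -
    have "dibond {Inr j}"
    proof (rule dibondI[of _ "(0, j)"])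
      show "conn (- {Inr j})"
        by (rule connI[of 0 _ "if j = 0 then 1 else 0"]) (use assms in auto)
      show "conn {Inr j}" by (rule conn_singleton)
    qed (use j assms in \<open>auto simp: upset_def\<close>)
    then show ?thesis using J(2) by blast
  qed
  have "card J = (\<Sum>i<m. card (cut {Inl i} \<inter> J))"
  proof -
    have "J = (\<Union>i\<in>{..<m}. cut {Inl i} \<inter> J)" using J(1) by (auto simp: cut_def)
    then have "card J = card (\<Union>i\<in>{..<m}. cut {Inl i} \<inter> J)" by simp
    also have "\<dots> = (\<Sum>i<m. card (cut {Inl i} \<inter> J))"
      by (rule card_UN_disjoint) (auto simp: cut_def finJ)
    finally show ?thesis .
  qed
  moreover have "{i \<in> {..<m}. odd (card (cut {Inl i} \<inter> J))} = {..<m}" using source by auto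
  ultimately have "even (card J) \<longleftrightarrow> even m"
    using even_sum_iff[of "{..<m}" "\<lambda>i. card (cut {Inl i} \<inter> J)"] by simp
  moreover have "card J = (\<Sum>j<n. card (cut {Inr j} \<inter> J))"
  proof -
    have "J = (\<Union>j\<in>{..<n}. cut {Inr j} \<inter> J)" using J(1) by (auto simp: cut_def)
    then have "card J = card (\<Union>j\<in>{..<n}. cut {Inr j} \<inter> J)" by simp
    also have "\<dots> = (\<Sum>j<n. card (cut {Inr j} \<inter> J))"
      by (rule card_UN_disjoint) (auto simp: cut_def finJ)
    finally show ?thesis .
  qed
  moreover have "{j \<in> {..<n}. odd (card (cut {Inr j} \<inter> J))} = {..<n}" using sink by auto
  ultimately have "even (card J) \<longleftrightarrow> even m" "even (card J) \<longleftrightarrow> even n"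
    using even_sum_iff[of "{..<n}" "\<lambda>j. card (cut {Inr j} \<inter> J)"] by simp_all
  then show False using assms(3) by simp
qed

lemma om_iso_odd_join:
  assumes iso: "om_iso M N" and supp: "\<And>C. C \<in> signed_circuits M \<Longrightarrow> supp C \<subseteq> elements M"
    and J: "J \<subseteq> elements M" "\<And>C. directed_circuit M C \<Longrightarrow> odd (card (supp C \<inter> J))"
  shows "\<exists>J\<subseteq>elements N. \<forall>C. directed_circuit N C \<longrightarrow> odd (card (supp C \<inter> J))"
proof -
  obtain f where f: "bij_betw f (elements M) (elements N)"
    and circ: "signed_circuits N = (\<lambda>C. (f ` fst C, f ` snd C)) ` signed_circuits M"
    using iso unfolding om_iso_def by blast
  have "odd (card (supp C \<inter> f ` J))" if C: "directed_circuit N C" for C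
  proof -
    obtain D where D: "D \<in> signed_circuits M" "C = (f ` fst D, f ` snd D)"
      using C unfolding directed_circuit_def circ by blast
    then have "directed_circuit M D" using C unfolding directed_circuit_def by simp
    then have odd: "odd (card (supp D \<inter> J))" by (rule J(2))
    have inj: "inj_on f (elements M)" using f by (simp add: bij_betw_def)
    have "supp C \<inter> f ` J = f ` (supp D \<inter> J)"
      using inj_on_image_Int[OF inj supp[OF D(1)] J(1)] unfolding D(2) supp_def by (simp add: image_Un)
    moreover have "inj_on f (supp D \<inter> J)" using inj_on_subset[OF inj] J(1) by blast
    ultimately show ?thesis using odd by (simp add: card_image)
  qed
  moreover have "f ` J \<subseteq> elements N" using f J(1) by (auto simp: bij_betw_def)
  ultimately show ?thesis by blast
qed

text \<open>The digraph is pulled back along the isomorphism, so that \<open>M\<close> itself and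
  not merely a copy is some \<open>bmat\<close>, and its minors are computed on its own
  elements.\<close>

lemma oriented_bond_matroid_bmat:
  assumes "oriented_bond_matroid M"
  obtains t h :: "'a \<Rightarrow> nat" where "M = arc_system.bmat (elements M) t h" "finite (elements M)"
proof -
  interpret oriented_matroid M using assms by (simp add: oriented_bond_matroid_def)
  obtain D :: "(nat, nat) pre_digraph" where D: "fin_digraph D" "om_iso M (bond_matroid D)"
    using assms by (auto simp: oriented_bond_matroid_def)
  interpret D: fin_digraph D by fact
  have DM: "bond_matroid D = arc_system.bmat (arcs D) (tail D) (head D)"
    by (rule bond_matroid_eq_bmat) (rule D.wf_digraph)
  obtain f where f: "bij_betw f (elements M) (arcs D)"
    and circ: "signed_circuits (bond_matroid D) = (\<lambda>C. (f ` fst C, f ` snd C)) ` signed_circuits M"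
    using D(2) unfolding om_iso_def DM arc_system.elements_bmat by blast
  interpret G: fin_arc_system "elements M" "tail D \<circ> f" "head D \<circ> f" by unfold_locales (rule finite_elements)
  let ?F = "\<lambda>C. (f ` fst C, f ` snd C)"
  have "signed_circuits (bond_matroid D) = ?F ` signed_circuits G.bmat"
    unfolding DM by (rule signed_circuits_bmat_image[OF f, of id]) auto
  then have "?F ` signed_circuits M = ?F ` signed_circuits G.bmat" using circ by simp
  moreover have "inj_on ?F {C. supp C \<subseteq> elements M}"
  proof (rule inj_onI)
    fix C C' assume C: "C \<in> {C. supp C \<subseteq> elements M}" "C' \<in> {C. supp C \<subseteq> elements M}"
      and eq: "(f ` fst C, f ` snd C) = (f ` fst C', f ` snd C')"
    have "inj_on f (elements M)" using f by (simp add: bij_betw_def)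
    from inj_on_image_eq_iff[OF this] show "C = C'"
      using C eq by (auto simp: supp_def intro: prod_eqI)
  qed
  moreover have "signed_circuits M \<subseteq> {C. supp C \<subseteq> elements M}" using signed_circuit_subset by blast
  moreover have "signed_circuits G.bmat \<subseteq> {C. supp C \<subseteq> elements M}"
    unfolding G.signed_circuits_bmat using subsetD[OF G.cut_subset] by (auto simp: G.supp_leave)
  ultimately have "signed_circuits M = signed_circuits G.bmat" by (simp add: inj_on_image_eq_iff)
  then have "M = G.bmat" by (simp add: G.bmat_def)
  then show thesis using that finite_elements by blast
qed

section \<open>Regularity of bond matroids\<close>

lemma sign_mult: "(a :: real) \<in> {-1, 0, 1} \<Longrightarrow> b \<in> {-1, 0, 1} \<Longrightarrow> a * b \<in> {-1, 0, 1}"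
  by auto

text \<open>Shrinking each \<open>X j\<close> to a point makes this the incidence matrix of arcs
  from \<open>s i\<close> to \<open>u i\<close>. Either a row with at most one nonzero entry allows
  expansion, or every arc has both ends in the sets; then each row sums to zero and the all-ones
  vector lies in the kernel.\<close>

lemma det_difference_disjoint:
  fixes s u :: "nat \<Rightarrow> 'p" and X :: "nat \<Rightarrow> 'p set"
  assumes "\<And>i j. i < k \<Longrightarrow> j < k \<Longrightarrow> i \<noteq> j \<Longrightarrow> X i \<inter> X j = {}"
  shows "det (mat k k (\<lambda>(i, j). of_bool (u i \<in> X j) - of_bool (s i \<in> X j) :: real)) \<in> {-1, 0, 1}"
  using assms
proof (induction k arbitrary: s u X)
  case 0
  then show ?case by simp
next
  case (Suc k)
  let ?a = "\<lambda>i j. of_bool (u i \<in> X j) - of_bool (s i \<in> X j) :: real"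
  define A where "A = mat (Suc k) (Suc k) (\<lambda>(i, j). ?a i j)"
  have A: "A \<in> carrier_mat (Suc k) (Suc k)" by (simp add: A_def)
  have unique: "j = j'" if "v \<in> X j" "v \<in> X j'" "j < Suc k" "j' < Suc k" for v j j'
    using Suc.prems that by blast
  show ?case
  proof (cases "\<exists>i<Suc k. \<exists>j0<Suc k. \<forall>j<Suc k. j \<noteq> j0 \<longrightarrow> ?a i j = 0")
    case True
    then obtain i j0 where i: "i < Suc k" and j0: "j0 < Suc k"
      and zero: "\<And>j. j < Suc k \<Longrightarrow> j \<noteq> j0 \<Longrightarrow> ?a i j = 0" by blast
    have "det A = (\<Sum>j<Suc k. A $$ (i, j) * cofactor A i j)" by (rule laplace_expansion_row[OF A i])
    also have "\<dots> = (\<Sum>j<Suc k. if j = j0 then ?a i j0 * cofactor A i j0 else 0)"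
      using zero i by (intro sum.cong) (auto simp: A_def)
    also have "\<dots> = ?a i j0 * ((-1) ^ (i + j0) * det (mat_delete A i j0))"
      using j0 by (simp add: cofactor_def)
    finally have det: "det A = ?a i j0 * ((-1) ^ (i + j0) * det (mat_delete A i j0))" .
    have ii: "insert_index l x < Suc k" if "x < k" for l x using that by (simp add: insert_index_def)
    have "mat_delete A i j0 = mat k k (\<lambda>(x, y). of_bool ((u \<circ> insert_index i) x \<in> (X \<circ> insert_index j0) y)
        - of_bool ((s \<circ> insert_index i) x \<in> (X \<circ> insert_index j0) y))"
      (is "_ = ?B")
    proof (rule eq_matI)
      fix x y assume "x < dim_row ?B" "y < dim_col ?B"
      then have xy: "x < k" "y < k" by simp_all
      have "mat_delete A i j0 $$ (x, y) = A $$ (insert_index i x, insert_index j0 y)"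
        using mat_delete_index[OF A i j0 xy] by simp
      then show "mat_delete A i j0 $$ (x, y) = ?B $$ (x, y)" using xy ii by (simp add: A_def)
    qed (simp_all add: A_def)
    moreover have "det ?B \<in> {-1, 0, 1}"
    proof (rule Suc.IH)
      fix x y assume "x < k" "y < k" "x \<noteq> y"
      then show "(X \<circ> insert_index j0) x \<inter> (X \<circ> insert_index j0) y = {}"
        using Suc.prems[OF ii ii, of x y j0 j0] by (auto simp: insert_index_def split: if_splits)
    qed
    ultimately have "det (mat_delete A i j0) \<in> {-1, 0, 1}" by simp
    moreover have "(-1 :: real) ^ (i + j0) \<in> {-1, 0, 1}" by (cases "even (i + j0)") auto
    moreover have "?a i j0 \<in> {-1, 0, 1}" by auto
    ultimately have "det A \<in> {-1, 0, 1}" unfolding det by (intro sign_mult)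
    then show ?thesis by (simp add: A_def)
  next
    case False
    have in_some: "(\<exists>j<Suc k. u i \<in> X j) \<and> (\<exists>j<Suc k. s i \<in> X j)" if i: "i < Suc k" for i
    proof (rule ccontr)
      assume none: "\<not> ?thesis"
      have "\<exists>j0<Suc k. \<forall>j<Suc k. j \<noteq> j0 \<longrightarrow> ?a i j = 0"
      proof (cases "\<exists>j0<Suc k. u i \<in> X j0 \<or> s i \<in> X j0")
        case True
        then obtain j0 where j0: "j0 < Suc k" "u i \<in> X j0 \<or> s i \<in> X j0" by blast
        have "?a i j = 0" if "j < Suc k" "j \<noteq> j0" for j
          using none j0 that unique[of "u i" j j0] unique[of "s i" j j0] by auto
        then show ?thesis using j0 by blast
      next
        case False
        then show ?thesis by (intro exI[of _ 0]) auto
      qed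
      then show False using False i by blast
    qed
    have one: "(\<Sum>j<Suc k. of_bool (v \<in> X j) :: real) = 1" if ex: "\<exists>j<Suc k. v \<in> X j" for v
    proof -
      obtain j0 where j0: "j0 < Suc k" "v \<in> X j0" using ex by blast
      have iff: "v \<in> X j \<longleftrightarrow> j = j0" if "j < Suc k" for j
        using unique[OF _ j0(2) that j0(1)] j0(2) by blast
      have "(\<Sum>j<Suc k. of_bool (v \<in> X j) :: real) = (\<Sum>j<Suc k. if j = j0 then 1 else 0)"
        by (intro sum.cong) (simp_all add: iff)
      then show ?thesis using j0 by simp
    qed
    let ?v = "vec (Suc k) (\<lambda>_. 1 :: real)"
    have "A *\<^sub>v ?v = 0\<^sub>v (Suc k)"
    proof (rule eq_vecI)
      fix i assume "i < dim_vec (0\<^sub>v (Suc k) :: real vec)"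
      then have i: "i < Suc k" by simp
      have "(A *\<^sub>v ?v) $ i = (\<Sum>j<Suc k. ?a i j)"
        using i by (simp add: A_def scalar_prod_def lessThan_atLeast0)
      also have "\<dots> = 0" using one in_some[OF i] by (simp add: sum_subtractf del: sum.lessThan_Suc)
      finally show "(A *\<^sub>v ?v) $ i = 0\<^sub>v (Suc k) $ i" using i by simp
    qed (simp add: A_def)
    moreover have "?v \<noteq> 0\<^sub>v (Suc k)"
    proof
      assume "?v = 0\<^sub>v (Suc k)"
      then have "?v $ 0 = 0\<^sub>v (Suc k) $ 0" by simp
      then show False by simp
    qed
    ultimately have "det A = 0" using det_0_iff_vec_prod_zero[OF A] vec_carrier by blast
    then show ?thesis by (simp add: A_def)
  qed
qed

definition laminar :: "'i set \<Rightarrow> ('i \<Rightarrow> 'p set) \<Rightarrow> bool" where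
  "laminar I X \<longleftrightarrow> (\<forall>i\<in>I. \<forall>j\<in>I. X i \<subseteq> X j \<or> X j \<subseteq> X i \<or> X i \<inter> X j = {})"

text \<open>Column operations turn a laminar family into a disjoint one.\<close>

lemma det_difference_laminar:
  fixes s u :: "nat \<Rightarrow> 'p" and X :: "nat \<Rightarrow> 'p set"
  assumes "laminar {..<k} X" "\<And>i. i < k \<Longrightarrow> finite (X i)"
  shows "det (mat k k (\<lambda>(i, j). of_bool (u i \<in> X j) - of_bool (s i \<in> X j) :: real)) \<in> {-1, 0, 1}"
  using assms
proof (induction "\<Sum>i<k. card (X i)" arbitrary: X rule: less_induct)
  case less
  let ?A = "\<lambda>X :: nat \<Rightarrow> 'p set. mat k k (\<lambda>(i, j). of_bool (u i \<in> X j) - of_bool (s i \<in> X j) :: real)"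
  have lam: "X i \<subseteq> X j \<or> X j \<subseteq> X i \<or> X i \<inter> X j = {}" if "i < k" "j < k" for i j
    using less.prems(1) that by (simp add: laminar_def)
  show ?case
  proof (cases "\<forall>i<k. \<forall>j<k. i \<noteq> j \<longrightarrow> X i \<inter> X j = {}")
    case True
    then show ?thesis by (intro det_difference_disjoint) blast
  next
    case False
    then obtain i0 p where i0: "i0 < k" "p < k" "i0 \<noteq> p" "X i0 \<inter> X p \<noteq> {}" "X i0 \<subseteq> X p"
      using lam by (metis inf_commute)
    show ?thesis
    proof (cases "X i0 = X p")
      case True
      have "col (?A X) i0 = col (?A X) p" using i0 True by (intro eq_vecI) auto
      then have "det (?A X) = 0" using i0 by (intro det_identical_columns[of _ k i0 p]) auto
      then show ?thesis by simp
    next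
      case False
      \<comment> \<open>A largest nonempty set properly inside \<open>X p\<close> is needed: no set
        lies strictly between the two, so what is left of \<open>X p\<close> after subtraction is
        still laminar with the others.\<close>
      define cand where "cand = {i. i < k \<and> X i \<subset> X p \<and> X i \<noteq> {}}"
      have "i0 \<in> cand" using i0 False by (auto simp: cand_def)
      moreover have "finite cand" by (simp add: cand_def)
      ultimately have "Max ((\<lambda>i. card (X i)) ` cand) \<in> (\<lambda>i. card (X i)) ` cand" by (intro Max_in) auto
      then obtain i where ic: "i \<in> cand" and imax: "Max ((\<lambda>i. card (X i)) ` cand) = card (X i)" by blast
      have i: "i < k" "X i \<subset> X p" "X i \<noteq> {}" using ic by (auto simp: cand_def)
      have max: "card (X j) \<le> card (X i)" if "j < k" "X j \<subset> X p" "X j \<noteq> {}" for j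
        unfolding imax[symmetric] using \<open>finite cand\<close> that by (intro Max_ge) (auto simp: cand_def)
      have ip: "i \<noteq> p" using i by blast
      define X' where "X' = X(p := X p - X i)"
      have "?A X' = addcol (-1) p i (?A X)"
        using i ip i0(2) by (intro eq_matI) (auto simp: X'_def mat_addcol_def)
      then have det: "det (?A X') = det (?A X)" using i(1) ip by (simp add: det_addcol[of i k p])
      have key: "X j \<subseteq> X p - X i \<or> X p - X i \<subseteq> X j \<or> X j \<inter> (X p - X i) = {}" if j: "j < k" for j
      proof -
        consider "X p \<subseteq> X j" | "X j \<inter> X p = {}" | "X j \<subset> X p" "X j \<noteq> {}" using lam[OF j i0(2)] by blast
        then show ?thesis
        proof cases
          case 3
          have "\<not> X i \<subset> X j"
            using max[OF j 3] psubset_card_mono[OF less.prems(2)[OF j], of "X i"] by linarith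
          then show ?thesis using lam[OF j i(1)] 3 by blast
        qed blast+
      qed
      have "laminar {..<k} X'"
        unfolding laminar_def
      proof (intro ballI)
        fix x y assume "x \<in> {..<k}" "y \<in> {..<k}"
        then have xy: "x < k" "y < k" by simp_all
        consider "x = p" "y = p" | "x \<noteq> p" "y = p" | "x = p" "y \<noteq> p" | "x \<noteq> p" "y \<noteq> p" by blast
        then show "X' x \<subseteq> X' y \<or> X' y \<subseteq> X' x \<or> X' x \<inter> X' y = {}"
        proof cases
          case 2
          then show ?thesis using key[OF xy(1)] unfolding X'_def by auto
        next
          case 3
          then show ?thesis using key[OF xy(2)] unfolding X'_def by auto
        next
          case 4
          then show ?thesis using lam[OF xy] unfolding X'_def by auto
        qed simp
      qed
      moreover have "finite (X' j)" if "j < k" for j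
        using less.prems(2)[OF that] less.prems(2)[OF i0(2)] by (simp add: X'_def)
      moreover have "(\<Sum>j<k. card (X' j)) < (\<Sum>j<k. card (X j))"
      proof (rule sum_strict_mono_ex1)
        have fp: "finite (X p)" using less.prems(2)[OF i0(2)] .
        show "\<forall>j\<in>{..<k}. card (X' j) \<le> card (X j)" using fp by (auto simp: X'_def intro: card_mono)
        have "X p - X i \<subset> X p" using i by blast
        then have "card (X' p) < card (X p)" using fp psubset_card_mono by (simp add: X'_def)
        then show "\<exists>j\<in>{..<k}. card (X' j) < card (X j)" using i0(2) by blast
      qed simp
      ultimately have "det (?A X') \<in> {-1, 0, 1}" by (intro less.hyps)
      then show ?thesis unfolding det .
    qed
  qed
qed

section \<open>Spanning forests and the representing matrix\<close>

context fin_arc_system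
begin

text \<open>Spanning is expressed through real potentials: those constant along the arcs of
  \<open>T\<close> are constant along all arcs. In this form \<open>regular_bmat\<close> extends an
  equality of potential differences from the forest to \<open>E\<close>.\<close>

definition constant_on :: "'a set \<Rightarrow> ('b \<Rightarrow> real) \<Rightarrow> bool" where
  "constant_on T q \<longleftrightarrow> (\<forall>e\<in>T. q (t e) = q (h e))"

text \<open>
  A rooted spanning forest \<open>T\<close> of the vertices \<open>R\<close> reached so far, where \<open>Y e\<close> is the set of
  descendants below the tree arc \<open>e\<close> and \<open>K\<close> is the component that is currently being grown.
\<close>

definition partial_forest :: "'b set \<Rightarrow> 'b set \<Rightarrow> 'a set \<Rightarrow> ('a \<Rightarrow> 'b set) \<Rightarrow> bool" where
  "partial_forest R K T Y \<longleftrightarrow>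
     R \<subseteq> ends \<and> K \<subseteq> R \<and> T \<subseteq> inside R \<and> (\<forall>e\<in>T. Y e \<subseteq> R) \<and> laminar T Y \<and>
     (\<forall>e\<in>T. \<forall>f\<in>T. f \<in> cut (Y e) \<longleftrightarrow> f = e) \<and>
     (\<forall>q. constant_on T q \<longrightarrow> (\<forall>u\<in>K. \<forall>v\<in>K. q u = q v) \<and> constant_on (inside R) q) \<and>
     (\<forall>e\<in>E. (t e \<in> R \<and> h e \<notin> R \<longrightarrow> t e \<in> K) \<and> (h e \<in> R \<and> t e \<notin> R \<longrightarrow> h e \<in> K))"

text \<open>If no arc leads out of \<open>R\<close>, its components are finished and a new one
  starts at a fresh root. Otherwise \<open>v\<close> is hung below a reached vertex \<open>u\<close>
  by \<open>e\<close>: it becomes a descendant of \<open>e\<close> and of exactly those tree arcs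
  that \<open>u\<close> lies below.\<close>

lemma grow_partial_forest:
  assumes F: "partial_forest R K T Y" and "R \<noteq> ends"
  shows "\<exists>v K' T' Y'. v \<in> ends - R \<and> partial_forest (insert v R) K' T' Y'"
proof -
  have R: "R \<subseteq> ends" "K \<subseteq> R" "T \<subseteq> inside R" and YR: "\<And>e. e \<in> T \<Longrightarrow> Y e \<subseteq> R" and lam: "laminar T Y"
    and fund: "\<And>e f. e \<in> T \<Longrightarrow> f \<in> T \<Longrightarrow> f \<in> cut (Y e) \<longleftrightarrow> f = e"
    and K: "\<And>q u v. constant_on T q \<Longrightarrow> u \<in> K \<Longrightarrow> v \<in> K \<Longrightarrow> q u = q v"
    and span: "\<And>q. constant_on T q \<Longrightarrow> constant_on (inside R) q"
    and tK: "\<And>e. e \<in> E \<Longrightarrow> t e \<in> R \<Longrightarrow> h e \<notin> R \<Longrightarrow> t e \<in> K"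
    and hK: "\<And>e. e \<in> E \<Longrightarrow> h e \<in> R \<Longrightarrow> t e \<notin> R \<Longrightarrow> h e \<in> K"
    using F unfolding partial_forest_def by simp_all
  show ?thesis
  proof (cases "cut R = {}")
    case True
    then have none: "t e \<in> R \<longleftrightarrow> h e \<in> R" if "e \<in> E" for e using that by (auto simp: cut_def)
    obtain v where v: "v \<in> ends - R" using R \<open>R \<noteq> ends\<close> by blast
    have "partial_forest (insert v R) {v} T Y"
      unfolding partial_forest_def
    proof (intro conjI allI impI)
      show "insert v R \<subseteq> ends" "{v} \<subseteq> insert v R" "T \<subseteq> inside (insert v R)" using R v by (auto simp: inside_def)
      show "\<forall>e\<in>T. Y e \<subseteq> insert v R" using YR by blast
      show "laminar T Y" by (rule lam)
      show "\<forall>e\<in>T. \<forall>f\<in>T. f \<in> cut (Y e) \<longleftrightarrow> f = e" using fund by simp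
      fix q assume q: "constant_on T q"
      show "\<forall>u\<in>{v}. \<forall>w\<in>{v}. q u = q w" by simp
      show "constant_on (inside (insert v R)) q"
        unfolding constant_on_def
      proof
        fix f assume f: "f \<in> inside (insert v R)"
        then have "f \<in> inside R \<or> t f = h f" using none[of f] v by (auto simp: inside_def)
        then show "q (t f) = q (h f)" using span[OF q] by (auto simp: constant_on_def)
      qed
    next
      show "\<forall>e\<in>E. (t e \<in> insert v R \<and> h e \<notin> insert v R \<longrightarrow> t e \<in> {v}) \<and>
          (h e \<in> insert v R \<and> t e \<notin> insert v R \<longrightarrow> h e \<in> {v})"
        using none by auto
    qed
    then show ?thesis using v by blast
  next
    case False
    then obtain e where e: "e \<in> E" "(t e \<in> R) \<noteq> (h e \<in> R)" by (auto simp: cut_def)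
    define u v where "u = (if t e \<in> R then t e else h e)" and "v = (if t e \<in> R then h e else t e)"
    have uv: "{t e, h e} = {u, v}" by (auto simp: u_def v_def)
    have u: "u \<in> R" "u \<in> K" using e tK[of e] hK[of e] by (auto simp: u_def)
    have v: "v \<in> ends" "v \<notin> R" using e arc_ends[of e] by (auto simp: v_def)
    have eT: "e \<notin> T" using R(3) e by (auto simp: inside_def)
    define Y' where "Y' f = (if f = e then {v} else if u \<in> Y f then insert v (Y f) else Y f)" for f
    have Y'R: "Y' f \<inter> R = Y f" "v \<in> Y' f \<longleftrightarrow> u \<in> Y f" "Y' f \<subseteq> insert v R" if "f \<in> T" for f
      using YR[OF that] v that eT by (auto simp: Y'_def)
    have Y'e: "Y' e = {v}" by (simp add: Y'_def)
    have cut_e: "e \<in> cut Z \<longleftrightarrow> (u \<in> Z) \<noteq> (v \<in> Z)" for Z using uv e(1) by (auto simp: cut_def doubleton_eq_iff)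
    have "partial_forest (insert v R) (insert v K) (insert e T) Y'"
      unfolding partial_forest_def
    proof (intro conjI allI impI)
      show "insert v R \<subseteq> ends" "insert v K \<subseteq> insert v R" using R v by auto
      show "insert e T \<subseteq> inside (insert v R)"
        using R(3) e u uv by (auto simp: inside_def doubleton_eq_iff)
      show "\<forall>f\<in>insert e T. Y' f \<subseteq> insert v R" using Y'R(3) Y'e by auto
      show "laminar (insert e T) Y'"
        unfolding laminar_def
      proof (intro ballI)
        have one: "Y' e \<subseteq> Y' f \<or> Y' e \<inter> Y' f = {}" for f unfolding Y'e by blast
        fix f g assume fg: "f \<in> insert e T" "g \<in> insert e T"
        show "Y' f \<subseteq> Y' g \<or> Y' g \<subseteq> Y' f \<or> Y' f \<inter> Y' g = {}"
        proof (cases "f = e \<or> g = e")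
          case True
          then show ?thesis using one by blast
        next
          case False
          then have "f \<in> T" "g \<in> T" "f \<noteq> e" "g \<noteq> e" using fg by auto
          moreover from this have "Y f \<subseteq> Y g \<or> Y g \<subseteq> Y f \<or> Y f \<inter> Y g = {}"
            using lam by (simp add: laminar_def)
          moreover have "v \<notin> Y f" "v \<notin> Y g" using YR v \<open>f \<in> T\<close> \<open>g \<in> T\<close> by blast+
          ultimately show ?thesis unfolding Y'_def by auto
        qed
      qed
      show "\<forall>f\<in>insert e T. \<forall>g\<in>insert e T. g \<in> cut (Y' f) \<longleftrightarrow> g = f"
      proof (intro ballI)
        fix f g assume fg: "f \<in> insert e T" "g \<in> insert e T"
        consider "f = e" "g = e" | "f = e" "g \<in> T" | "f \<in> T" "g = e" | "f \<in> T" "g \<in> T" using fg by blast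
        then show "g \<in> cut (Y' f) \<longleftrightarrow> g = f"
        proof cases
          case 1
          then show ?thesis using cut_e[of "{v}"] Y'e u v by auto
        next
          case 2
          then have "t g \<noteq> v" "h g \<noteq> v" using R(3) v by (auto simp: inside_def)
          then show ?thesis using 2 Y'e eT by (auto simp: cut_def)
        next
          case 3
          then have "u \<in> Y' f \<longleftrightarrow> u \<in> Y f" using Y'R(1)[OF 3(1)] u by blast
          then show ?thesis using 3 cut_e[of "Y' f"] Y'R(2)[OF 3(1)] eT by auto
        next
          case 4
          have "t g \<in> R" "h g \<in> R" using 4 R(3) by (auto simp: inside_def)
          then have "g \<in> cut (Y' f) \<longleftrightarrow> g \<in> cut (Y f)" using Y'R(1)[OF 4(1)] by (auto simp: cut_def)
          then show ?thesis using fund[OF 4] by simp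
        qed
      qed
      fix q assume "constant_on (insert e T) q"
      then have q: "constant_on T q" "q (t e) = q (h e)" by (auto simp: constant_on_def)
      then have quv: "q u = q v" using uv by (auto simp: doubleton_eq_iff)
      have Kv: "q w = q v" if "w \<in> K" for w using K[OF q(1) that u(2)] quv by simp
      show "\<forall>x\<in>insert v K. \<forall>y\<in>insert v K. q x = q y" using Kv by auto
      show "constant_on (inside (insert v R)) q"
        unfolding constant_on_def
      proof
        fix f assume f: "f \<in> inside (insert v R)"
        then have fE: "f \<in> E" by (simp add: inside_def)
        consider "f \<in> inside R" | "t f = v" "h f = v" | "t f = v" "h f \<in> R" | "h f = v" "t f \<in> R"
          using f by (auto simp: inside_def)
        then show "q (t f) = q (h f)"
        proof cases
          case 1
          then show ?thesis using span[OF q(1)] by (simp add: constant_on_def)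
        next
          case 3
          then show ?thesis using Kv[OF hK[OF fE]] v by simp
        next
          case 4
          then show ?thesis using Kv[OF tK[OF fE]] v by simp
        qed simp
      qed
    next
      show "\<forall>e\<in>E. (t e \<in> insert v R \<and> h e \<notin> insert v R \<longrightarrow> t e \<in> insert v K) \<and>
          (h e \<in> insert v R \<and> t e \<notin> insert v R \<longrightarrow> h e \<in> insert v K)"
        using tK hK by auto
    qed
    then show ?thesis using v by blast
  qed
qed

lemma spanning_forest:
  "\<exists>T Y. T \<subseteq> E \<and> (\<forall>e\<in>T. finite (Y e)) \<and> laminar T Y \<and>
    (\<forall>e\<in>T. \<forall>f\<in>T. f \<in> cut (Y e) \<longleftrightarrow> f = e) \<and> (\<forall>q. constant_on T q \<longrightarrow> constant_on E q)"
proof -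
  have "\<exists>K T Y. partial_forest R K T Y \<Longrightarrow> \<exists>K T Y. partial_forest ends K T Y" for R
  proof (induction "card (ends - R)" arbitrary: R rule: less_induct)
    case less
    show ?case
    proof (cases "R = ends")
      case False
      then obtain v K' T' Y' where v: "v \<in> ends - R" "partial_forest (insert v R) K' T' Y'"
        using grow_partial_forest less.prems by blast
      have "ends - insert v R \<subset> ends - R" using v by blast
      then have "card (ends - insert v R) < card (ends - R)" using finite_ends by (intro psubset_card_mono) auto
      then show ?thesis using less.hyps v(2) by blast
    qed (use less.prems in blast)
  qed
  moreover have "partial_forest {} {} {} (\<lambda>_. {})"
    by (auto simp: partial_forest_def laminar_def constant_on_def inside_def)
  ultimately obtain K T Y where F: "partial_forest ends K T Y" by blast
  have inside: "inside ends = E" using arc_ends by (auto simp: inside_def)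
  have "T \<subseteq> E \<and> (\<forall>e\<in>T. Y e \<subseteq> ends) \<and> laminar T Y \<and>
    (\<forall>e\<in>T. \<forall>f\<in>T. f \<in> cut (Y e) \<longleftrightarrow> f = e) \<and> (\<forall>q. constant_on T q \<longrightarrow> constant_on E q)"
    using F unfolding partial_forest_def inside by simp
  then show ?thesis using finite_subset[OF _ finite_ends] by (intro exI[of _ T] exI[of _ Y]) auto
qed

text \<open>
  The representing matrix is the fundamental cycle matrix of the forest \<open>T\<close>. Splitting the head of
  every arc \<open>f\<close> off as a new vertex \<open>Inr f\<close> makes the unit columns of the arcs outside \<open>T\<close> differences
  of indicators as well.
\<close>

lemma regular_bmat: "regular_matroid (underlying_matroid bmat)"
proof -
  obtain T Y where forest: "T \<subseteq> E \<and> (\<forall>e\<in>T. finite (Y e)) \<and> laminar T Y \<and>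
    (\<forall>e\<in>T. \<forall>f\<in>T. f \<in> cut (Y e) \<longleftrightarrow> f = e) \<and> (\<forall>q. constant_on T q \<longrightarrow> constant_on E q)"
    using spanning_forest by (elim exE)
  have TE: "T \<subseteq> E" and finY: "\<And>e. e \<in> T \<Longrightarrow> finite (Y e)" and lam: "laminar T Y"
    and fund: "\<And>e f. e \<in> T \<Longrightarrow> f \<in> T \<Longrightarrow> f \<in> cut (Y e) \<longleftrightarrow> f = e"
    and span: "\<And>q. constant_on T q \<Longrightarrow> constant_on E q"
    using forest by simp_all
  have finT: "finite T" using TE finite_E finite_subset by blast
  define r where "r = card (E - T)"
  obtain row where row: "bij_betw row {..<r} (E - T)"
    using ex_bij_betw_nat_finite[of "E - T"] finite_E by (auto simp: r_def atLeast0LessThan)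
  have rowE: "row i \<in> E - T" if "i < r" for i using row that by (auto simp: bij_betw_def)
  define X where "X e = (if e \<in> T then Inl ` Y e \<union> Inr ` {f \<in> E. h f \<in> Y e} else {Inr e})" for e
  define A where "A i e = (of_bool (Inr (row i) \<in> X e) - of_bool (Inl (t (row i)) \<in> X e) :: real)" for i e
  have finX: "finite (X e)" for e using finY finite_E by (simp add: X_def)
  have lamX: "laminar E X"
    unfolding laminar_def
  proof (intro ballI)
    fix e f assume "e \<in> E" "f \<in> E"
    have single: "X e \<subseteq> X f \<or> X e \<inter> X f = {}" if "e \<notin> T" for e f using that by (auto simp: X_def)
    show "X e \<subseteq> X f \<or> X f \<subseteq> X e \<or> X e \<inter> X f = {}"
    proof (cases "e \<in> T \<and> f \<in> T")
      case True
      then have "Y e \<subseteq> Y f \<or> Y f \<subseteq> Y e \<or> Y e \<inter> Y f = {}" using lam by (simp add: laminar_def)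
      then show ?thesis using True unfolding X_def by auto
    next
      case False
      then show ?thesis using single[of e f] single[of f e] by blast
    qed
  qed
  have tu: "totally_unimodular r E A"
    unfolding totally_unimodular_def
  proof (intro allI ballI)
    fix k :: nat and f :: "nat \<Rightarrow> nat" and g assume f: "f \<in> {..<k} \<rightarrow> {..<r}" and g: "g \<in> {..<k} \<rightarrow> E"
    have "laminar {..<k} (X \<circ> g)" using lamX g unfolding laminar_def by auto
    from det_difference_laminar[OF this, of "\<lambda>i. Inr (row (f i))" "\<lambda>i. Inl (t (row (f i)))"]
    show "det (mat k k (\<lambda>(i, j). A (f i) (g j))) \<in> {-1, 0, 1}" using finX by (simp add: A_def)
  qed
  define \<phi> where "\<phi> e v = (of_bool (v \<in> Y e) :: real)" for e v
  have A_tree: "A i e = \<phi> e (h (row i)) - \<phi> e (t (row i))" if "i < r" "e \<in> T" for i e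
    using rowE[OF that(1)] that(2) by (auto simp: A_def X_def \<phi>_def)
  have A_cotree: "A i e = of_bool (row i = e)" if "e \<notin> T" for i e
    using that by (auto simp: A_def X_def)
  define \<epsilon> where "\<epsilon> e = \<phi> e (h e) - \<phi> e (t e)" for e
  have \<epsilon>: "\<epsilon> e = 1 \<or> \<epsilon> e = -1" if "e \<in> T" for e
    using fund[OF that that] by (auto simp: \<epsilon>_def \<phi>_def cut_def)
  have fund': "\<phi> e (h f) - \<phi> e (t f) = (if e = f then \<epsilon> f else 0)" if "e \<in> T" "f \<in> T" for e f
    using fund[OF that] TE that by (auto simp: \<epsilon>_def \<phi>_def cut_def)
  \<comment> \<open>Coefficients \<open>c\<close> are read as a potential whose jump along a tree
    arc \<open>f\<close> is \<open>c f * \<epsilon> f\<close>. By \<open>row_sum\<close>, a linear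
    relation says that each arc outside \<open>T\<close> has as coefficient the negative of its
    jump.\<close>
  define pot where "pot c v = (\<Sum>e\<in>T. c e * \<phi> e v)" for c :: "'a \<Rightarrow> real" and v
  have pot_diff: "pot c (h f) - pot c (t f) = (\<Sum>e\<in>T. c e * (\<phi> e (h f) - \<phi> e (t f)))" for c f
    unfolding pot_def by (simp add: sum_subtractf algebra_simps)
  have pot_tree: "pot c (h f) - pot c (t f) = c f * \<epsilon> f" if "f \<in> T" for c f
  proof -
    have "pot c (h f) - pot c (t f) = (\<Sum>e\<in>T. if e = f then c f * \<epsilon> f else 0)"
      unfolding pot_diff using that by (intro sum.cong) (auto simp: fund')
    then show ?thesis using that finT by simp
  qed
  have row_sum: "(\<Sum>e\<in>E. c e * A i e) = pot c (h (row i)) - pot c (t (row i)) + c (row i)" if i: "i < r" for c i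
  proof -
    have "(\<Sum>e\<in>E. c e * A i e) = (\<Sum>e\<in>E - T. c e * A i e) + (\<Sum>e\<in>T. c e * A i e)"
      by (rule sum.subset_diff[OF TE finite_E])
    moreover have "(\<Sum>e\<in>T. c e * A i e) = pot c (h (row i)) - pot c (t (row i))"
      unfolding pot_diff using A_tree[OF i] by (intro sum.cong) auto
    moreover have "(\<Sum>e\<in>E - T. c e * A i e) = (\<Sum>e\<in>E - T. if e = row i then c (row i) else 0)"
      by (intro sum.cong) (auto simp: A_cotree)
    ultimately show ?thesis using rowE[OF i] finite_E by simp
  qed
  have "indep (underlying_matroid bmat) S \<longleftrightarrow> independent_columns r A S" if S: "S \<subseteq> E" for S
  proof
    assume ind: "indep (underlying_matroid bmat) S"
    show "independent_columns r A S"
      unfolding independent_columns_def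
    proof (intro allI impI ballI)
      fix c :: "'a \<Rightarrow> real" and g
      assume c: "\<forall>i<r. (\<Sum>e\<in>S. c e * A i e) = 0" and g: "g \<in> S"
      define d where "d e = (if e \<in> S then c e else 0)" for e
      have "(\<Sum>e\<in>S. c e * A i e) = (\<Sum>e\<in>E. d e * A i e)" for i
        using S finite_E by (intro sum.mono_neutral_cong_left) (auto simp: d_def)
      then have zero: "pot d (h (row i)) - pot d (t (row i)) + d (row i) = 0" if "i < r" for i
        using c[rule_format, OF that] row_sum[OF that, of d] by simp
      have moves: "pot d (h f) \<noteq> pot d (t f) \<longleftrightarrow> d f \<noteq> 0" if f: "f \<in> E" for f
      proof (cases "f \<in> T")
        case True
        then show ?thesis using pot_tree[OF True, of d] \<epsilon>[OF True] by auto
      next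
        case False
        then obtain i where "i < r" "f = row i" using f row by (auto simp: bij_betw_def)
        then show ?thesis using zero[of i] by auto
      qed
      show "c g = 0"
      proof (rule ccontr)
        assume "c g \<noteq> 0"
        then have "pot d (h g) \<noteq> pot d (t g)" using moves[of g] g S by (auto simp: d_def)
        \<comment> \<open>The threshold is the larger of the values at the ends of \<open>g\<close>,
          so the level set separates them. Only arcs along which the potential changes cross it;
          these have nonzero coefficients and lie in \<open>S\<close>.\<close>
        define Z where "Z = {v. pot d v \<ge> max (pot d (h g)) (pot d (t g))}"
        have "g \<in> cut Z" using \<open>pot d (h g) \<noteq> pot d (t g)\<close> g S by (auto simp: cut_def Z_def)
        moreover have "cut Z \<subseteq> S"
        proof
          fix f assume f: "f \<in> cut Z"
          then have "pot d (h f) \<noteq> pot d (t f)" by (auto simp: cut_def Z_def)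
          then have "d f \<noteq> 0" using moves f cut_subset by blast
          then show "f \<in> S" by (auto simp: d_def split: if_splits)
        qed
        ultimately show False using ind unfolding indep_bmat by blast
      qed
    qed
  next
    assume cols: "independent_columns r A S"
    show "indep (underlying_matroid bmat) S"
      unfolding indep_bmat
    proof (intro conjI allI impI notI)
      fix Z assume "cut Z \<noteq> {}" and Z: "cut Z \<subseteq> S"
      then obtain g where g: "g \<in> cut Z" by blast
      define q where "q v = (of_bool (v \<in> Z) :: real)" for v
      define d where "d e = q (h e) - q (t e)" for e
      \<comment> \<open>Chosen so that \<open>pot c\<close> jumps like the indicator of
        \<open>Z\<close>: on tree arcs because \<epsilon> squares to 1, on the others by spanning.
        The rows then cancel.\<close>
      define c where "c e = (if e \<in> T then \<epsilon> e * d e else - d e)" for e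
      have "constant_on T (\<lambda>v. q v - pot c v)"
        unfolding constant_on_def
      proof
        fix f assume f: "f \<in> T"
        have "\<epsilon> f * d f * \<epsilon> f = d f" using \<epsilon>[OF f] by auto
        then have "pot c (h f) - pot c (t f) = d f" using pot_tree[OF f, of c] f by (simp add: c_def)
        then show "q (t f) - pot c (t f) = q (h f) - pot c (h f)" by (simp add: d_def)
      qed
      then have "constant_on E (\<lambda>v. q v - pot c v)" by (rule span)
      then have pot_c: "pot c (h f) - pot c (t f) = d f" if "f \<in> E" for f
        using that unfolding constant_on_def d_def by (auto simp: algebra_simps)
      have off: "c e = 0" if "e \<in> E" "e \<notin> cut Z" for e
        using that by (auto simp: c_def d_def q_def cut_def)
      have "(\<Sum>e\<in>S. c e * A i e) = 0" if i: "i < r" for i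
      proof -
        have "(\<Sum>e\<in>S. c e * A i e) = (\<Sum>e\<in>E. c e * A i e)"
          using S finite_E Z off by (intro sum.mono_neutral_left) auto
        then show ?thesis using row_sum[OF i, of c] pot_c[of "row i"] rowE[OF i] by (simp add: c_def)
      qed
      then have "c g = 0" using cols g Z unfolding independent_columns_def by blast
      moreover have "d g \<noteq> 0" using g by (auto simp: d_def q_def cut_def)
      ultimately show False using \<epsilon>[of g] by (auto simp: c_def split: if_splits)
    qed (rule S)
  qed
  moreover have "ground (underlying_matroid bmat) = E" by (simp add: underlying_matroid_def)
  ultimately show ?thesis unfolding regular_matroid_def using tu by auto
qed

end

theorem theorem1p9:
  fixes M :: "'a oriented_matroid"
  assumes "oriented_bond_matroid M"
  shows "non_even M \<longleftrightarrow>
    \<not> (\<exists>N m n. gb_minor M N \<and> m \<ge> 2 \<and> n \<ge> 2 \<and> odd (m + n) \<and>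
               om_iso N (bond_matroid (complete_bipartite_dir m n)))"
proof -
  obtain t h :: "'a \<Rightarrow> nat" where M: "M = arc_system.bmat (elements M) t h" and fin: "finite (elements M)"
    using oriented_bond_matroid_bmat[OF assms] .
  interpret fin_arc_system "elements M" t h by unfold_locales (rule fin)
  have non_even: "non_even M \<longleftrightarrow> has_odd_join"
    unfolding non_even_def has_odd_join_iff M[symmetric] using regular_bmat[folded M] by simp
  have "\<not> has_odd_join" if minor: "gb_minor M N" and mn: "m \<ge> 2" "n \<ge> 2" "odd (m + n)"
    and iso: "om_iso N (bond_matroid (complete_bipartite_dir m n))" for N m n
  proof
    assume has_odd_join
    then obtain E' and t' h' :: "'a \<Rightarrow> nat" where N: "N = arc_system.bmat E' t' h'" "finite E'"
      "arc_system.has_odd_join E' t' h'"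
      using gb_minor_bmat[OF minor M fin] by blast
    interpret N: fin_arc_system E' t' h' by unfold_locales fact
    interpret K: fin_arc_system "{..<m} \<times> {..<n}" "\<lambda>e. Inl (fst e) :: nat + nat" "\<lambda>e. Inr (snd e)"
      by unfold_locales simp
    have "\<exists>J\<subseteq>elements N. \<forall>C. directed_circuit N C \<longrightarrow> odd (card (supp C \<inter> J))"
      using N(3) unfolding N(1) N.has_odd_join_iff .
    moreover have "supp C \<subseteq> elements N" if "C \<in> signed_circuits N" for C
      using that subsetD[OF N.cut_subset] unfolding N(1) N.signed_circuits_bmat by (auto simp: N.supp_leave)
    ultimately have K.has_odd_join
      unfolding K.has_odd_join_iff bond_matroid_complete_bipartite[symmetric]
      using om_iso_odd_join[OF iso] by blast
    then show False using complete_bipartite_no_odd_join[OF mn] by blast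
  qed
  moreover have "\<exists>N m n. gb_minor M N \<and> m \<ge> 2 \<and> n \<ge> 2 \<and> odd (m + n) \<and>
      om_iso N (bond_matroid (complete_bipartite_dir m n))" if "\<not> has_odd_join"
    using even_has_forbidden_minor[OF fin that] unfolding M[symmetric] .
  ultimately show ?thesis unfolding non_even by blast
qed

end
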